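(* Let $d\ge2$, let $\mathcal{C}=\{Q_0,\dots,Q_{r-1}\}$ be a toric constellation with origin over $X=\mathbb{C}^d$, and let $P(\underline t)$ be the Poincaré series of the multi-index filtration on $\mathcal{O}_{\mathbb{C}^d,o}$ defined by the divisorial valuations $\nu_1,\dots,\nu_r$ of the exceptional components $E_1,\dots,E_r$. Let $\underline v_1,\underline v_2,\dots,\underline v_s\in\mathbb{Z}^r$ be the different columns of the matrix $\mathcal{L}(\mathcal{C})$ of the linear system determined by the constellation. Then $$P(\underline t)=\frac{1}{(1-\underline t^{\underline v_1})^{\chi(D_{\underline v_1})}\cdots(1-\underline t^{\underline v_s})^{\chi(D_{\underline v_s})}},$$ where $\chi$ denotes the Euler characteristic.
   Context: Constellations: $X=X_0=\mathbb{C}^d$ has coordinates $x_1,\dots,x_d$ and carries the standard action of the torus $T=(\mathbb{C}^* )^d$; $o$ is the origin. A toric constellation with origin is a finite sequence $\mathcal{C}=\{Q_0,\dots,Q_{r-1}\}$, $r\ge 1$, where $Q_0=o\in X_0$, $X_j\to X_{j-1}$ is the blowing-up of the point $Q_{j-1}$ ($1\le j\le r$), and each $Q_j$ ($1\le j\le r-1$) is a $0$-dimensional $T$-orbit of $X_j$ mapping to $Q_0$. Put $Z=X_r$, $\pi:Z\to X$ the composition, $J=\{1,\dots,r\}$. For $j\in J$, $E_j\subset Z$ is the (strict transform in $Z$ of the) exceptional divisor of the blowing-up of $Q_{j-1}$, $\mathcal{D}=\bigcup_{j\in J}E_j$, and $\nu_j$ is the discrete valuation on $\mathcal{O}_{\mathbb{C}^d,o}$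 given by the order of vanishing of $\pi^*g$ along $E_j$ (a monomial valuation). $\underline\nu=(\nu_1,\dots,\nu_r)$. The matrix $\mathcal{L}(\mathcal{C})$: the $r\times d$ matrix of the linear system $\langle s,\underline\nu\rangle=\underline v$ in the unknown $s$, i.e. its $(j,i)$ entry is $\nu_j(x_i)$; its $i$-th column is $\underline\nu(x_i)$. Poincaré series: for $\underline v\in\mathbb{Z}^r$ put $I(\underline v)=\{g\in\mathcal{O}_{\mathbb{C}^d,o}\mid \nu_i(g)\ge v_i,\ 1\le i\le r\}$, $\underline 1=(1,\dots,1)$, $d(\underline v)=\dim_{\mathbb C} I(\underline v)/I(\underline v+\underline 1)$ (finite), $L=\sum_{\underline v\in\mathbb{Z}^r}d(\underline v)\,\underline t^{\underline v}$. Then $\prod_{i=1}^r(t_i-1)L\in\mathbb{Z}[[t_1,\dots,t_r]]$ and $P(\underline t)=\prod_{i=1}^r(t_i-1)L/(t_1\cdots t_r-1)\in\mathbb{Z}[[t_1,\dots,t_r]]$. The space $D_{\underline v}$: for $g\in\mathcal{O}_{\mathbb{C}^d,o}$ let $\{\hat g=0\}$ be the strict transform of $\{g=0\}$ in $Z$ (i.e. the divisor $\mathrm{div}(\pi^*g)-\sum_i\nu_i(g)E_i$ near $\mathcal{D}$). As a set, $$D_{\underline v}=\{\{\hat g=0\}\cap\mathcal{D}\mid g\in\mathcal{O}_{\mathbb{C}^d,o},\ \underline\nu(g)=\underline v,\ \{\hat g=0\}\text{ contains no non-empty intersection }E_a\cap E_b,\ a,b\in J,\ a\ne b\},$$ where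 intersections are taken as divisors, i.e. $\{\hat g=0\}\cap\mathcal{D}$ is recorded by the effective divisors (with multiplicities) cut out by $\hat g$ on the components $E_j$. Topology: with $E_{\underline v}=\sum_{i=1}^rv_iE_i$, let $R$ be the restriction to $\mathcal{D}$ of the line bundle $\mathcal{O}_Z(-E_{\underline v})$; since $\mathcal{D}$ is projective, $H^0(\mathcal{D},R)$ is finite-dimensional. For $g$ with $\underline\nu(g)=\underline v$, $\pi^*g$ is a section of $\mathcal{O}_Z(-E_{\underline v})$ near $\mathcal{D}$ and $\{\hat g=0\}\cap\mathcal{D}$ is the divisor of zeros of its restriction to $\mathcal{D}$, a global section of $R$. Assigning to $\{\hat g=0\}\cap\mathcal{D}$ the class of this section identifies $D_{\underline v}$ with a subset of the projective space $\mathbb{P}H^0(\mathcal{D},R)$, and $D_{\underline v}$ carries the induced topology. *)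

theory Defs
  imports
    "HOL-Analysis.Analysis"
    "HOL-Homology.Homology"
    "HOL-Library.Poly_Mapping"
    "HOL-Library.Extended_Nat"
begin

section \<open>The ring of integral formal power series in the variables t 0, t 1, ...\<close>

typedef mps = "UNIV :: ((nat \<Rightarrow>\<^sub>0 nat) \<Rightarrow> int) set"
  morphisms mps_coeff Abs_mps ..

setup_lifting type_definition_mps

lemma mps_eqI: "(\<And>a. mps_coeff f a = mps_coeff g a) \<Longrightarrow> f = g"
  by (metis mps_coeff_inject ext)

definition splits :: "(nat \<Rightarrow>\<^sub>0 nat) \<Rightarrow> ((nat \<Rightarrow>\<^sub>0 nat) \<times> (nat \<Rightarrow>\<^sub>0 nat)) set" where
  "splits a = {(u, w). u + w = a}"

lemma finite_splits [simp]: "finite (splits a)"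
proof -
  let ?S = "{u. \<exists>w. u + w = a}"
  let ?K = "Poly_Mapping.keys a"
  have eq: "Poly_Mapping.lookup u i = 0" if "u \<in> ?S" "i \<notin> ?K" for u i
    using that by (auto simp: in_keys_iff lookup_add)
  have le: "Poly_Mapping.lookup u i \<le> Poly_Mapping.lookup a i" if "u \<in> ?S" for u i
    using that by (auto simp: lookup_add)
  have "inj_on (\<lambda>u. restrict (Poly_Mapping.lookup u) ?K) ?S"
  proof (rule inj_onI)
    fix u u' assume u: "u \<in> ?S" and u': "u' \<in> ?S"
      and r: "restrict (Poly_Mapping.lookup u) ?K = restrict (Poly_Mapping.lookup u') ?K"
    show "u = u'"
    proof (rule poly_mapping_eqI)
      fix i
      show "Poly_Mapping.lookup u i = Poly_Mapping.lookup u' i"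
        using eq[OF u, of i] eq[OF u', of i] fun_cong[OF r, of i] by (cases "i \<in> ?K") auto
    qed
  qed
  moreover have "(\<lambda>u. restrict (Poly_Mapping.lookup u) ?K) ` ?S
      \<subseteq> (\<Pi>\<^sub>E i\<in>?K. {..Poly_Mapping.lookup a i})"
    using le by auto
  ultimately have "finite ?S"
    by (meson finite_PiE finite_atMost finite_keys inj_on_finite)
  moreover have "inj_on fst (splits a)"
    by (auto simp: inj_on_def splits_def)
  moreover have "fst ` splits a \<subseteq> ?S"
    by (auto simp: splits_def)
  ultimately show ?thesis
    by (meson inj_on_finite)
qed

instantiation mps :: comm_ring_1
begin

lift_definition zero_mps :: mps is "\<lambda>_. 0" .
lift_definition one_mps :: mps is "\<lambda>a. if a = 0 then 1 else 0" .
lift_definition plus_mps :: "mps \<Rightarrow> mps \<Rightarrow> mps" is "\<lambda>f g a. f a + g a" .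
lift_definition minus_mps :: "mps \<Rightarrow> mps \<Rightarrow> mps" is "\<lambda>f g a. f a - g a" .
lift_definition uminus_mps :: "mps \<Rightarrow> mps" is "\<lambda>f a. - f a" .
lift_definition times_mps :: "mps \<Rightarrow> mps \<Rightarrow> mps"
  is "\<lambda>f g a. \<Sum>(u, w)\<in>splits a. f u * g w" .

instance
proof
  fix f g h :: mps
  show "f + g + h = f + (g + h)" by transfer auto
  show "f + g = g + f" by transfer auto
  show "0 + f = f" by transfer auto
  show "- f + f = 0" by transfer auto
  show "f - g = f + - g" by transfer auto
  show "(0::mps) \<noteq> 1" by transfer (auto simp: fun_eq_iff)
  show "(f + g) * h = f * h + g * h"
    by transfer (auto simp: fun_eq_iff case_prod_unfold ring_distribs sum.distrib)
  show "f * g = g * f"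
  proof (transfer, rule ext)
    fix f g :: "(nat \<Rightarrow>\<^sub>0 nat) \<Rightarrow> int" and a
    show "(\<Sum>(u, w)\<in>splits a. f u * g w) = (\<Sum>(u, w)\<in>splits a. g u * f w)"
      by (rule sum.reindex_bij_witness[where i = prod.swap and j = prod.swap])
        (auto simp: splits_def add.commute)
  qed
  show "1 * f = f"
  proof (transfer, rule ext)
    fix f :: "(nat \<Rightarrow>\<^sub>0 nat) \<Rightarrow> int" and a
    have "(\<Sum>(u, w)\<in>splits a. (if u = 0 then 1 else 0) * f w)
        = (\<Sum>(u, w)\<in>{(0 :: nat \<Rightarrow>\<^sub>0 nat, a)}. (if u = 0 then 1 else 0) * f w)"
      by (rule sum.mono_neutral_right[OF finite_splits]) (auto simp: splits_def split: if_splits)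
    then show "(\<Sum>(u, w)\<in>splits a. (if u = 0 then 1 else 0) * f w) = f a" by simp
  qed
  show "f * g * h = f * (g * h)"
  proof (transfer, rule ext)
    fix f g h :: "(nat \<Rightarrow>\<^sub>0 nat) \<Rightarrow> int" and a
    have "(\<Sum>(u, w)\<in>splits a. (\<Sum>(x, y)\<in>splits u. f x * g y) * h w)
        = (\<Sum>q\<in>splits a. \<Sum>p\<in>splits (fst q). f (fst p) * g (snd p) * h (snd q))"
      by (simp only: case_prod_unfold sum_distrib_right)
    also have "\<dots> = (\<Sum>(q, p)\<in>(SIGMA q:splits a. splits (fst q)).
            f (fst p) * g (snd p) * h (snd q))"
      by (rule sum.Sigma) simp_all
    also have "\<dots> = (\<Sum>(q, p)\<in>(SIGMA q:splits a. splits (snd q)).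
            f (fst q) * (g (fst p) * h (snd p)))"
      by (rule sum.reindex_bij_witness[where
            i = "\<lambda>((x, z), (y, w)). ((x + y, w), (x, y))" and
            j = "\<lambda>((u, w), (x, y)). ((x, y + w), (y, w))"])
        (auto simp: splits_def add.assoc)
    also have "\<dots> = (\<Sum>q\<in>splits a. \<Sum>p\<in>splits (snd q). f (fst q) * (g (fst p) * h (snd p)))"
      by (rule sum.Sigma[symmetric]) simp_all
    also have "\<dots> = (\<Sum>(x, z)\<in>splits a. f x * (\<Sum>(y, w)\<in>splits z. g y * h w))"
      by (simp only: case_prod_unfold sum_distrib_left)
    finally show "(\<Sum>(u, w)\<in>splits a. (\<Sum>(x, y)\<in>splits u. f x * g y) * h w)
        = (\<Sum>(x, z)\<in>splits a. f x * (\<Sum>(y, w)\<in>splits z. g y * h w))" .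
  qed
qed

end

text \<open>Inverses of units (and 0 for non-units), so that quotients and integer powers
  (\<open>powi\<close>) are available.\<close>

instantiation mps :: inverse
begin

definition inverse_mps :: "mps \<Rightarrow> mps" where
  "inverse_mps f = (if f dvd 1 then (THE g. f * g = 1) else 0)"

definition divide_mps :: "mps \<Rightarrow> mps \<Rightarrow> mps" where
  "divide_mps f g = f * inverse g"

instance ..

end

lemma mps_inverse: "f dvd 1 \<Longrightarrow> f * inverse f = (1 :: mps)"
proof -
  assume f: "f dvd 1"
  then obtain g where g: "f * g = 1" by (metis dvdE)
  have "f * (THE g. f * g = 1) = 1"
  proof (rule theI)
    show "f * g = 1" by (rule g)
    fix h assume h: "f * h = 1"
    have "h = (f * g) * h" by (simp add: g)
    also have "\<dots> = (f * h) * g" by (simp only: ac_simps)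
    finally show "h = g" by (simp add: h)
  qed
  with f show ?thesis by (simp add: inverse_mps_def)
qed

definition mps_monom :: "(nat \<Rightarrow>\<^sub>0 nat) \<Rightarrow> mps" where
  "mps_monom a = Abs_mps (\<lambda>b. if b = a then 1 else 0)"

definition t_var :: "nat \<Rightarrow> mps" where
  "t_var i = mps_monom (Poly_Mapping.single i 1)"

definition t_pow :: "nat \<Rightarrow> (nat \<Rightarrow> int) \<Rightarrow> mps" where
  "t_pow r v = (\<Prod>i = 1..r. t_var i ^ nat (v i))"


section \<open>Topological preliminaries\<close>

definition quotient_topology :: "'a topology \<Rightarrow> ('a \<Rightarrow> 'b) \<Rightarrow> 'b topology" where
  "quotient_topology X f =
     topology (\<lambda>U. U \<subseteq> f ` topspace X \<and> openin X {x \<in> topspace X. f x \<in> U})"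

lemma openin_quotient_topology:
  "openin (quotient_topology X f) U \<longleftrightarrow>
     U \<subseteq> f ` topspace X \<and> openin X {x \<in> topspace X. f x \<in> U}"
proof -
  have "istopology (\<lambda>U. U \<subseteq> f ` topspace X \<and> openin X {x \<in> topspace X. f x \<in> U})"
    unfolding istopology_def
  proof (intro conjI allI impI; (elim conjE)?)
    fix S T
    assume "openin X {x \<in> topspace X. f x \<in> S}" "openin X {x \<in> topspace X. f x \<in> T}"
    then have "openin X ({x \<in> topspace X. f x \<in> S} \<inter> {x \<in> topspace X. f x \<in> T})" by blast
    then show "openin X {x \<in> topspace X. f x \<in> S \<inter> T}"
      by (rule back_subst[of "openin X"]) auto
  next
    fix \<K> assume K: "\<forall>K\<in>\<K>. K \<subseteq> f ` topspace X \<and> openin X {x \<in> topspace X. f x \<in> K}"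
    then have "openin X (\<Union>K\<in>\<K>. {x \<in> topspace X. f x \<in> K})" by blast
    then show "openin X {x \<in> topspace X. f x \<in> \<Union> \<K>}"
      by (rule back_subst[of "openin X"]) auto
    show "\<Union> \<K> \<subseteq> f ` topspace X" using K by blast
  qed auto
  then show ?thesis
    by (simp add: quotient_topology_def)
qed

text \<open>For a linear subspace \<open>V\<close> of a space of complex functions: the set of its lines.  The
  topology on functions is that of pointwise convergence; on a finite-dimensional \<open>V\<close> it
  induces the usual topology.\<close>

definition line :: "('a \<Rightarrow> complex) \<Rightarrow> ('a \<Rightarrow> complex) set" where
  "line s = range (\<lambda>c x. c * s x)"

definition projectivization :: "('a \<Rightarrow> complex) set \<Rightarrow> ('a \<Rightarrow> complex) set topology" where
  "projectivization V = quotient_topology (top_of_set (V - {\<lambda>_. 0})) line"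

definition holomorphic_sev :: "(complex^'d \<Rightarrow> complex) \<Rightarrow> (complex^'d) set \<Rightarrow> bool" where
  "holomorphic_sev h U \<longleftrightarrow> open U \<and>
     (\<forall>p\<in>U. \<exists>D. (h has_derivative D) (at p) \<and> (\<forall>c x. D (c *s x) = c * D x))"

definition group_rank :: "('a, 'b) monoid_scheme \<Rightarrow> enat" where
  "group_rank G = Sup {enat (card B) | B. finite B \<and> B \<subseteq> carrier G \<and>
     (\<forall>n :: 'a \<Rightarrow> int. finprod G (\<lambda>b. b [^]\<^bsub>G\<^esub> n b) B = \<one>\<^bsub>G\<^esub> \<longrightarrow> (\<forall>b\<in>B. n b = 0))}"

definition betti :: "nat \<Rightarrow> 'a topology \<Rightarrow> enat" where
  "betti p X = group_rank (homology_group (int p) X)"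

definition finite_betti :: "'a topology \<Rightarrow> bool" where
  "finite_betti X \<longleftrightarrow> (\<forall>p. betti p X \<noteq> \<infinity>) \<and> finite {p. betti p X \<noteq> 0}"

text \<open>Only meaningful if \<open>finite_betti X\<close>.\<close>
definition euler_characteristic :: "'a topology \<Rightarrow> int" where
  "euler_characteristic X = (\<Sum>p | betti p X \<noteq> 0. (- 1) ^ p * int (the_enat (betti p X)))"


section \<open>Blowing up points of toric varieties\<close>

text \<open>A smooth toric variety is given by its set of points, its atlas of torus-equivariant
  affine charts \<open>complex^'d \<Rightarrow> points\<close>, the torus action and its map to affine space.
  Blowing up the point \<open>Q\<close> replaces \<open>Q\<close> by the points \<open>Exc j l\<close>, one for each line \<open>l\<close> in the
  tangent space at \<open>Q\<close>, where \<open>j\<close> is the number of the blowing-up and the tangent space is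
  identified with \<open>complex^'d\<close> by the toric chart centred at \<open>Q\<close>.  All other points, and the
  charts not containing \<open>Q\<close>, are kept unchanged.\<close>

datatype ('d::finite) pt = Base "complex^'d" | Exc nat "(complex^'d) set"

record ('d::finite) variety =
  points :: "'d pt set"
  atlas :: "(complex^'d \<Rightarrow> 'd pt) set"
  act :: "complex^'d \<Rightarrow> 'd pt \<Rightarrow> 'd pt"
  down :: "'d pt \<Rightarrow> complex^'d"

definition torus :: "(complex^'d) set" where
  "torus = {t. \<forall>i. t $ i \<noteq> 0}"

definition affine_space :: "('d::finite) variety" where
  "affine_space =
     \<lparr> points = range Base,
       atlas = {Base},
       act = (\<lambda>t p. case p of Base x \<Rightarrow> Base (\<chi> i. t $ i * x $ i) | Exc _ _ \<Rightarrow> p),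
       down = (\<lambda>p. case p of Base x \<Rightarrow> x | Exc _ _ \<Rightarrow> 0) \<rparr>"

definition cspan1 :: "complex^'d \<Rightarrow> (complex^'d) set" where
  "cspan1 w = range (\<lambda>c. c *s w)"

text \<open>The \<open>k\<close>-th standard chart of the blowing-up of the centre of the chart \<open>\<psi>\<close>: the
  blowing-down map is \<open>z \<mapsto> z\<^sub>k \<cdot> (z\<^sub>1, \<dots>, 1, \<dots>, z\<^sub>d)\<close> with 1 in position \<open>k\<close>.\<close>

definition blowup_chart ::
    "nat \<Rightarrow> (complex^'d \<Rightarrow> 'd pt) \<Rightarrow> 'd \<Rightarrow> complex^'d \<Rightarrow> ('d::finite) pt" where
  "blowup_chart j \<psi> k z =
     (let w = (\<chi> i. if i = k then 1 else z $ i)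
      in if z $ k = 0 then Exc j (cspan1 w) else \<psi> (z $ k *s w))"

definition centred_chart :: "('d::finite) variety \<Rightarrow> 'd pt \<Rightarrow> complex^'d \<Rightarrow> 'd pt" where
  "centred_chart X Q = (THE \<psi>. \<psi> \<in> atlas X \<and> \<psi> 0 = Q)"

text \<open>In the toric chart centred at the fixed point \<open>Q\<close> the torus acts linearly, hence on
  the lines in the tangent space.\<close>

definition blow_up :: "nat \<Rightarrow> 'd pt \<Rightarrow> ('d::finite) variety \<Rightarrow> 'd variety" where
  "blow_up j Q X =
     (let \<psi> = centred_chart X Q in
     \<lparr> points = (points X - {Q}) \<union> {Exc j (cspan1 w) | w. w \<noteq> 0},
       atlas = {\<phi> \<in> atlas X. Q \<notin> range \<phi>} \<union> range (blowup_chart j \<psi>),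
       act = (\<lambda>t p. case p of
                Base _ \<Rightarrow> act X t p
              | Exc i l \<Rightarrow> if i = j then Exc j {y'. \<exists>y\<in>l. \<psi> y' = act X t (\<psi> y)} else act X t p),
       down = (\<lambda>p. case p of
                Base _ \<Rightarrow> down X p
              | Exc i _ \<Rightarrow> if i = j then down X Q else down X p) \<rparr>)"

definition manifold_topology :: "('d::finite) variety \<Rightarrow> 'd pt topology" where
  "manifold_topology X =
     topology (\<lambda>U. U \<subseteq> points X \<and> (\<forall>\<phi>\<in>atlas X. open (\<phi> -` U)))"

lemma openin_manifold_topology:
  "openin (manifold_topology X) U \<longleftrightarrow> U \<subseteq> points X \<and> (\<forall>\<phi>\<in>atlas X. open (\<phi> -` U))"
proof -
  have "istopology (\<lambda>U. U \<subseteq> points X \<and> (\<forall>\<phi>\<in>atlas X. open (\<phi> -` U)))"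
    unfolding istopology_def by (auto simp: vimage_Union)
  then show ?thesis
    by (simp add: manifold_topology_def)
qed


section \<open>Toric constellations\<close>

primrec level :: "('d::finite) pt list \<Rightarrow> nat \<Rightarrow> 'd variety" where
  "level C 0 = affine_space"
| "level C (Suc j) = blow_up (Suc j) (C ! j) (level C j)"

text \<open>As the torus is connected, a 0-dimensional orbit is a single point.\<close>

definition toric_constellation :: "('d::finite) pt list \<Rightarrow> bool" where
  "toric_constellation C \<longleftrightarrow> C \<noteq> [] \<and> C ! 0 = Base 0 \<and>
     (\<forall>j. 1 \<le> j \<and> j < length C \<longrightarrow>
        C ! j \<in> points (level C j) \<and>
        (\<lambda>t. act (level C j) t (C ! j)) ` torus = {C ! j} \<and>
        down (level C j) (C ! j) = 0)"

abbreviation sky :: "('d::finite) pt list \<Rightarrow> 'd variety" where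
  "sky C \<equiv> level C (length C)"

abbreviation indices :: "('d::finite) pt list \<Rightarrow> nat set" where
  "indices C \<equiv> {1..length C}"

text \<open>Strict transform of the exceptional divisor: the closure of the part of it lying
  outside the later centres.\<close>

definition exc_div :: "('d::finite) pt list \<Rightarrow> nat \<Rightarrow> 'd pt set" where
  "exc_div C j = manifold_topology (sky C) closure_of {p \<in> points (sky C). \<exists>l. p = Exc j l}"

definition exc_locus :: "('d::finite) pt list \<Rightarrow> 'd pt set" where
  "exc_locus C = (\<Union>j\<in>indices C. exc_div C j)"

text \<open>In a toric chart, a torus-invariant prime divisor \<open>E\<close> is a coordinate hyperplane or
  empty; its local equation is the corresponding coordinate, respectively 1.\<close>

definition loc_eq :: "(complex^'d \<Rightarrow> 'd pt) \<Rightarrow> ('d::finite) pt set \<Rightarrow> complex^'d \<Rightarrow> complex" where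
  "loc_eq \<psi> E y = (\<Prod>k | \<psi> -` E = {y. y $ k = 0}. y $ k)"


section \<open>Valuations and the Poincare series\<close>

text \<open>The local ring of \<open>complex^'d\<close> at the origin, as the ring of convergent power series.\<close>

definition local_ring :: "(('d::finite \<Rightarrow> nat) \<Rightarrow> complex) set" where
  "local_ring = {g. \<exists>\<rho>>0. (\<lambda>a. norm (g a) * \<rho> ^ (\<Sum>i\<in>UNIV. a i)) summable_on UNIV}"

definition germ_eval :: "(('d::finite \<Rightarrow> nat) \<Rightarrow> complex) \<Rightarrow> complex^'d \<Rightarrow> complex" where
  "germ_eval g x = infsum (\<lambda>a. g a * (\<Prod>i\<in>UNIV. (x $ i) ^ a i)) UNIV"

definition coord_fun :: "'d::finite \<Rightarrow> ('d \<Rightarrow> nat) \<Rightarrow> complex" where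
  "coord_fun i a = (if a = (\<lambda>k. if k = i then 1 else 0) then 1 else 0)"

definition pullback :: "('d::finite) pt list \<Rightarrow> (('d \<Rightarrow> nat) \<Rightarrow> complex) \<Rightarrow> 'd pt \<Rightarrow> complex" where
  "pullback C g p = germ_eval g (down (sky C) p)"

definition vanishes_along ::
    "('d::finite) pt list \<Rightarrow> nat \<Rightarrow> (('d \<Rightarrow> nat) \<Rightarrow> complex) \<Rightarrow> nat \<Rightarrow> bool" where
  "vanishes_along C j g m \<longleftrightarrow>
     (\<forall>\<psi>\<in>atlas (sky C). \<exists>U h. holomorphic_sev h U \<and> \<psi> -` exc_div C j \<subseteq> U \<and>
        (\<forall>y\<in>U. pullback C g (\<psi> y) = loc_eq \<psi> (exc_div C j) y ^ m * h y))"

definition valuation :: "('d::finite) pt list \<Rightarrow> nat \<Rightarrow> (('d \<Rightarrow> nat) \<Rightarrow> complex) \<Rightarrow> enat" where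
  "valuation C j g = Sup {enat m | m. vanishes_along C j g m}"

text \<open>Vectors \<open>v \<in> \<int>\<^sup>r\<close> are functions \<open>nat \<Rightarrow> int\<close>; only the entries with index in
  \<open>indices C\<close> are relevant.  Valuations being nonnegative, \<open>\<nu> \<ge> v\<close> amounts to
  \<open>\<nu> \<ge> nat v\<close>.\<close>

definition val_ideal :: "('d::finite) pt list \<Rightarrow> (nat \<Rightarrow> int) \<Rightarrow> (('d \<Rightarrow> nat) \<Rightarrow> complex) set" where
  "val_ideal C v = {g \<in> local_ring. \<forall>i\<in>indices C. enat (nat (v i)) \<le> valuation C i g}"

definition basis_modulo ::
    "('a \<Rightarrow> complex) set \<Rightarrow> ('a \<Rightarrow> complex) set \<Rightarrow> ('a \<Rightarrow> complex) set \<Rightarrow> bool" where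
  "basis_modulo V W B \<longleftrightarrow> finite B \<and> B \<subseteq> V \<and>
     (\<forall>f\<in>V. \<exists>!c. c \<in> B \<rightarrow>\<^sub>E UNIV \<and> (\<lambda>a. f a - (\<Sum>b\<in>B. c b * b a)) \<in> W)"

text \<open>Dimension of the quotient space \<open>V / W\<close>, where \<open>W \<subseteq> V\<close>.\<close>

definition quot_dim :: "('a \<Rightarrow> complex) set \<Rightarrow> ('a \<Rightarrow> complex) set \<Rightarrow> nat" where
  "quot_dim V W = (THE n. \<exists>B. basis_modulo V W B \<and> card B = n)"

definition hilbert_fun :: "('d::finite) pt list \<Rightarrow> (nat \<Rightarrow> int) \<Rightarrow> nat" where
  "hilbert_fun C v = quot_dim (val_ideal C v) (val_ideal C (\<lambda>i. v i + 1))"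

text \<open>Multiplication by \<open>t\<^sub>i - 1\<close> of a series with exponents in \<open>\<int>\<^sup>r\<close>, given by its
  coefficients.\<close>

definition mult_t_minus_1 :: "nat \<Rightarrow> ((nat \<Rightarrow> int) \<Rightarrow> int) \<Rightarrow> (nat \<Rightarrow> int) \<Rightarrow> int" where
  "mult_t_minus_1 i L v = L (v(i := v i - 1)) - L v"

definition poincare_numerator :: "('d::finite) pt list \<Rightarrow> (nat \<Rightarrow> int) \<Rightarrow> int" where
  "poincare_numerator C =
     fold mult_t_minus_1 [1..<Suc (length C)] (\<lambda>v. int (hilbert_fun C v))"

text \<open>The numerator has no terms with a negative exponent, hence it is a power series.\<close>

lemma poincare_numerator_eq_0:
  assumes "i \<in> indices C" and "v i < 0"
  shows "poincare_numerator C v = 0"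
proof -
  have hilb: "hilbert_fun C (u(i := x)) = hilbert_fun C u" if "x < 0" "u i < 0" for u x
  proof -
    have "nat ((u(i := x)) k) = nat (u k)" "nat ((u(i := x)) k + 1) = nat (u k + 1)" for k
      using that by auto
    then have "val_ideal C (u(i := x)) = val_ideal C u"
      and "val_ideal C (\<lambda>k. (u(i := x)) k + 1) = val_ideal C (\<lambda>k. u k + 1)"
      unfolding val_ideal_def by metis+
    then show ?thesis by (simp only: hilbert_fun_def)
  qed
  have zero: "fold mult_t_minus_1 js L u = 0"
    if "\<And>u. u i < 0 \<Longrightarrow> L u = 0" "u i < 0" for js L u
    using that
  proof (induction js arbitrary: L)
    case (Cons j js)
    have "mult_t_minus_1 j L w = 0" if "w i < 0" for w
    proof -
      have "L (w(j := w j - 1)) = 0" by (rule Cons.prems(1)) (use that in auto)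
      moreover have "L w = 0" by (rule Cons.prems(1)) (rule that)
      ultimately show ?thesis by (simp add: mult_t_minus_1_def)
    qed
    from Cons.IH[of "mult_t_minus_1 j L", OF this Cons.prems(2)] show ?case by simp
  next
    case Nil
    from Nil.prems(1)[of u, OF Nil.prems(2)] show ?case by simp
  qed
  have main: "fold mult_t_minus_1 js L u = 0"
    if "\<And>u x. x < 0 \<Longrightarrow> u i < 0 \<Longrightarrow> L (u(i := x)) = L u" "i \<in> set js" "u i < 0" for js L u
    using that
  proof (induction js arbitrary: L)
    case (Cons j js)
    show ?case
    proof (cases "j = i")
      case True
      have "mult_t_minus_1 j L w = 0" if "w i < 0" for w
        unfolding mult_t_minus_1_def True using Cons.prems(1)[of "w i - 1" w] that by linarith
      from zero[of "mult_t_minus_1 j L" u js, OF this Cons.prems(3)] show ?thesis by simp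
    next
      case False
      have "mult_t_minus_1 j L (w(i := x)) = mult_t_minus_1 j L w" if "x < 0" "w i < 0" for w x
      proof -
        have "L ((w(j := w j - 1))(i := x)) = L (w(j := w j - 1))"
          by (rule Cons.prems(1)) (use that False in auto)
        moreover have "L (w(i := x)) = L w"
          by (rule Cons.prems(1)) (use that in auto)
        moreover have "(w(i := x))(j := (w(i := x)) j - 1) = (w(j := w j - 1))(i := x)"
          using False by (auto simp: fun_eq_iff)
        ultimately show ?thesis
          unfolding mult_t_minus_1_def by metis
      qed
      from Cons.IH[of "mult_t_minus_1 j L", OF this _ Cons.prems(3)] show ?thesis
        using Cons.prems(2) False by simp
    qed
  next
    case Nil
    from Nil.prems(2) show ?case by simp
  qed
  show ?thesis
    unfolding poincare_numerator_def
  proof (rule main)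
    show "int (hilbert_fun C (u(i := x))) = int (hilbert_fun C u)" if "x < 0" "u i < 0" for u x
      using hilb[of x u, OF that] by (rule arg_cong)
    show "i \<in> set [1..<Suc (length C)]"
      using assms(1) by auto
  qed (rule assms(2))
qed

definition nonneg_exponents :: "nat \<Rightarrow> ((nat \<Rightarrow> int) \<Rightarrow> int) \<Rightarrow> mps" where
  "nonneg_exponents r L = Abs_mps (\<lambda>a. if Poly_Mapping.keys a \<subseteq> {1..r}
     then L (\<lambda>i. int (Poly_Mapping.lookup a i)) else 0)"

definition poincare_series :: "('d::finite) pt list \<Rightarrow> mps" where
  "poincare_series C =
     nonneg_exponents (length C) (poincare_numerator C) / ((\<Prod>i\<in>indices C. t_var i) - 1)"

definition matrix_entry :: "('d::finite) pt list \<Rightarrow> nat \<Rightarrow> 'd \<Rightarrow> int" where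
  "matrix_entry C j i = int (the_enat (valuation C j (coord_fun i)))"

definition matrix_columns :: "('d::finite) pt list \<Rightarrow> (nat \<Rightarrow> int) set" where
  "matrix_columns C = range (\<lambda>i j. if j \<in> indices C then matrix_entry C j i else 0)"


section \<open>The space of traces of strict transforms\<close>

text \<open>\<open>local_trivialization C v N f \<psi> F\<close>: in the chart \<open>\<psi>\<close>, the function \<open>f\<close> on
  \<open>N - exc_locus C\<close> corresponds to the holomorphic function \<open>F\<close> under the trivialization of
  the line bundle \<open>O(-\<Sum> v\<^sub>j E\<^sub>j)\<close> given by the local equations.  For \<open>f = \<pi>\<^sup>* g\<close> with
  \<open>\<nu>(g) = v\<close>, the local equation of the strict transform of \<open>{g = 0}\<close> is \<open>F\<close>.\<close>

definition local_trivialization ::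
    "('d::finite) pt list \<Rightarrow> (nat \<Rightarrow> int) \<Rightarrow> 'd pt set \<Rightarrow> ('d pt \<Rightarrow> complex) \<Rightarrow>
     (complex^'d \<Rightarrow> 'd pt) \<Rightarrow> (complex^'d \<Rightarrow> complex) \<Rightarrow> bool" where
  "local_trivialization C v N f \<psi> F \<longleftrightarrow> holomorphic_sev F (\<psi> -` N) \<and>
     (\<forall>y \<in> \<psi> -` (N - exc_locus C).
        f (\<psi> y) = (\<Prod>j\<in>indices C. loc_eq \<psi> (exc_div C j) y powi v j) * F y)"

text \<open>A section over the exceptional locus is given by its values \<open>s (\<psi>, y)\<close> in the charts
  at the points \<open>\<psi> y\<close> of the exceptional locus (and 0 elsewhere).  The section \<open>f\<close> of
  \<open>O(-\<Sum> v\<^sub>j E\<^sub>j)\<close> over \<open>N\<close> restricts to \<open>s\<close>:\<close>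

definition restricts_to ::
    "('d::finite) pt list \<Rightarrow> (nat \<Rightarrow> int) \<Rightarrow> 'd pt set \<Rightarrow> ('d pt \<Rightarrow> complex) \<Rightarrow>
     ((complex^'d \<Rightarrow> 'd pt) \<times> (complex^'d) \<Rightarrow> complex) \<Rightarrow> bool" where
  "restricts_to C v N f s \<longleftrightarrow> openin (manifold_topology (sky C)) N \<and>
     (\<forall>\<psi>\<in>atlas (sky C). \<exists>F. local_trivialization C v N f \<psi> F \<and>
        (\<forall>y \<in> \<psi> -` (N \<inter> exc_locus C). s (\<psi>, y) = F y))"

definition global_sections ::
    "('d::finite) pt list \<Rightarrow> (nat \<Rightarrow> int) \<Rightarrow>
     ((complex^'d \<Rightarrow> 'd pt) \<times> (complex^'d) \<Rightarrow> complex) set" where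
  "global_sections C v = {s.
     (\<forall>\<psi> y. \<not> (\<psi> \<in> atlas (sky C) \<and> \<psi> y \<in> exc_locus C) \<longrightarrow> s (\<psi>, y) = 0) \<and>
     (\<forall>p\<in>exc_locus C. \<exists>N f. p \<in> N \<and> restricts_to C v N f s)}"

definition zero_locus ::
    "('d::finite) pt list \<Rightarrow> ((complex^'d \<Rightarrow> 'd pt) \<times> (complex^'d) \<Rightarrow> complex) \<Rightarrow> 'd pt set" where
  "zero_locus C s = {\<psi> y | \<psi> y. \<psi> \<in> atlas (sky C) \<and> \<psi> y \<in> exc_locus C \<and> s (\<psi>, y) = 0}"

text \<open>The sections \<open>\<pi>\<^sup>* g\<close> restricted to the exceptional locus, for \<open>g\<close> with \<open>\<nu>(g) = v\<close> whose
  strict transform contains no non-empty \<open>E\<^sub>a \<inter> E\<^sub>b\<close>.\<close>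

definition admissible_sections ::
    "('d::finite) pt list \<Rightarrow> (nat \<Rightarrow> int) \<Rightarrow>
     ((complex^'d \<Rightarrow> 'd pt) \<times> (complex^'d) \<Rightarrow> complex) set" where
  "admissible_sections C v = {s \<in> global_sections C v. \<exists>g\<in>local_ring.
     (\<forall>j\<in>indices C. \<exists>n. valuation C j g = enat n \<and> v j = int n) \<and>
     (\<exists>N. exc_locus C \<subseteq> N \<and> restricts_to C v N (pullback C g) s) \<and>
     (\<forall>a\<in>indices C. \<forall>b\<in>indices C. a \<noteq> b \<and> exc_div C a \<inter> exc_div C b \<noteq> {} \<longrightarrow>
        \<not> exc_div C a \<inter> exc_div C b \<subseteq> zero_locus C s)}"

text \<open>The divisors of zeros of \<open>s\<close> on the components \<open>E\<^sub>j\<close>, as effective Cartier divisors: in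
  each chart, the set of all local equations, that is, the multiples of the local expression
  of \<open>s\<close> by units.\<close>

definition zero_divisor ::
    "('d::finite) pt list \<Rightarrow> ((complex^'d \<Rightarrow> 'd pt) \<times> (complex^'d) \<Rightarrow> complex) \<Rightarrow>
     nat \<Rightarrow> (complex^'d \<Rightarrow> 'd pt) \<Rightarrow> (complex^'d \<Rightarrow> complex) set" where
  "zero_divisor C s j \<psi> =
     (if j \<in> indices C \<and> \<psi> \<in> atlas (sky C)
      then {h. (\<forall>y. \<psi> y \<notin> exc_div C j \<longrightarrow> h y = 0) \<and>
              (\<exists>u. holomorphic_sev u UNIV \<and> (\<forall>y. u y \<noteq> 0) \<and>
                 (\<forall>y. \<psi> y \<in> exc_div C j \<longrightarrow> h y = u y * s (\<psi>, y)))}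
      else {})"

text \<open>The condition on the intersections \<open>E\<^sub>a \<inter> E\<^sub>b\<close> makes the section determined by its
  divisors up to a scalar; this identifies the set of divisors with a subset of the
  projective space of global sections.\<close>

definition section_class ::
    "('d::finite) pt list \<Rightarrow> (nat \<Rightarrow> int) \<Rightarrow>
     (nat \<Rightarrow> (complex^'d \<Rightarrow> 'd pt) \<Rightarrow> (complex^'d \<Rightarrow> complex) set) \<Rightarrow>
     ((complex^'d \<Rightarrow> 'd pt) \<times> (complex^'d) \<Rightarrow> complex) set" where
  "section_class C v \<delta> =
     (THE l. \<exists>s\<in>admissible_sections C v. zero_divisor C s = \<delta> \<and> line s = l)"

definition D_space ::
    "('d::finite) pt list \<Rightarrow> (nat \<Rightarrow> int) \<Rightarrow>
     (nat \<Rightarrow> (complex^'d \<Rightarrow> 'd pt) \<Rightarrow> (complex^'d \<Rightarrow> complex) set) topology" where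
  "D_space C v = pullback_topology (zero_divisor C ` admissible_sections C v)
     (section_class C v) (projectivization (global_sections C v))"

end

theory Submission
  imports
    Defs
    "HOL-Computational_Algebra.Fundamental_Theorem_Algebra"
    "HOL-Library.Function_Algebras"
begin

text \<open>In toric charts \<open>\<nu>\<^sub>b\<close> is the monomial valuation whose weight vector is the primitive vector of the ray
  of \<open>E\<^sub>b\<close>.  Hence the dimension of \<open>I(v)/I(v + 1)\<close> counts monomials, and
  \<open>P\<close> is the product over all coordinates \<open>x\<^sub>k\<close> of \<open>1 / (1 - t\<^bsup>\<nu>(x\<^sub>k)\<^esup>)\<close>.

  It remains to see that \<open>\<chi>(D\<^sub>v)\<close> is the number of coordinates \<open>x\<^sub>k\<close> with \<open>\<nu>(x\<^sub>k) = v\<close>.  The strict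
  transform of a germ \<open>g\<close> with \<open>\<nu>(g) = v\<close> contains no non-empty \<open>E\<^sub>a \<inter> E\<^sub>b\<close>, since \<open>g\<close> then contains a
  linear term \<open>x\<^sub>k\<close> with \<open>\<nu>(x\<^sub>k) = v\<close>, whose strict transform misses a fixed point of \<open>E\<^sub>a \<inter> E\<^sub>b\<close>.  So
  \<open>D\<^sub>v\<close> consists of the lines of sections with a nonzero coefficient at some such \<open>x\<^sub>k\<close>, and scaling
  the other coefficients to \<open>0\<close> retracts it to the projective space on these \<open>x\<^sub>k\<close>.\<close>

section \<open>Ranks of abelian groups\<close>

text \<open>The space is given by points and charts only, so the geometry of the fan has to be
  recovered: every chart carries the labels of its rays, an invariant kept through all blowing-ups.
  Each \<open>N b\<close> is the sum of the rays of a full-dimensional cone, hence has entries at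
  least 1. Therefore only finitely many monomials lie below a given weight, and a convergent series
  splits into finitely many multiples of monomials that can be divided by the local equations of the
  divisors.

  A point of the space of traces records divisors on single components, and the factors relating two
  sections with equal divisors might differ from one component to another. Two facts exclude this.
  On each component the factor is constant, because along lines it is a unit relating two
  polynomials. And a coordinate with the given valuations contributes a monomial that vanishes
  identically on no component, so its coefficient can be read off on each of them and fixes all
  factors at once. The same coefficients, as continuous functionals on sections, define the
  retraction. The homology of complex projective space is computed by adjoining one coordinate at a
  time.\<close>

lemma group_rank_trivial:
  fixes G (structure)
  assumes "comm_group G" "trivial_group G"
  shows "group_rank G = 0"
proof -
  interpret comm_group G by fact
  have eq: "B = {}" if "B \<subseteq> carrier G"
    "\<forall>n :: 'a \<Rightarrow> int. finprod G (\<lambda>b. b [^]\<^bsub>G\<^esub> n b) B = \<one>\<^bsub>G\<^esub> \<longrightarrow> (\<forall>b\<in>B. n b = 0)" for B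
  proof (rule ccontr)
    assume "B \<noteq> {}"
    then have B: "B = {\<one>}"
      using that(1) assms(2) unfolding trivial_group_def by (metis subset_singletonD)
    \<comment> \<open>The identity satisfies a relation with the nonzero exponent 1, so it belongs
      to no independent set.\<close>
    have "finprod G (\<lambda>b. b [^] (1::int)) B = \<one>"
      unfolding B by simp
    with that(2)[rule_format, of "\<lambda>_. 1"] B show False by auto
  qed
  have "{enat (card B) | B. finite B \<and> B \<subseteq> carrier G \<and>
     (\<forall>n :: 'a \<Rightarrow> int. finprod G (\<lambda>b. b [^]\<^bsub>G\<^esub> n b) B = \<one>\<^bsub>G\<^esub> \<longrightarrow> (\<forall>b\<in>B. n b = 0))} \<subseteq> {0}"
    using eq by (auto simp: zero_enat_def)
  then have "group_rank G \<le> Sup {0}"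
    unfolding group_rank_def by (rule Sup_subset_mono)
  then show ?thesis by simp
qed

lemma group_rank_infinite_cyclic:
  fixes G (structure)
  assumes "comm_group G" "G \<cong> integer_group"
  shows "group_rank G = 1"
proof -
  interpret comm_group G by fact
  from assms(2) obtain \<phi> where phi: "\<phi> \<in> iso G integer_group"
    unfolding is_iso_def by blast
  have hom: "\<phi> \<in> hom G integer_group" and bij: "bij_betw \<phi> (carrier G) UNIV"
    using phi by (auto simp: iso_def)
  have pw: "\<phi> (x [^] (n::int)) = n * \<phi> x" if "x \<in> carrier G" for x n
    using hom_int_pow[OF hom that is_group group_integer_group, of n] by simp
  have mult: "\<phi> (x \<otimes> y) = \<phi> x + \<phi> y" if "x \<in> carrier G" "y \<in> carrier G" for x y
    using hom_mult[OF hom that] by simp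
  have one: "\<phi> \<one> = 0"
    using hom_one[OF hom is_group group_integer_group] by simp
  have inj: "x = y" if "x \<in> carrier G" "y \<in> carrier G" "\<phi> x = \<phi> y" for x y
    using bij that by (auto simp: bij_betw_def inj_on_def)
  let ?I = "{enat (card B) | B. finite B \<and> B \<subseteq> carrier G \<and>
     (\<forall>n :: 'a \<Rightarrow> int. finprod G (\<lambda>b. b [^]\<^bsub>G\<^esub> n b) B = \<one>\<^bsub>G\<^esub> \<longrightarrow> (\<forall>b\<in>B. n b = 0))}"
  have upper: "card B \<le> 1" if fin: "finite B" and B: "B \<subseteq> carrier G"
    and ind: "\<forall>n :: 'a \<Rightarrow> int. finprod G (\<lambda>b. b [^]\<^bsub>G\<^esub> n b) B = \<one>\<^bsub>G\<^esub> \<longrightarrow> (\<forall>b\<in>B. n b = 0)" for B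
  proof (rule ccontr)
    assume "\<not> card B \<le> 1"
    then obtain a b where ab: "a \<in> B" "b \<in> B" "a \<noteq> b"
      using card_le_Suc0_iff_eq[OF fin] by auto
    \<comment> \<open>Two integers satisfy the relation
      \<open>\<phi> b * \<phi> a - \<phi> a * \<phi> b = 0\<close>; independence then makes both of
      them zero, against injectivity.\<close>
    define n where "n = (\<lambda>x. if x = a then \<phi> b else if x = b then - \<phi> a else 0)"
    have car: "a \<in> carrier G" "b \<in> carrier G" using ab B by auto
    have Beq: "B = insert a (insert b (B - {a, b}))" using ab by auto
    have rest: "finprod G (\<lambda>x. x [^] n x) (B - {a, b}) = \<one>"
      by (rule finprod_one_eqI) (auto simp: n_def)
    have cl: "(\<lambda>x. x [^] n x) \<in> B - {a, b} \<rightarrow> carrier G" using B by auto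
    have "finprod G (\<lambda>x. x [^] n x) B = a [^] n a \<otimes> (b [^] n b \<otimes> \<one>)"
      apply (subst Beq)
      apply (subst finprod_insert)
      using fin ab cl car apply (auto)[4]
      apply (subst finprod_insert)
      using fin ab cl car rest by auto
    also have "\<dots> = \<one>"
    proof (rule inj)
      show "\<phi> (a [^] n a \<otimes> (b [^] n b \<otimes> \<one>)) = \<phi> \<one>"
        using car ab(3) by (simp add: mult pw one n_def)
    qed (use car in auto)
    finally have "finprod G (\<lambda>x. x [^] n x) B = \<one>" .
    with ind have "\<forall>x\<in>B. n x = 0" by blast
    with ab have "\<phi> b = 0" "\<phi> a = 0" by (auto simp: n_def split: if_splits)
    with inj car ab(3) show False by auto
  qed
  obtain g where g: "g \<in> carrier G" "\<phi> g = 1"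
    using bij by (metis UNIV_I bij_betw_iff_bijections)
  have "enat (card {g}) \<in> ?I"
  proof (intro CollectI exI[of _ "{g}"] conjI refl allI impI)
    fix n :: "'a \<Rightarrow> int"
    assume "finprod G (\<lambda>b. b [^] n b) {g} = \<one>"
    then have "g [^] n g = \<one>" using g by simp
    then have "n g = 0" using pw[of g "n g"] g one by simp
    then show "\<forall>b\<in>{g}. n b = 0" by simp
  qed (use g in auto)
  from Sup_upper[OF this] have "enat 1 \<le> Sup ?I" by (simp only: card_1_singleton_iff card.empty card_insert_disjoint finite.emptyI empty_iff not_False_eq_True One_nat_def)
  moreover have "Sup ?I \<le> enat 1"
  proof (rule Sup_least)
    fix x assume "x \<in> ?I"
    then show "x \<le> enat 1"
    proof (elim CollectE exE conjE)
      fix B assume x: "x = enat (card B)" and "finite B" "B \<subseteq> carrier G"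
        "\<forall>n :: 'a \<Rightarrow> int. finprod G (\<lambda>b. b [^]\<^bsub>G\<^esub> n b) B = \<one>\<^bsub>G\<^esub> \<longrightarrow> (\<forall>b\<in>B. n b = 0)"
      from upper[OF this(2-4)] x show ?thesis by simp
    qed
  qed
  ultimately show ?thesis
    unfolding group_rank_def one_enat_def by (rule antisym[rotated])
qed

lemma exact_seq_trivial_middle:
  assumes "exact_seq ([C, B, A], [g, f])" "trivial_group A" "trivial_group C"
  shows "trivial_group B"
proof -
  have gB: "group B" and gA: "group A" and f: "f \<in> hom A B" and g: "g \<in> hom B C"
    and k: "kernel B C g = f ` carrier A"
    using assms(1) by (auto simp: group_hom_def group_hom_axioms_def)
  have "carrier B \<subseteq> kernel B C g"
    using g assms(3) by (auto simp: kernel_def trivial_group_def hom_def)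
  also have "\<dots> \<subseteq> {\<one>\<^bsub>B\<^esub>}"
    unfolding k using assms(2) hom_one[OF f gA gB] by (auto simp: trivial_group_def)
  finally show ?thesis
    using gB group.is_monoid monoid.one_closed by (fastforce simp: trivial_group_def)
qed

section \<open>Spaces of lines\<close>

text \<open>The quotient by scaling is formed for arbitrary sets of vectors, so that a subset of a
  projective space has its own quotient topology, to be compared with the induced one.\<close>

definition line_space :: "('a \<Rightarrow> complex) set \<Rightarrow> ('a \<Rightarrow> complex) set topology" where
  "line_space S = quotient_topology (top_of_set S) line"

text \<open>Closure under nonzero scalars makes the set saturated and \<open>line\<close> an open
  map on it, which is what relates quotient topologies to subspace topologies.\<close>

definition punctured_cone :: "('a \<Rightarrow> complex) set \<Rightarrow> bool" where
  "punctured_cone S \<longleftrightarrow> (\<lambda>_. 0) \<notin> S \<and> (\<forall>c s. c \<noteq> 0 \<longrightarrow> s \<in> S \<longrightarrow> (\<lambda>x. c * s x) \<in> S)"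

definition homogeneous :: "(('a \<Rightarrow> complex) \<Rightarrow> 'b \<Rightarrow> complex) \<Rightarrow> bool" where
  "homogeneous f \<longleftrightarrow> (\<forall>c s. f (\<lambda>x. c * s x) = (\<lambda>x. c * f s x))"

lemma line_eqD:
  assumes "line s = line s'" "s \<noteq> (\<lambda>_. 0)"
  obtains c where "c \<noteq> 0" "s' = (\<lambda>x. c * s x)"
proof -
  have "s' \<in> line s'" by (auto simp: line_def intro: image_eqI[of _ _ 1])
  then obtain c where c: "s' = (\<lambda>x. c * s x)" using assms(1) by (auto simp: line_def)
  have "s \<in> line s" by (auto simp: line_def intro: image_eqI[of _ _ 1])
  then obtain d where d: "s = (\<lambda>x. d * s' x)" using assms(1) by (auto simp: line_def)
  have "c \<noteq> 0"
  proof
    assume "c = 0"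
    with c have "s' = (\<lambda>_. 0)" by simp
    with d have "s = (\<lambda>_. 0)" by (metis mult_zero_right)
    with assms(2) show False by contradiction
  qed
  with c that show ?thesis by blast
qed

lemma line_scale: "c \<noteq> 0 \<Longrightarrow> line (\<lambda>x. c * s x) = line s"
proof -
  assume c: "c \<noteq> 0"
  have "(\<lambda>d x. d * (c * s x)) = (\<lambda>d x. d * s x) \<circ> (\<lambda>d. d * c)" by (simp add: fun_eq_iff mult.assoc)
  then have "line (\<lambda>x. c * s x) = (\<lambda>d x. d * s x) ` range (\<lambda>d. d * c)"
    unfolding line_def image_comp by (rule arg_cong)
  also have "range (\<lambda>d. d * c) = UNIV"
    using c by (intro surjI[of _ "\<lambda>d. d / c"]) simp
  finally show ?thesis by (simp add: line_def)
qed

lemma punctured_coneD: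
  assumes "punctured_cone S"
  shows "(\<lambda>_. 0) \<notin> S" "c \<noteq> 0 \<Longrightarrow> s \<in> S \<Longrightarrow> (\<lambda>x. c * s x) \<in> S"
  using assms by (auto simp: punctured_cone_def)

lemma punctured_cone_line_in:
  assumes "punctured_cone S" "s \<in> S" "line s = line s'"
  shows "s' \<in> S"
proof -
  have "s \<noteq> (\<lambda>_. 0)" using assms by (auto simp: punctured_cone_def)
  then obtain c where "c \<noteq> 0" "s' = (\<lambda>x. c * s x)" using line_eqD assms(3) by metis
  then show ?thesis using punctured_coneD(2)[OF assms(1)] assms(2) by auto
qed

lemma openin_line_space:
  "openin (line_space S) U \<longleftrightarrow> U \<subseteq> line ` S \<and> openin (top_of_set S) {x \<in> S. line x \<in> U}"
  by (simp add: line_space_def openin_quotient_topology)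

lemma topspace_line_space [simp]: "topspace (line_space S) = line ` S"
proof
  show "topspace (line_space S) \<subseteq> line ` S"
    by (metis openin_line_space openin_topspace)
  have "{x \<in> S. line x \<in> line ` S} = S" by auto
  then have "openin (line_space S) (line ` S)"
    unfolding openin_line_space by simp
  then show "line ` S \<subseteq> topspace (line_space S)" by (rule openin_subset)
qed

lemma quotient_map_line: "quotient_map (top_of_set S) (line_space S) line"
  unfolding quotient_map_def by (auto simp: openin_line_space)

lemma continuous_map_line: "continuous_map (top_of_set S) (line_space S) line"
  using quotient_map_line quotient_imp_continuous_map by blast

lemma continuous_on_scale: "continuous_on S (\<lambda>s x. c * s x :: complex)"
  by (intro continuous_intros continuous_on_subset[OF continuous_on_product_coordinates]) auto

text \<open>The saturation of \<open>U\<close> is the union of its preimages under the scalings by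
  \<open>c \<noteq> 0\<close>, and scalings are continuous.\<close>

lemma openin_line_image:
  assumes S: "punctured_cone S" and U: "openin (top_of_set S) U"
  shows "openin (line_space S) (line ` U)"
proof -
  have US: "U \<subseteq> S" using openin_subset[OF U] by simp
  have "{s \<in> S. line s \<in> line ` U} = (\<Union>c\<in>-{0}. S \<inter> (\<lambda>s x. c * s x) -` U)"
  proof (intro equalityI subsetI)
    fix s assume "s \<in> {s \<in> S. line s \<in> line ` U}"
    then obtain u where s: "s \<in> S" "line s = line u" "u \<in> U" by auto
    moreover have "s \<noteq> (\<lambda>_. 0)" using s S by (auto simp: punctured_cone_def)
    ultimately obtain c where "c \<noteq> 0" "u = (\<lambda>x. c * s x)" using line_eqD by metis
    with s show "s \<in> (\<Union>c\<in>-{0}. S \<inter> (\<lambda>s x. c * s x) -` U)" by auto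
  next
    fix s assume "s \<in> (\<Union>c\<in>-{0}. S \<inter> (\<lambda>s x. c * s x) -` U)"
    then obtain c where "c \<noteq> 0" "s \<in> S" "(\<lambda>x. c * s x) \<in> U" by auto
    with line_scale[of c s] show "s \<in> {s \<in> S. line s \<in> line ` U}" by (metis (lifting) imageI mem_Collect_eq)
  qed
  moreover have "openin (top_of_set S) (S \<inter> (\<lambda>s x. c * s x) -` U)" if "c \<in> -{0}" for c
    using continuous_on_scale[of S c] by (rule continuous_openin_preimage[OF _ _ U])
      (use that S in \<open>auto simp: punctured_cone_def\<close>)
  then have "openin (top_of_set S) (\<Union>c\<in>-{0}. S \<inter> (\<lambda>s x. c * s x) -` U)" by (intro openin_Union) auto
  ultimately have "openin (top_of_set S) {s \<in> S. line s \<in> line ` U}" by simp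
  with US show ?thesis unfolding openin_line_space by auto
qed

text \<open>A quotient topology need not restrict to the quotient topology of a subset. Here it
  does, because \<open>line\<close> is open on \<open>S\<close> and \<open>S'\<close> is a union of
  lines without the origin.\<close>

lemma subtopology_line_space:
  assumes S: "punctured_cone S" and S': "punctured_cone S'" and sub: "S' \<subseteq> S"
  shows "subtopology (line_space S) (line ` S') = line_space S'"
proof (rule topology_eq[THEN iffD2], intro allI iffI)
  fix T assume "openin (subtopology (line_space S) (line ` S')) T"
  then obtain T' where T': "openin (line_space S) T'" "T = T' \<inter> line ` S'"
    by (auto simp: openin_subtopology)
  then obtain W where W: "open W" "{x \<in> S. line x \<in> T'} = S \<inter> W"
    unfolding openin_line_space openin_open by blast
  have "{x \<in> S'. line x \<in> T} = S' \<inter> W" using T' W sub by auto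
  then show "openin (line_space S') T"
    using T' W unfolding openin_line_space openin_open by blast
next
  fix T assume T: "openin (line_space S') T"
  then obtain W where W: "open W" "{x \<in> S'. line x \<in> T} = S' \<inter> W" and TS: "T \<subseteq> line ` S'"
    unfolding openin_line_space openin_open by blast
  have "openin (line_space S) (line ` (S \<inter> W))"
    by (rule openin_line_image[OF S]) (use W in \<open>auto simp: openin_open\<close>)
  moreover have "T = line ` (S \<inter> W) \<inter> line ` S'"
  proof (intro equalityI subsetI)
    fix l assume l: "l \<in> T"
    then obtain s where s: "s \<in> S'" "l = line s" using TS by auto
    then have "s \<in> S' \<inter> W" using W l by blast
    then show "l \<in> line ` (S \<inter> W) \<inter> line ` S'" using s sub by auto
  next
    fix l assume "l \<in> line ` (S \<inter> W) \<inter> line ` S'"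
    then obtain s s' where s: "s \<in> S" "s \<in> W" "l = line s" "s' \<in> S'" "l = line s'" by auto
    then have "s \<in> S'" using punctured_cone_line_in[OF S', of s' s] by auto
    then show "l \<in> T" using s W by blast
  qed
  ultimately show "openin (subtopology (line_space S) (line ` S')) T"
    by (auto simp: openin_subtopology)
qed

section \<open>Homotopies between spaces of lines\<close>

lemma homogeneous_image_line: "homogeneous f \<Longrightarrow> f ` line s = line (f s)"
  by (auto simp: homogeneous_def line_def image_def)

lemma continuous_map_line_space:
  assumes f: "homogeneous f" "continuous_on S f" "f ` S \<subseteq> S'"
  shows "continuous_map (line_space S) (line_space S') ((`) f)"
proof (rule continuous_compose_quotient_map[OF quotient_map_line])
  have "continuous_map (top_of_set S) (line_space S') (line \<circ> f)"
    by (rule continuous_map_compose[OF _ continuous_map_line]) (use f in auto)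
  then show "continuous_map (top_of_set S) (line_space S') ((`) f \<circ> line)"
    by (rule continuous_map_eq) (simp add: homogeneous_image_line f)
qed

text \<open>The product of \<open>line\<close> with the identity of the unit interval is still a
  quotient map, since the interval is locally compact and Hausdorff; hence a homotopy through
  homogeneous maps descends to lines.\<close>

lemma homotopic_line_space:
  fixes H :: "real \<Rightarrow> ('a \<Rightarrow> complex) \<Rightarrow> ('a \<Rightarrow> complex)"
  assumes hom: "\<And>t. homogeneous (H t)"
    and cont: "continuous_on ({0..1} \<times> S) (\<lambda>(t, s). H t s)"
    and im: "\<And>t s. 0 \<le> t \<Longrightarrow> t \<le> 1 \<Longrightarrow> s \<in> S \<Longrightarrow> H t s \<in> S"
  shows "homotopic_with (\<lambda>_. True) (line_space S) (line_space S) ((`) (H 0)) ((`) (H 1))"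
proof -
  let ?I = "top_of_set {0..1::real}"
  have q: "quotient_map (prod_topology ?I (top_of_set S)) (prod_topology ?I (line_space S))
      (\<lambda>(t, s). (t, line s))"
    by (rule quotient_map_prod_right)
      (auto simp: quotient_map_line compact_imp_locally_compact_space compact_space_subtopology
        Hausdorff_space_subtopology)
  have "continuous_map (prod_topology ?I (top_of_set S)) (line_space S) (line \<circ> (\<lambda>(t, s). H t s))"
    by (rule continuous_map_compose[OF _ continuous_map_line])
      (use cont im in \<open>auto simp: subtopology_Times[symmetric] euclidean_product_topology\<close>)
  then have "continuous_map (prod_topology ?I (top_of_set S)) (line_space S)
      ((\<lambda>(t, L). H t ` L) \<circ> (\<lambda>(t, s). (t, line s)))"
    by (rule continuous_map_eq) (clarsimp simp: homogeneous_image_line[OF hom])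
  then have "continuous_map (prod_topology ?I (line_space S)) (line_space S) (\<lambda>(t, L). H t ` L)"
    by (rule continuous_compose_quotient_map[OF q])
  then show ?thesis
    unfolding homotopic_with_def by (intro exI[of _ "\<lambda>(t, L). H t ` L"]) auto
qed

text \<open>At each time the point on the segment from \<open>g (f s)\<close> to \<open>s\<close>
  depends homogeneously on \<open>s\<close>, so the deformation along these segments descends to
  lines.\<close>

lemma line_space_homotopy_equivalent:
  fixes f :: "('a \<Rightarrow> complex) \<Rightarrow> ('b \<Rightarrow> complex)" and g :: "('b \<Rightarrow> complex) \<Rightarrow> ('a \<Rightarrow> complex)"
  assumes f: "homogeneous f" "continuous_on UNIV f" "f ` S \<subseteq> S'"
    and g: "homogeneous g" "continuous_on UNIV g" "g ` S' \<subseteq> S"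
    and fg: "\<And>s'. s' \<in> S' \<Longrightarrow> f (g s') = s'"
    and H: "\<And>t s. 0 \<le> t \<Longrightarrow> t \<le> 1 \<Longrightarrow> s \<in> S \<Longrightarrow>
      (\<lambda>x. of_real t * s x + (1 - of_real t) * g (f s) x) \<in> S"
  shows "line_space S homotopy_equivalent_space line_space S'"
proof -
  let ?H = "\<lambda>t s x. complex_of_real t * s x + (1 - of_real t) * g (f s) x"
  have gf: "continuous_on UNIV (\<lambda>s. g (f s))"
    by (rule continuous_on_compose2[OF g(2) f(2)]) simp
  have h: "homotopic_with (\<lambda>_. True) (line_space S) (line_space S) ((`) (?H 0)) ((`) (?H 1))"
  proof (rule homotopic_line_space[where H = ?H])
    show "homogeneous (?H t)" for t
      using f(1) g(1) by (simp add: homogeneous_def algebra_simps)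
    have a: "continuous_on T (\<lambda>p. snd p x)" for x and T :: "(real \<times> ('a \<Rightarrow> complex)) set"
      by (rule continuous_on_product_then_coordinatewise[of T snd x])
        (rule continuous_on_snd, rule continuous_on_id)
    have b: "continuous_on T (\<lambda>p. g (f (snd p)) x)" for x and T :: "(real \<times> ('a \<Rightarrow> complex)) set"
    proof (rule continuous_on_product_then_coordinatewise[of T "\<lambda>p. g (f (snd p))" x])
      show "continuous_on T (\<lambda>p. g (f (snd p)))"
        by (rule continuous_on_compose2[OF gf continuous_on_snd[OF continuous_on_id]]) simp
    qed
    show "continuous_on ({0..1} \<times> S) (\<lambda>(t, s). ?H t s)"
      unfolding case_prod_unfold
      by (intro continuous_intros a b)
    show "?H t s \<in> S" if "0 \<le> t" "t \<le> 1" "s \<in> S" for t s using H that by blast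
  qed
  have c: "continuous_map (line_space S) (line_space S') ((`) f)"
    using f by (intro continuous_map_line_space) (auto intro: continuous_on_subset)
  have d: "continuous_map (line_space S') (line_space S) ((`) g)"
    using g by (intro continuous_map_line_space) (auto intro: continuous_on_subset)
  have "(`) (?H 0) = (`) g \<circ> (`) f" by (rule ext) (simp add: image_image)
  moreover have "(`) (?H 1) = id" by (rule ext) simp
  ultimately have h1: "homotopic_with (\<lambda>_. True) (line_space S) (line_space S) ((`) g \<circ> (`) f) id"
    using h by simp
  have h2: "homotopic_with (\<lambda>_. True) (line_space S') (line_space S') ((`) f \<circ> (`) g) id"
  proof (rule homotopic_with_equal)
    show "((`) f \<circ> (`) g) L = id L" if "L \<in> topspace (line_space S')" for L
      using that by (clarsimp simp: homogeneous_image_line[OF f(1)] homogeneous_image_line[OF g(1)] fg)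
    show "continuous_map (line_space S') (line_space S') ((`) f \<circ> (`) g)"
      by (rule continuous_map_compose[OF d c])
  qed auto
  from c d h1 h2 show ?thesis
    unfolding homotopy_equivalent_space_def by (intro exI conjI)
qed

section \<open>Homology of complex projective spaces\<close>

definition coord_space :: "'k set \<Rightarrow> ('k \<Rightarrow> complex) set" where
  "coord_space M = {c. \<forall>i. i \<notin> M \<longrightarrow> c i = 0}"

abbreviation punctured_coord_space :: "'k set \<Rightarrow> ('k \<Rightarrow> complex) set" where
  "punctured_coord_space M \<equiv> coord_space M - {\<lambda>_. 0}"

lemma punctured_cone_coord_space: "punctured_cone (punctured_coord_space M)"
  by (auto simp: punctured_cone_def coord_space_def fun_eq_iff)

text \<open>In dimension 0 the complement of the origin is empty and the relative group is an
  absolute one; every added real coordinate raises the degree by one.\<close>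

lemma relative_homology_group_Euclidean_space_origin:
  "relative_homology_group p (Euclidean_space n) (topspace (Euclidean_space n) - {\<lambda>_. 0})
     \<cong> homology_group (p - int n) (Euclidean_space 0)"
proof -
  have top: "topspace (Euclidean_space 0) = {\<lambda>_. 0}"
    by (auto simp: topspace_Euclidean_space)
  have "closedin (Euclidean_space 0) {\<lambda>_. 0}"
    using closedin_topspace[of "Euclidean_space 0"] by (simp only: top)
  from relative_homology_group_Euclidean_complement_step[OF this, of "p - int n" n]
  have "homology_group (p - int n) (Euclidean_space 0) \<cong>
      relative_homology_group p (Euclidean_space n) (topspace (Euclidean_space n) - {\<lambda>_. 0})"
    by (simp only: top Diff_cancel diff_add_cancel add_0)
  then show ?thesis
    by (rule group.iso_sym[rotated]) simp
qed

lemma Euclidean_space_top_of_set: "Euclidean_space n = top_of_set {x. \<forall>i\<ge>n. x i = 0}"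
  by (simp add: Euclidean_space_def euclidean_product_topology)

lemma homeomorphic_maps_coord_space:
  assumes "finite M"
  obtains f g where "homeomorphic_maps (top_of_set (coord_space M)) (Euclidean_space (2 * card M)) f g"
    "f (\<lambda>_. 0) = (\<lambda>_. 0)" "g (\<lambda>_. 0) = (\<lambda>_. 0)"
proof -
  obtain h where h: "bij_betw h M {0..<card M}"
    using ex_bij_betw_finite_nat[OF assms] by blast
  define e where "e = inv_into M h"
  have he: "h (e i) = i" if "i < card M" for i
    unfolding e_def using bij_betw_inv_into_right[OF h] that by auto
  have eh: "e (h k) = k" if "k \<in> M" for k
    unfolding e_def using bij_betw_inv_into_left[OF h] that by auto
  have hM: "h k < card M" if "k \<in> M" for k
    using bij_betwE[OF h] that by auto
  have eM: "e i \<in> M" if "i < card M" for i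
    unfolding e_def using bij_betwE[OF bij_betw_inv_into[OF h]] that by auto
  \<comment> \<open>Real and imaginary part of the coordinate with number j become the real
    coordinates 2j and 2j + 1.\<close>
  define f :: "('a \<Rightarrow> complex) \<Rightarrow> nat \<Rightarrow> real" where
    "f z i = (if i < 2 * card M then if even i then Re (z (e (i div 2))) else Im (z (e (i div 2))) else 0)"
    for z i
  define g :: "(nat \<Rightarrow> real) \<Rightarrow> 'a \<Rightarrow> complex" where
    "g x k = (if k \<in> M then of_real (x (2 * h k)) + \<i> * of_real (x (2 * h k + 1)) else 0)" for x k
  have co: "continuous_on S (\<lambda>x. x i)" for i and S :: "('c \<Rightarrow> 'd::topological_space) set"
    by (rule continuous_on_subset[OF continuous_on_product_coordinates]) simp
  have cf: "continuous_on S f" for S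
  proof (rule continuous_on_coordinatewise_then_product)
    fix i
    consider "i < 2 * card M" "even i" | "i < 2 * card M" "odd i" | "\<not> i < 2 * card M" by blast
    then show "continuous_on S (\<lambda>z. f z i)"
      by cases (simp_all add: f_def continuous_on_Re continuous_on_Im co)
  qed
  have cg: "continuous_on S g" for S
  proof (rule continuous_on_coordinatewise_then_product)
    fix k
    show "continuous_on S (\<lambda>x. g x k)"
      by (cases "k \<in> M") (auto simp: g_def intro!: continuous_intros co)
  qed
  have gf: "g (f z) = z" if z: "z \<in> coord_space M" for z
  proof
    fix k
    show "g (f z) k = z k"
      using z hM[of k] eh[of k]
      by (cases "k \<in> M") (auto simp: g_def f_def coord_space_def complex_eq_iff)
  qed
  have fg: "f (g x) = x" if x: "\<forall>i\<ge>2 * card M. x i = 0" for x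
  proof
    fix i
    show "f (g x) i = x i"
    proof (cases "i < 2 * card M")
      case True
      then have "i div 2 < card M" by auto
      with True eM[of "i div 2"] he[of "i div 2"] show ?thesis
        by (auto simp: f_def g_def elim: evenE oddE)
    qed (use x in \<open>auto simp: f_def\<close>)
  qed
  show thesis
  proof (rule that[of f g])
    show "homeomorphic_maps (top_of_set (coord_space M)) (Euclidean_space (2 * card M)) f g"
      unfolding homeomorphic_maps_def Euclidean_space_top_of_set
    proof (intro conjI)
      show "continuous_map (top_of_set (coord_space M)) (top_of_set {x. \<forall>i\<ge>2 * card M. x i = 0}) f"
        using cf by (auto simp: f_def)
      show "continuous_map (top_of_set {x. \<forall>i\<ge>2 * card M. x i = 0}) (top_of_set (coord_space M)) g"
        using cg by (auto simp: g_def coord_space_def)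
    qed (use fg gf in auto)
    show "f (\<lambda>_. 0) = (\<lambda>_. 0)" "g (\<lambda>_. 0) = (\<lambda>_. 0)"
      by (auto simp: f_def g_def fun_eq_iff)
  qed
qed

lemma relative_homology_group_coord_space_origin:
  assumes "finite M"
  shows "relative_homology_group p (top_of_set (coord_space M)) (punctured_coord_space M)
     \<cong> homology_group (p - 2 * int (card M)) (Euclidean_space 0)"
proof -
  obtain f g where h: "homeomorphic_maps (top_of_set (coord_space M)) (Euclidean_space (2 * card M)) f g"
    and z: "f (\<lambda>_. 0) = (\<lambda>_. 0)" "g (\<lambda>_. 0) = (\<lambda>_. 0)"
    using homeomorphic_maps_coord_space[OF assms] by blast
  have hm: "homeomorphic_map (top_of_set (coord_space M)) (Euclidean_space (2 * card M)) f"
    using h homeomorphic_map_maps by blast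
  have inj: "inj_on f (coord_space M)" and im: "f ` coord_space M = topspace (Euclidean_space (2 * card M))"
    using homeomorphic_imp_injective_map[OF hm] homeomorphic_imp_surjective_map[OF hm] by auto
  have zin: "(\<lambda>_. 0) \<in> coord_space M" by (simp add: coord_space_def)
  have "f ` punctured_coord_space M = topspace (Euclidean_space (2 * card M)) - {\<lambda>_. 0}"
    using inj_on_image_set_diff[OF inj, of "coord_space M" "{\<lambda>_. 0}"] zin im z by auto
  from homeomorphic_map_relative_homology_iso[OF hm _ this, of p]
  have "relative_homology_group p (top_of_set (coord_space M)) (punctured_coord_space M) \<cong>
      relative_homology_group p (Euclidean_space (2 * card M))
        (topspace (Euclidean_space (2 * card M)) - {\<lambda>_. 0})"
    by (auto intro: is_isoI)
  also have "\<dots> \<cong> homology_group (p - int (2 * card M)) (Euclidean_space 0)"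
    by (rule relative_homology_group_Euclidean_space_origin)
  finally (iso_trans) show ?thesis by simp
qed

lemma homology_group_singleton:
  assumes "topspace X = {a}"
  shows "homology_group 0 X \<cong> integer_group" "p \<noteq> 0 \<Longrightarrow> trivial_group (homology_group p X)"
proof -
  have "path_connected_space X"
    using assms by (metis path_connectedin_singleton path_connectedin_topspace insertI1)
  then show "homology_group 0 X \<cong> integer_group"
    using assms by (intro isomorphic_integer_zeroth_homology_group) auto
  show "p \<noteq> 0 \<Longrightarrow> trivial_group (homology_group p X)"
    using homology_dimension_axiom[OF assms] .
qed

text \<open>The projective space with homogeneous coordinates in \<open>insert k M\<close> is the union of the
  affine chart \<open>c k \<noteq> 0\<close> and the complement \<open>V\<close> of its origin, which retracts to the
  projective space with coordinates in \<open>M\<close>.\<close>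

definition proj_complement :: "'k \<Rightarrow> 'k set \<Rightarrow> ('k \<Rightarrow> complex) set" where
  "proj_complement k M = {c \<in> coord_space (insert k M). \<exists>i\<in>M. c i \<noteq> 0}"

definition affine_part :: "'k \<Rightarrow> 'k set \<Rightarrow> ('k \<Rightarrow> complex) set" where
  "affine_part k M = {c \<in> coord_space (insert k M). c k \<noteq> 0}"

lemma punctured_cone_parts:
  "k \<notin> M \<Longrightarrow> punctured_cone (proj_complement k M)" "punctured_cone (affine_part k M)"
  by (auto simp: punctured_cone_def proj_complement_def affine_part_def coord_space_def)

lemma proj_complement_homotopy_equivalent:
  assumes "k \<notin> M"
  shows "line_space (proj_complement k M) homotopy_equivalent_space line_space (punctured_coord_space M)"
proof (rule line_space_homotopy_equivalent[where f = "\<lambda>c i. if i \<in> M then c i else 0" and g = "\<lambda>c. c"])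
  have co: "continuous_on S (\<lambda>x. x i)" for i and S :: "('c \<Rightarrow> 'd::topological_space) set"
    by (rule continuous_on_subset[OF continuous_on_product_coordinates]) simp
  show "continuous_on UNIV (\<lambda>c i. if i \<in> M then c i else (0::complex))"
  proof (rule continuous_on_coordinatewise_then_product)
    fix i show "continuous_on UNIV (\<lambda>c. if i \<in> M then c i else (0::complex))"
      by (cases "i \<in> M") (simp_all add: co)
  qed
  show "homogeneous (\<lambda>c i. if i \<in> M then c i else 0)" by (auto simp: homogeneous_def)
  show "(\<lambda>c i. if i \<in> M then c i else 0) ` proj_complement k M \<subseteq> punctured_coord_space M"
    by (auto simp: proj_complement_def coord_space_def fun_eq_iff; metis)
  show "homogeneous (\<lambda>c. c)" by (simp add: homogeneous_def)
  show "(\<lambda>c. c) ` punctured_coord_space M \<subseteq> proj_complement k M"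
    by (auto simp: proj_complement_def coord_space_def fun_eq_iff; metis)
  show "(\<lambda>i. if i \<in> M then s' i else 0) = s'" if "s' \<in> punctured_coord_space M" for s'
    using that by (auto simp: coord_space_def fun_eq_iff)
  show "(\<lambda>x. of_real t * s x + (1 - of_real t) * (if x \<in> M then s x else 0)) \<in> proj_complement k M"
    if "s \<in> proj_complement k M" for t s
    using that by (auto simp: proj_complement_def coord_space_def algebra_simps)
qed auto

text \<open>\<open>A\<close> is saturated, so the line of a vector in \<open>A\<close> has no
  representative in \<open>S - A\<close>.\<close>

lemma line_image_diff:
  assumes A: "punctured_cone A" and V: "V \<subseteq> S"
  shows "line ` V - line ` (S - A) = line ` (A \<inter> V)"
proof (intro equalityI subsetI)
  fix l assume l: "l \<in> line ` V - line ` (S - A)"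
  then obtain v where v: "v \<in> V" "l = line v" by blast
  with l V have "v \<in> A" by blast
  with v show "l \<in> line ` (A \<inter> V)" by blast
next
  fix l assume "l \<in> line ` (A \<inter> V)"
  then obtain a where a: "a \<in> A" "a \<in> V" "l = line a" by blast
  have "l \<notin> line ` (S - A)"
  proof
    assume "l \<in> line ` (S - A)"
    then obtain s where "s \<notin> A" "line a = line s" using a by blast
    with punctured_cone_line_in[OF A a(1)] show False by blast
  qed
  with a show "l \<in> line ` V - line ` (S - A)" by blast
qed

text \<open>Dehomogenization with respect to \<open>k\<close>; the lines that also lie in
  \<open>proj_complement\<close> are those whose affine coordinates are not all 0.\<close>

lemma affine_part_homeomorphic:
  assumes k: "k \<notin> M"
  obtains f g where "homeomorphic_maps (line_space (affine_part k M)) (top_of_set (coord_space M)) f g"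
    "f ` line ` (affine_part k M \<inter> proj_complement k M) = punctured_coord_space M"
proof -
  have co: "continuous_on S (\<lambda>x. x i)" for i and S :: "('c \<Rightarrow> 'd::topological_space) set"
    by (rule continuous_on_subset[OF continuous_on_product_coordinates]) simp
  let ?r = "\<lambda>s i. if i \<in> M then s i / s k else (0::complex)"
  let ?e = "\<lambda>z. z(k := 1::complex)"
  \<comment> \<open>The quotients \<open>s i / s k\<close> do not depend on the representative
    chosen on the line.\<close>
  define f where "f L = ?r (SOME s. s \<in> affine_part k M \<and> line s = L)" for L
  have f: "f (line s) = ?r s" if s: "s \<in> affine_part k M" for s
  proof -
    have "\<exists>s'. s' \<in> affine_part k M \<and> line s' = line s"
      using s by blast
    from someI_ex[OF this] obtain s' where s': "s' \<in> affine_part k M" "line s' = line s"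
      and fs: "f (line s) = ?r s'"
      unfolding f_def by metis
    have "s' \<noteq> (\<lambda>_. 0)" using s'(1) by (auto simp: affine_part_def)
    then obtain c where c: "c \<noteq> 0" "s = (\<lambda>x. c * s' x)"
      using line_eqD[OF s'(2)] by metis
    have "?r (\<lambda>x. c * s' x) = ?r s'" using c(1) by (simp add: fun_eq_iff)
    then show ?thesis using fs c(2) by metis
  qed
  have eA: "?e z \<in> affine_part k M" if "z \<in> coord_space M" for z
    using that by (auto simp: affine_part_def coord_space_def)
  have fe: "f (line (?e z)) = z" if z: "z \<in> coord_space M" for z
  proof -
    have "?r (?e z) = z" using z k by (auto simp: coord_space_def fun_eq_iff)
    with f[OF eA[OF z]] show ?thesis by simp
  qed
  have ef: "line (?e (f (line s))) = line s" if s: "s \<in> affine_part k M" for s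
  proof -
    have sk: "s k \<noteq> 0" and s0: "\<And>i. i \<noteq> k \<Longrightarrow> i \<notin> M \<Longrightarrow> s i = 0"
      using s by (auto simp: affine_part_def coord_space_def)
    have "?e (?r s) = (\<lambda>x. (1 / s k) * s x)"
      using sk s0 by (auto simp: fun_eq_iff)
    with line_scale[of "1 / s k" s] sk f[OF s] show ?thesis by simp
  qed
  have cf: "continuous_map (line_space (affine_part k M)) (top_of_set (coord_space M)) f"
  proof (rule continuous_compose_quotient_map[OF quotient_map_line])
    have "continuous_on (affine_part k M) ?r"
    proof (rule continuous_on_coordinatewise_then_product)
      fix i show "continuous_on (affine_part k M) (\<lambda>s. ?r s i)"
        by (cases "i \<in> M") (auto intro!: continuous_on_divide co simp: affine_part_def)
    qed
    then have "continuous_map (top_of_set (affine_part k M)) (top_of_set (coord_space M)) ?r"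
      by (auto simp: coord_space_def)
    then show "continuous_map (top_of_set (affine_part k M)) (top_of_set (coord_space M)) (f \<circ> line)"
      by (rule continuous_map_eq) (simp add: f)
  qed
  have cg: "continuous_map (top_of_set (coord_space M)) (line_space (affine_part k M)) (line \<circ> ?e)"
  proof (rule continuous_map_compose[OF _ continuous_map_line])
    have "continuous_on (coord_space M) ?e"
    proof (rule continuous_on_coordinatewise_then_product)
      fix i show "continuous_on (coord_space M) (\<lambda>z. ?e z i)"
        by (cases "i = k") (auto intro!: co)
    qed
    then show "continuous_map (top_of_set (coord_space M)) (top_of_set (affine_part k M)) ?e"
      using eA by auto
  qed
  show thesis
  proof (rule that)
    show "homeomorphic_maps (line_space (affine_part k M)) (top_of_set (coord_space M)) f (line \<circ> ?e)"
      unfolding homeomorphic_maps_def using cf cg fe ef by auto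
    show "f ` line ` (affine_part k M \<inter> proj_complement k M) = punctured_coord_space M"
    proof (intro equalityI subsetI)
      fix z assume "z \<in> f ` line ` (affine_part k M \<inter> proj_complement k M)"
      then obtain s where s: "s \<in> affine_part k M" "s \<in> proj_complement k M" "z = f (line s)" by auto
      then obtain i where i: "i \<in> M" "s i \<noteq> 0" by (auto simp: proj_complement_def)
      have "z i \<noteq> 0" using i s f[OF s(1)] by (auto simp: affine_part_def)
      moreover have "z \<in> coord_space M" unfolding s(3) f[OF s(1)] by (simp add: coord_space_def)
      ultimately show "z \<in> punctured_coord_space M" by auto
    next
      fix z assume z: "z \<in> punctured_coord_space M"
      then obtain i where i: "z i \<noteq> 0" by auto
      have zc: "z \<in> coord_space M" using z by simp
      have "i \<in> M" using i zc by (auto simp: coord_space_def)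
      then have "?e z \<in> proj_complement k M"
        using i k eA[OF zc] by (auto simp: proj_complement_def affine_part_def intro!: bexI[of _ i])
      with eA[OF zc] fe[OF zc] show "z \<in> f ` line ` (affine_part k M \<inter> proj_complement k M)"
        by (metis IntI imageI)
    qed
  qed
qed

text \<open>The closed set \<open>?Z\<close> of lines in the hyperplane \<open>c k = 0\<close> lies
  in the open set \<open>?V\<close>. Excising it leaves the affine chart relative to the complement
  of its origin.\<close>

lemma relative_homology_group_proj_complement:
  assumes k: "k \<notin> M" and M: "finite M"
  shows "relative_homology_group p (line_space (punctured_coord_space (insert k M)))
      (line ` proj_complement k M) \<cong> homology_group (p - 2 * int (card M)) (Euclidean_space 0)"
proof -
  let ?S = "punctured_coord_space (insert k M)"
  let ?X = "line_space ?S"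
  let ?V = "line ` proj_complement k M"
  let ?Z = "line ` (?S - affine_part k M)"
  have co: "continuous_on S (\<lambda>x. x i)" for i and S :: "('c \<Rightarrow> 'd::topological_space) set"
    by (rule continuous_on_subset[OF continuous_on_product_coordinates]) simp
  have S: "punctured_cone ?S" by (rule punctured_cone_coord_space)
  have openV: "openin ?X ?V"
  proof (rule openin_line_image[OF S])
    have "openin (top_of_set ?S) (\<Union>i\<in>M. ?S \<inter> (\<lambda>c. c i) -` (- {0}))"
      by (intro openin_Union) (auto intro!: continuous_openin_preimage_gen co)
    moreover have "(\<Union>i\<in>M. ?S \<inter> (\<lambda>c. c i) -` (- {0})) = proj_complement k M"
      by (auto simp: proj_complement_def)
    ultimately show "openin (top_of_set ?S) (proj_complement k M)" by simp
  qed
  have openA: "openin ?X (line ` affine_part k M)"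
  proof (rule openin_line_image[OF S])
    have "openin (top_of_set ?S) (?S \<inter> (\<lambda>c. c k) -` (- {0}))"
      by (auto intro!: continuous_openin_preimage_gen co)
    moreover have "?S \<inter> (\<lambda>c. c k) -` (- {0}) = affine_part k M"
      by (auto simp: affine_part_def)
    ultimately show "openin (top_of_set ?S) (affine_part k M)" by simp
  qed
  have AS: "affine_part k M \<subseteq> ?S" and VS: "proj_complement k M \<subseteq> ?S"
    by (auto simp: affine_part_def proj_complement_def)
  have cA: "punctured_cone (affine_part k M)" by (rule punctured_cone_parts)
  have XZ: "topspace ?X - ?Z = line ` affine_part k M"
    using line_image_diff[OF cA subset_refl, of ?S] AS by (simp add: Int_absorb2)
  have ZX: "?Z \<subseteq> topspace ?X" by auto
  have "closedin ?X ?Z"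
    unfolding closedin_def using openA XZ ZX by auto
  moreover have "?Z \<subseteq> ?V"
  proof (rule image_mono, rule subsetI)
    fix c assume c: "c \<in> ?S - affine_part k M"
    then obtain i where i: "c i \<noteq> 0" by (auto simp: fun_eq_iff)
    with c have "i \<in> M" by (auto simp: affine_part_def coord_space_def)
    with i c show "c \<in> proj_complement k M" by (auto simp: proj_complement_def)
  qed
  ultimately have clo: "?X closure_of ?Z \<subseteq> ?X interior_of ?V"
    using openV by (simp add: closure_of_closedin interior_of_openin)
  have VZ: "?V - ?Z = line ` (affine_part k M \<inter> proj_complement k M)"
    by (rule line_image_diff[OF cA VS])
  have sub: "subtopology ?X (topspace ?X - ?Z) = line_space (affine_part k M)"
    unfolding XZ by (rule subtopology_line_space[OF S cA AS])
  have "hom_induced p (subtopology ?X (topspace ?X - ?Z)) (?V - ?Z) (subtopology ?X (topspace ?X)) ?V id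
    \<in> iso (relative_homology_group p (subtopology ?X (topspace ?X - ?Z)) (?V - ?Z))
        (relative_homology_group p (subtopology ?X (topspace ?X)) ?V)"
    by (rule homology_excision_axiom[OF clo]) (use VS in auto)
  then have "relative_homology_group p (line_space (affine_part k M)) (?V - ?Z) \<cong>
      relative_homology_group p ?X ?V"
    unfolding sub subtopology_topspace by (rule is_isoI)
  then have "relative_homology_group p ?X ?V \<cong>
      relative_homology_group p (line_space (affine_part k M)) (?V - ?Z)"
    by (rule group.iso_sym[rotated]) simp
  also have "\<dots> \<cong> relative_homology_group p (top_of_set (coord_space M)) (punctured_coord_space M)"
  proof -
    obtain f g where fg: "homeomorphic_maps (line_space (affine_part k M)) (top_of_set (coord_space M)) f g"
      and im: "f ` line ` (affine_part k M \<inter> proj_complement k M) = punctured_coord_space M"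
      using affine_part_homeomorphic[OF k] by blast
    have "homeomorphic_map (line_space (affine_part k M)) (top_of_set (coord_space M)) f"
      using fg homeomorphic_map_maps by blast
    from homeomorphic_map_relative_homology_iso[OF this _ im, of p] show ?thesis
      unfolding VZ by (auto intro!: is_isoI)
  qed
  also have "\<dots> \<cong> homology_group (p - 2 * int (card M)) (Euclidean_space 0)"
    by (rule relative_homology_group_coord_space_origin[OF M])
  finally (iso_trans) show ?thesis .
qed

text \<open>Long exact sequence of the pair (\<open>?X\<close>, \<open>?V\<close>):
  \<open>?V\<close> has the homology of the smaller projective space, in even degrees below
  \<open>?m\<close>, and the relative group is infinite cyclic in degree \<open>?m\<close> and
  trivial otherwise, so exactly one class is added.\<close>

lemma homology_group_projective_space:
  assumes "finite M" "M \<noteq> {}"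
  shows "(even p \<and> 0 \<le> p \<and> p < 2 * int (card M) \<longrightarrow>
      homology_group p (line_space (punctured_coord_space M)) \<cong> integer_group) \<and>
    (\<not> (even p \<and> 0 \<le> p \<and> p < 2 * int (card M)) \<longrightarrow>
      trivial_group (homology_group p (line_space (punctured_coord_space M))))"
  using assms
proof (induction M arbitrary: p rule: finite_ne_induct)
  case (singleton k)
  have "line ` punctured_coord_space {k} = {line (\<lambda>i. if i = k then 1 else 0)}"
  proof (intro equalityI subsetI)
    fix l assume "l \<in> line ` punctured_coord_space {k}"
    then obtain s where s: "s \<in> coord_space {k}" "s \<noteq> (\<lambda>_. 0)" "l = line s" by auto
    have eq: "s = (\<lambda>x. s k * (if x = k then 1 else 0))"
      using s(1) by (auto simp: coord_space_def fun_eq_iff)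
    then have "s k \<noteq> 0" using s(2) by force
    from line_scale[OF this] eq s(3) show "l \<in> {line (\<lambda>i. if i = k then 1 else 0)}" by (metis singletonI)
  next
    fix l assume "l \<in> {line (\<lambda>i. if i = k then 1 else 0 :: complex)}"
    moreover have "(\<lambda>i. if i = k then 1 else 0) \<in> punctured_coord_space {k}"
      by (auto simp: coord_space_def fun_eq_iff)
    ultimately show "l \<in> line ` punctured_coord_space {k}" by blast
  qed
  then have top: "topspace (line_space (punctured_coord_space {k})) = {line (\<lambda>i. if i = k then 1 else 0)}"
    by simp
  have "even p \<and> 0 \<le> p \<and> p < 2 * int (card {k}) \<longleftrightarrow> p = 0" by (auto elim!: evenE)
  with homology_group_singleton[OF top] show ?case by auto
next
  case (insert k M)
  let ?X = "line_space (punctured_coord_space (insert k M))"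
  let ?V = "line ` proj_complement k M"
  let ?m = "2 * int (card M)"
  have k: "k \<notin> M" by (rule insert.hyps)
  have m: "?m \<ge> 2" using insert.hyps by (simp add: Suc_le_eq card_gt_0_iff)
  have card: "2 * int (card (insert k M)) = ?m + 2" using insert.hyps by simp
  have VS: "proj_complement k M \<subseteq> punctured_coord_space (insert k M)" by (auto simp: proj_complement_def)
  have subV: "subtopology ?X ?V = line_space (proj_complement k M)"
    by (rule subtopology_line_space[OF punctured_cone_coord_space punctured_cone_parts(1)[OF k] VS])
  have HV: "homology_group q (subtopology ?X ?V) \<cong> homology_group q (line_space (punctured_coord_space M))" for q
    unfolding subV
    by (rule homotopy_equivalent_space_imp_isomorphic_homology_groups[OF proj_complement_homotopy_equivalent[OF k]])
  have V1: "homology_group q (subtopology ?X ?V) \<cong> integer_group" if "even q" "0 \<le> q" "q < ?m" for q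
    using insert.IH[of q] that iso_trans[OF HV[of q]] by blast
  have V0: "trivial_group (homology_group q (subtopology ?X ?V))" if "\<not> (even q \<and> 0 \<le> q \<and> q < ?m)" for q
    using insert.IH[of q] that isomorphic_group_triviality[OF HV[of q]] by auto
  have top0: "topspace (Euclidean_space 0) = {\<lambda>_. 0}" by (auto simp: topspace_Euclidean_space)
  note rel = relative_homology_group_proj_complement[OF k insert.hyps(1)]
  have R1: "relative_homology_group ?m ?X ?V \<cong> integer_group"
    using iso_trans[OF rel[of ?m]] homology_group_singleton(1)[OF top0] by simp
  have R0: "trivial_group (relative_homology_group q ?X ?V)" if "q \<noteq> ?m" for q
    using isomorphic_group_triviality[OF rel[of q]] homology_group_singleton(2)[OF top0, of "q - ?m"] that
    by auto
  \<comment> \<open>Degree \<open>?m - 1\<close> is separate because the relative group one degree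
    higher is not trivial; there both neighbours of the group of \<open>?X\<close> vanish. In
    degrees other than these two the inclusion of \<open>?V\<close> is an isomorphism.\<close>
  consider "p = ?m" | "p = ?m - 1" | "p \<noteq> ?m" "p \<noteq> ?m - 1" by blast
  then show ?case
  proof cases
    case 1
    have "hom_induced p ?X {} ?X ?V id \<in> iso (homology_group p ?X) (relative_homology_group p ?X ?V)"
    proof (rule very_short_exact_sequence)
      show "exact_seq ([homology_group (p - 1) (subtopology ?X ?V), relative_homology_group p ?X ?V,
          homology_group p ?X, homology_group p (subtopology ?X ?V)],
          [hom_boundary p ?X ?V, hom_induced p ?X {} ?X ?V id, hom_induced p (subtopology ?X ?V) {} ?X {} id])"
        using homology_exactness_axiom_1[of p ?X ?V] homology_exactness_axiom_3[of p ?X ?V] by auto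
      show "trivial_group (homology_group p (subtopology ?X ?V))" using V0[of p] 1 by auto
      show "trivial_group (homology_group (p - 1) (subtopology ?X ?V))" using V0[of "p - 1"] 1 by auto
    qed
    then have "homology_group p ?X \<cong> integer_group" using 1 R1 iso_trans is_isoI by blast
    with 1 card show ?thesis by auto
  next
    case 2
    have "trivial_group (homology_group p ?X)"
      by (rule exact_seq_trivial_middle[OF homology_exactness_axiom_3[of p ?X ?V]])
        (use V0[of p] R0[of p] 2 in auto)
    with 2 show ?thesis by auto
  next
    case 3
    have "hom_induced p (subtopology ?X ?V) {} ?X {} id
        \<in> iso (homology_group p (subtopology ?X ?V)) (homology_group p ?X)"
    proof (rule very_short_exact_sequence)
      show "exact_seq ([relative_homology_group p ?X ?V, homology_group p ?X,
          homology_group p (subtopology ?X ?V), relative_homology_group (p + 1) ?X ?V],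
          [hom_induced p ?X {} ?X ?V id, hom_induced p (subtopology ?X ?V) {} ?X {} id, hom_boundary (p + 1) ?X ?V])"
        using homology_exactness_axiom_2[of "p + 1" ?X ?V] homology_exactness_axiom_3[of p ?X ?V] by auto
    qed (use R0[of p] R0[of "p + 1"] 3 in auto)
    then have iso: "homology_group p (subtopology ?X ?V) \<cong> homology_group p ?X" by (rule is_isoI)
    show ?thesis
    proof (cases "even p \<and> 0 \<le> p \<and> p < ?m")
      case True
      have "homology_group p ?X \<cong> homology_group p (subtopology ?X ?V)"
        using iso by (rule group.iso_sym[rotated]) simp
      from iso_trans[OF this] V1[of p] True card show ?thesis by auto
    next
      case False
      have "trivial_group (homology_group p ?X)"
        using isomorphic_group_triviality[OF iso] V0[OF False] by auto
      moreover have "\<not> (even p \<and> 0 \<le> p \<and> p < ?m + 2)"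
        using False 3 by (auto elim!: evenE)
      ultimately show ?thesis unfolding card by auto
    qed
  qed
qed

lemma euler_characteristic_projective_space:
  assumes "finite M" "M \<noteq> {}" and X: "X homotopy_equivalent_space line_space (punctured_coord_space M)"
  shows "finite_betti X" "euler_characteristic X = int (card M)"
proof -
  note iso = homotopy_equivalent_space_imp_isomorphic_homology_groups[OF X]
  have b: "betti p X = (if even p \<and> p < 2 * card M then 1 else 0)" for p
  proof (cases "even p \<and> p < 2 * card M")
    case True
    then have "homology_group (int p) (line_space (punctured_coord_space M)) \<cong> integer_group"
      using homology_group_projective_space[OF assms(1,2), of "int p"] by auto
    then have "homology_group (int p) X \<cong> integer_group" using iso_trans[OF iso] by blast
    with True show ?thesis
      unfolding betti_def by (simp add: group_rank_infinite_cyclic abelian_homology_group)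
  next
    case False
    then have "trivial_group (homology_group (int p) (line_space (punctured_coord_space M)))"
      using homology_group_projective_space[OF assms(1,2), of "int p"] by auto
    then have "trivial_group (homology_group (int p) X)"
      using isomorphic_group_triviality[OF iso] by auto
    with False show ?thesis
      unfolding betti_def by (auto simp: group_rank_trivial abelian_homology_group)
  qed
  have set: "{p. betti p X \<noteq> 0} = (\<lambda>i. 2 * i) ` {..<card M}"
    by (auto simp: b elim!: evenE)
  show "finite_betti X"
    unfolding finite_betti_def set by (auto simp: b one_enat_def zero_enat_def)
  have "euler_characteristic X = (\<Sum>i<card M. (- 1) ^ (2 * i) * int (the_enat (betti (2 * i) X)))"
    unfolding euler_characteristic_def set by (subst sum.reindex) (auto simp: inj_on_def)
  also have "\<dots> = (\<Sum>i<card M. 1)"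
    by (rule sum.cong) (auto simp: b one_enat_def)
  finally show "euler_characteristic X = int (card M)" by simp
qed

section \<open>Generating series of weighted monomials\<close>

lemma mps_coeff_simps:
  "mps_coeff 0 a = 0" "mps_coeff 1 a = (if a = 0 then 1 else 0)"
  "mps_coeff (f + g) a = mps_coeff f a + mps_coeff g a"
  "mps_coeff (f - g) a = mps_coeff f a - mps_coeff g a"
  "mps_coeff (mps_monom m) a = (if a = m then 1 else 0)"
  "mps_coeff (Abs_mps F) a = F a"
  by (simp_all add: zero_mps.rep_eq one_mps.rep_eq plus_mps.rep_eq minus_mps.rep_eq mps_monom_def
      Abs_mps_inverse)

lemma mps_coeff_monom_times:
  "mps_coeff (mps_monom m * g) (m + b) = mps_coeff g b"
  "(\<And>b. a \<noteq> m + b) \<Longrightarrow> mps_coeff (mps_monom m * g) a = 0"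
proof -
  have "mps_coeff (mps_monom m * g) (m + b)
      = (\<Sum>(u, w)\<in>splits (m + b). (if u = m then 1 else 0) * mps_coeff g w)"
    by (simp add: times_mps.rep_eq mps_coeff_simps case_prod_unfold)
  also have "\<dots> = (\<Sum>(u, w)\<in>{(m, b)}. (if u = m then 1 else 0) * mps_coeff g w)"
    by (rule sum.mono_neutral_right[OF finite_splits]) (auto simp: splits_def split: if_splits)
  finally show "mps_coeff (mps_monom m * g) (m + b) = mps_coeff g b" by simp
  assume a: "\<And>b. a \<noteq> m + b"
  have "mps_coeff (mps_monom m * g) a
      = (\<Sum>(u, w)\<in>splits a. (if u = m then 1 else 0) * mps_coeff g w)"
    by (simp add: times_mps.rep_eq mps_coeff_simps case_prod_unfold)
  also have "\<dots> = 0" by (rule sum.neutral) (use a in \<open>auto simp: splits_def\<close>)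
  finally show "mps_coeff (mps_monom m * g) a = 0" .
qed

lemma mps_monom_mult: "mps_monom a * mps_monom b = mps_monom (a + b)"
proof (rule mps_eqI)
  fix c
  show "mps_coeff (mps_monom a * mps_monom b) c = mps_coeff (mps_monom (a + b)) c"
  proof (cases "\<exists>d. c = a + d")
    case True
    then show ?thesis by (auto simp: mps_coeff_monom_times mps_coeff_simps)
  next
    case False
    then have "mps_coeff (mps_monom a * mps_monom b) c = 0" by (intro mps_coeff_monom_times(2)) auto
    with False show ?thesis by (auto simp: mps_coeff_simps)
  qed
qed

lemma mps_monom_0: "mps_monom 0 = 1"
  by (rule mps_eqI) (simp add: mps_coeff_simps)

lemma mps_monom_sum: "mps_monom (sum f A) = (\<Prod>i\<in>A. mps_monom (f i))"
  by (induction A rule: infinite_finite_induct) (simp_all add: mps_monom_0 mps_monom_mult[symmetric])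

lemma t_var_power: "t_var i ^ n = mps_monom (Poly_Mapping.single i n)"
  by (induction n) (simp_all add: mps_monom_0 t_var_def mps_monom_mult flip: single_add)

lemma t_pow_eq_monom: "t_pow r v = mps_monom (\<Sum>i = 1..r. Poly_Mapping.single i (nat (v i)))"
  by (simp add: t_pow_def t_var_power mps_monom_sum)

definition unit_exponent :: "'d \<Rightarrow> 'd \<Rightarrow> nat" where
  "unit_exponent i = (\<lambda>k. if k = i then 1 else 0)"

text \<open>The exponents counted by \<open>?S\<close> but not by \<open>?T\<close> are those with
  \<open>a i > 0\<close>, and these are the shifts, by the unit exponent of \<open>i\<close>, of all
  exponents supported in \<open>insert i I\<close>.\<close>

lemma generating_series_step:
  fixes wt :: "('d \<Rightarrow> nat) \<Rightarrow> (nat \<Rightarrow>\<^sub>0 nat)"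
  assumes add: "\<And>a b. wt (\<lambda>k. a k + b k) = wt a + wt b"
    and fin: "\<And>b. finite {a. wt a = b}" and i: "i \<notin> I"
  shows "Abs_mps (\<lambda>b. int (card {a. (\<forall>k. k \<notin> insert i I \<longrightarrow> a k = 0) \<and> wt a = b})) *
      (1 - mps_monom (wt (unit_exponent i)))
    = Abs_mps (\<lambda>b. int (card {a. (\<forall>k. k \<notin> I \<longrightarrow> a k = 0) \<and> wt a = b}))" (is "?S * _ = ?T")
proof (rule mps_eqI)
  fix b
  let ?m = "wt (unit_exponent i)"
  let ?A = "\<lambda>J b. {a. (\<forall>k. k \<notin> J \<longrightarrow> a k = 0) \<and> wt a = b}"
  let ?P = "{a \<in> ?A (insert i I) b. a i > 0}"
  have finA: "finite (?A J b)" for J b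
    by (rule finite_subset[OF _ fin[of b]]) auto
  have split: "?A (insert i I) b = ?A I b \<union> ?P"
    using i by (auto; metis neq0_conv)
  have disj: "?A I b \<inter> ?P = {}" using i by auto
  have card: "int (card (?A (insert i I) b)) = int (card (?A I b)) + int (card ?P)"
    using card_Un_disjoint[OF finA[of I b] _ disj] finA[of "insert i I" b]
    by (subst split) (simp del: mem_Collect_eq)
  have shift: "?P = (\<lambda>a k. a k + unit_exponent i k) ` {a. (\<forall>k. k \<notin> insert i I \<longrightarrow> a k = 0) \<and> wt a + ?m = b}"
  proof (intro equalityI subsetI)
    fix a assume a: "a \<in> ?P"
    let ?a = "\<lambda>k. a k - unit_exponent i k"
    have eq: "a = (\<lambda>k. ?a k + unit_exponent i k)"
      using a by (auto simp: unit_exponent_def fun_eq_iff)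
    have "wt ?a + ?m = b" using add[of ?a "unit_exponent i"] eq a by auto
    with a eq show "a \<in> (\<lambda>a k. a k + unit_exponent i k) ` {a. (\<forall>k. k \<notin> insert i I \<longrightarrow> a k = 0) \<and> wt a + ?m = b}"
      by (intro image_eqI[of _ _ ?a]) auto
  next
    fix a assume "a \<in> (\<lambda>a k. a k + unit_exponent i k) ` {a. (\<forall>k. k \<notin> insert i I \<longrightarrow> a k = 0) \<and> wt a + ?m = b}"
    then show "a \<in> ?P" by (auto simp: add unit_exponent_def)
  qed
  have cardP: "card ?P = card {a. (\<forall>k. k \<notin> insert i I \<longrightarrow> a k = 0) \<and> wt a + ?m = b}"
    unfolding shift by (rule card_image) (auto simp: inj_on_def fun_eq_iff)
  have main: "mps_coeff (mps_monom ?m * ?S) b = int (card ?P)"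
  proof (cases "\<exists>b'. b = ?m + b'")
    case True
    then obtain b' where b': "b = ?m + b'" by blast
    have "wt a + ?m = b \<longleftrightarrow> wt a = b'" for a unfolding b' by (metis add.commute add_left_cancel)
    then have "card ?P = card {a. (\<forall>k. k \<notin> insert i I \<longrightarrow> a k = 0) \<and> wt a = b'}"
      unfolding cardP by (simp only:)
    moreover have "mps_coeff (mps_monom ?m * ?S) b = mps_coeff ?S b'"
      unfolding b' by (rule mps_coeff_monom_times(1))
    ultimately show ?thesis by (simp only: mps_coeff_simps)
  next
    case False
    then have "mps_coeff (mps_monom ?m * ?S) b = 0" by (intro mps_coeff_monom_times(2)) auto
    moreover have "{a. (\<forall>k. k \<notin> insert i I \<longrightarrow> a k = 0) \<and> wt a + ?m = b} = {}"
      using False by (auto simp: add.commute)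
    ultimately show ?thesis unfolding cardP by (simp only: card.empty of_nat_0)
  qed
  have "?S * (1 - mps_monom ?m) = ?S - mps_monom ?m * ?S" by (simp add: algebra_simps)
  then show "mps_coeff (?S * (1 - mps_monom ?m)) b = mps_coeff ?T b"
    using main card by (simp add: mps_coeff_simps)
qed

text \<open>Each factor removes one variable from the monomials counted; in the end only the
  exponent 0 is left, whose weight is 0 by additivity.\<close>

lemma generating_series_times_prod:
  fixes wt :: "('d::finite \<Rightarrow> nat) \<Rightarrow> (nat \<Rightarrow>\<^sub>0 nat)"
  assumes add: "\<And>a b. wt (\<lambda>k. a k + b k) = wt a + wt b"
    and fin: "\<And>b. finite {a. wt a = b}"
  shows "Abs_mps (\<lambda>b. int (card {a. wt a = b})) * (\<Prod>i\<in>UNIV. 1 - mps_monom (wt (unit_exponent i))) = 1"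
proof -
  have "Abs_mps (\<lambda>b. int (card {a. (\<forall>k. k \<notin> I \<longrightarrow> a k = 0) \<and> wt a = b})) *
      (\<Prod>i\<in>I. 1 - mps_monom (wt (unit_exponent i))) = 1" if "finite I" for I
    using that
  proof (induction I)
    case empty
    have "wt (\<lambda>_. 0) + wt (\<lambda>_. 0) = wt (\<lambda>_. 0) + 0" using add[of "\<lambda>_. 0" "\<lambda>_. 0"] by simp
    then have "wt (\<lambda>_. 0) = 0" by (simp only: add_left_cancel)
    moreover have "(\<forall>k. a k = 0) \<longleftrightarrow> a = (\<lambda>_. 0)" for a :: "'d \<Rightarrow> nat" by auto
    ultimately have "{a. (\<forall>k. a k = 0) \<and> wt a = b} = (if b = 0 then {\<lambda>_. 0} else {})" for b
      by auto
    then show ?case by (intro mps_eqI) (simp add: mps_coeff_simps)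
  next
    case (insert i I)
    then show ?case
      using generating_series_step[OF add fin, of i I] by (simp add: mult.assoc[symmetric])
  qed
  from this[of UNIV] show ?thesis by simp
qed

text \<open>Up to sign the inverse is a geometric series, obtained as the generating series for a
  single variable, indexed by the type \<open>unit\<close>, of weight \<open>m\<close>. As
  \<open>m\<close> is nonzero, no weight occurs more than once.\<close>

lemma one_minus_monom_unit:
  assumes "m \<noteq> 0"
  shows "mps_monom m - 1 dvd 1"
proof -
  define wt :: "(unit \<Rightarrow> nat) \<Rightarrow> (nat \<Rightarrow>\<^sub>0 nat)" where "wt a = ((+) m ^^ a ()) 0" for a
  have "Poly_Mapping.lookup (((+) m ^^ n) 0) k = n * Poly_Mapping.lookup m k" for n k
    by (induction n) (simp_all add: lookup_add)
  then have lookup: "Poly_Mapping.lookup (wt a) k = a () * Poly_Mapping.lookup m k" for a k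
    by (simp add: wt_def)
  have "wt (\<lambda>k. a k + b k) = wt a + wt b" for a b
    by (rule poly_mapping_eqI) (simp add: lookup lookup_add algebra_simps)
  moreover have "finite {a. wt a = b}" for b
  proof -
    obtain k where k: "Poly_Mapping.lookup m k \<noteq> 0"
      using assms by (metis poly_mapping_eqI lookup_zero)
    have uniq: "a = a'" if "wt a = b" "wt a' = b" for a a'
    proof -
      have "a () = a' ()" using lookup[of a k] lookup[of a' k] that k by auto
      then show ?thesis by auto
    qed
    show ?thesis
    proof (cases "\<exists>a. wt a = b")
      case True
      then obtain a where "wt a = b" by blast
      with uniq have "{a. wt a = b} = {a}" by blast
      then show ?thesis by simp
    qed simp
  qed
  ultimately have "Abs_mps (\<lambda>b. int (card {a. wt a = b})) *
      (\<Prod>i\<in>UNIV. 1 - mps_monom (wt (unit_exponent i))) = 1"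
    by (rule generating_series_times_prod)
  moreover have "wt (unit_exponent i) = m" for i
    by (simp add: wt_def unit_exponent_def)
  ultimately have "(1 - mps_monom m) dvd 1"
    by (simp add: UNIV_unit) (metis dvd_triv_right)
  then show ?thesis by (metis minus_diff_eq minus_dvd_iff)
qed


section \<open>The numerator of the Poincare series for monomial valuations\<close>

text \<open>The value of the monomial valuation with weights \<open>w\<close> on the monomial with
  exponent \<open>a\<close>.\<close>

definition dot :: "('d::finite \<Rightarrow> nat) \<Rightarrow> ('d \<Rightarrow> nat) \<Rightarrow> nat" where
  "dot w a = (\<Sum>k\<in>UNIV. w k * a k)"

lemma dot_add: "dot w (\<lambda>k. a k + b k) = dot w a + dot w b"
  by (simp add: dot_def algebra_simps sum.distrib)

lemma dot_unit_exponent: "dot w (unit_exponent i) = w i"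
  by (simp add: dot_def unit_exponent_def if_distrib[of "\<lambda>x. _ * x"] cong: if_cong)

lemma sum_le_dot: "(\<And>k. w k \<ge> 1) \<Longrightarrow> (\<Sum>k\<in>UNIV. a k) \<le> dot w a"
  unfolding dot_def by (rule sum_mono) (metis mult_le_mono1 mult_1)

lemma finite_exponents_le: "finite {a :: 'd::finite \<Rightarrow> nat. (\<Sum>k\<in>UNIV. a k) \<le> m}"
proof (rule finite_subset)
  show "{a :: 'd \<Rightarrow> nat. (\<Sum>k\<in>UNIV. a k) \<le> m} \<subseteq> UNIV \<rightarrow>\<^sub>E {..m}"
  proof
    fix a :: "'d \<Rightarrow> nat" assume "a \<in> {a. (\<Sum>k\<in>UNIV. a k) \<le> m}"
    then have "a k \<le> m" for k using member_le_sum[of k UNIV a] by simp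
    then show "a \<in> UNIV \<rightarrow>\<^sub>E {..m}" by auto
  qed
  show "finite ((UNIV :: 'd set) \<rightarrow>\<^sub>E {..m})" by (rule finite_PiE) auto
qed

lemma finite_dot_le:
  assumes "\<And>k. w k \<ge> 1"
  shows "finite {a. dot w a \<le> m}"
  by (rule finite_subset[OF _ finite_exponents_le[of m]]) (use sum_le_dot[of w, OF assms] in \<open>auto intro: order_trans\<close>)

text \<open>The coefficient at \<open>v\<close> involves only exponents at most \<open>v\<close>, so
  \<open>L\<close> may be replaced by a formula built on a finite set that depends on
  \<open>v\<close>.\<close>

lemma fold_mult_cong:
  assumes "\<And>w. (\<forall>i. w i \<le> v i) \<Longrightarrow> L w = L' w"
  shows "fold mult_t_minus_1 js L v = fold mult_t_minus_1 js L' v"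
  using assms
proof (induction js arbitrary: L L')
  case (Cons j js)
  have "mult_t_minus_1 j L w = mult_t_minus_1 j L' w" if "\<forall>i. w i \<le> v i" for w
  proof -
    have "\<forall>i. (w(j := w j - 1)) i \<le> v i" using that by (auto intro: order_trans[rotated])
    from Cons.prems[OF this] Cons.prems[OF that] show ?thesis by (simp only: mult_t_minus_1_def)
  qed
  from Cons.IH[of "mult_t_minus_1 j L" "mult_t_minus_1 j L'", OF this] show ?case by simp
qed simp

lemma fold_mult_diff:
  "fold mult_t_minus_1 js (\<lambda>w. f w - g w) = (\<lambda>w. fold mult_t_minus_1 js f w - fold mult_t_minus_1 js g w)"
proof (induction js arbitrary: f g)
  case (Cons j js)
  have "mult_t_minus_1 j (\<lambda>w. f w - g w) = (\<lambda>w. mult_t_minus_1 j f w - mult_t_minus_1 j g w)"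
    by (simp add: mult_t_minus_1_def fun_eq_iff)
  then show ?case by (simp add: Cons.IH)
qed simp

lemma fold_mult_sum:
  "fold mult_t_minus_1 js (\<lambda>w. \<Sum>a\<in>F. f a w) = (\<lambda>w. \<Sum>a\<in>F. fold mult_t_minus_1 js (f a) w)"
proof (induction js arbitrary: f)
  case (Cons j js)
  have "mult_t_minus_1 j (\<lambda>w. \<Sum>a\<in>F. f a w) = (\<lambda>w. \<Sum>a\<in>F. mult_t_minus_1 j (f a) w)"
    by (simp add: mult_t_minus_1_def fun_eq_iff sum_subtractf)
  then show ?case by (simp add: Cons.IH)
qed simp

text \<open>The product of \<open>t_j - 1\<close> with the sum of all powers of \<open>t_j\<close>
  up to the n-th is the power n + 1 alone. \<open>A\<close> holds the variables already treated,
  \<open>B\<close> those that are still only bounded.\<close>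

lemma fold_mult_indicator:
  assumes "distinct js" "set js \<subseteq> B" "A \<inter> B = {}"
  shows "fold mult_t_minus_1 js (\<lambda>w. of_bool ((\<forall>i\<in>A. w i = n i + 1) \<and> (\<forall>i\<in>B. w i \<le> n i)))
    = (\<lambda>w. of_bool ((\<forall>i\<in>A \<union> set js. w i = n i + 1) \<and> (\<forall>i\<in>B - set js. w i \<le> n i)))"
  using assms
proof (induction js arbitrary: A B)
  case (Cons j js)
  have "mult_t_minus_1 j (\<lambda>w. of_bool ((\<forall>i\<in>A. w i = n i + 1) \<and> (\<forall>i\<in>B. w i \<le> n i)))
      = (\<lambda>w. of_bool ((\<forall>i\<in>insert j A. w i = n i + 1) \<and> (\<forall>i\<in>B - {j}. w i \<le> n i)))"
  proof
    fix w :: "nat \<Rightarrow> int"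
    have jB: "j \<in> B" "j \<notin> A" using Cons.prems by auto
    have a: "(\<forall>i\<in>A. (w(j := w j - 1)) i = n i + 1) \<longleftrightarrow> (\<forall>i\<in>A. w i = n i + 1)" using jB by auto
    have b: "(\<forall>i\<in>B. (w(j := w j - 1)) i \<le> n i) \<longleftrightarrow> w j - 1 \<le> n j \<and> (\<forall>i\<in>B - {j}. w i \<le> n i)"
      using jB by auto
    have c: "(\<forall>i\<in>B. w i \<le> n i) \<longleftrightarrow> w j \<le> n j \<and> (\<forall>i\<in>B - {j}. w i \<le> n i)" using jB by auto
    show "mult_t_minus_1 j (\<lambda>w. of_bool ((\<forall>i\<in>A. w i = n i + 1) \<and> (\<forall>i\<in>B. w i \<le> n i))) w
      = of_bool ((\<forall>i\<in>insert j A. w i = n i + 1) \<and> (\<forall>i\<in>B - {j}. w i \<le> n i))"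
      unfolding mult_t_minus_1_def a b c by (auto simp: of_bool_def)
  qed
  moreover have "fold mult_t_minus_1 js (\<lambda>w. of_bool ((\<forall>i\<in>insert j A. w i = n i + 1) \<and> (\<forall>i\<in>B - {j}. w i \<le> n i)))
      = (\<lambda>w. of_bool ((\<forall>i\<in>insert j A \<union> set js. w i = n i + 1) \<and> (\<forall>i\<in>B - {j} - set js. w i \<le> n i)))"
    by (rule Cons.IH) (use Cons.prems in auto)
  moreover have "insert j A \<union> set js = A \<union> set (j # js)" "B - {j} - set js = B - set (j # js)" by auto
  ultimately show ?case by simp
qed simp

text \<open>A monomial with vector of values \<nu> is counted at v by the indicator of v \<le> \<nu>
  minus that of v + 1 \<le> \<nu>. Multiplication by all \<open>t_i - 1\<close> turns these two
  orthants into the single points \<nu> + 1 and \<nu>.\<close>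

lemma fold_mult_hilbert:
  fixes N :: "nat \<Rightarrow> 'd::finite \<Rightarrow> nat"
  assumes N: "\<And>i k. i \<in> {1..r} \<Longrightarrow> N i k \<ge> 1" and r: "r \<ge> 1"
  shows "fold mult_t_minus_1 [1..<Suc r] (\<lambda>v. int (card {a. (\<forall>i\<in>{1..r}. nat (v i) \<le> dot (N i) a) \<and>
        \<not> (\<forall>i\<in>{1..r}. nat (v i + 1) \<le> dot (N i) a)})) v
    = int (card {a. \<forall>i\<in>{1..r}. v i = int (dot (N i) a) + 1}) - int (card {a. \<forall>i\<in>{1..r}. v i = int (dot (N i) a)})"
proof -
  \<comment> \<open>All exponents that are counted at some w \<le> v lie in \<open>F\<close>, so one
    finite index set serves for all these w.\<close>
  define F where "F = (\<Union>i\<in>{1..r}. {a. dot (N i) a \<le> nat (v i)})"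
  have F: "finite F" unfolding F_def by (intro finite_UN_I finite_dot_le N) auto
  let ?h1 = "\<lambda>a w. of_bool ((\<forall>i\<in>{}. w i = int (dot (N i) a) + 1) \<and> (\<forall>i\<in>{1..r}. w i \<le> int (dot (N i) a))) :: int"
  let ?h2 = "\<lambda>a w. of_bool ((\<forall>i\<in>{}. w i = (int (dot (N i) a) - 1) + 1) \<and> (\<forall>i\<in>{1..r}. w i \<le> int (dot (N i) a) - 1)) :: int"
  have H: "int (card {a. (\<forall>i\<in>{1..r}. nat (w i) \<le> dot (N i) a) \<and> \<not> (\<forall>i\<in>{1..r}. nat (w i + 1) \<le> dot (N i) a)})
      = (\<Sum>a\<in>F. ?h1 a w) - (\<Sum>a\<in>F. ?h2 a w)" if w: "\<forall>i. w i \<le> v i" for w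
  proof -
    let ?A = "{a. (\<forall>i\<in>{1..r}. nat (w i) \<le> dot (N i) a) \<and> \<not> (\<forall>i\<in>{1..r}. nat (w i + 1) \<le> dot (N i) a)}"
    have sub: "?A \<subseteq> F"
    proof
      fix a assume "a \<in> ?A"
      then obtain i where i: "i \<in> {1..r}" "\<not> nat (w i + 1) \<le> dot (N i) a" by auto
      then have "dot (N i) a \<le> nat (w i)" by linarith
      also have "\<dots> \<le> nat (v i)" using w by (simp add: nat_mono)
      finally show "a \<in> F" using i by (auto simp: F_def)
    qed
    have "int (card ?A) = (\<Sum>a\<in>F. of_bool (a \<in> ?A))"
      using sub F by (simp add: sum.If_cases Int_absorb1 of_bool_def del: mem_Collect_eq)
    also have "\<dots> = (\<Sum>a\<in>F. ?h1 a w - ?h2 a w)"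
    proof (rule sum.cong[OF refl])
      fix a
      have 1: "(\<forall>i\<in>{1..r}. nat (w i) \<le> dot (N i) a) \<longleftrightarrow> (\<forall>i\<in>{1..r}. w i \<le> int (dot (N i) a))"
        by (simp add: nat_le_iff)
      have 2: "(\<forall>i\<in>{1..r}. nat (w i + 1) \<le> dot (N i) a) \<longleftrightarrow> (\<forall>i\<in>{1..r}. w i \<le> int (dot (N i) a) - 1)"
        by (auto simp: nat_le_iff)
      have 3: "(\<forall>i\<in>{1..r}. w i \<le> int (dot (N i) a) - 1) \<Longrightarrow> (\<forall>i\<in>{1..r}. w i \<le> int (dot (N i) a))"
        by fastforce
      show "of_bool (a \<in> ?A) = ?h1 a w - ?h2 a w"
        unfolding mem_Collect_eq 1 2 using 3 by (auto simp: of_bool_def)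
    qed
    finally show ?thesis by (simp only: sum_subtractf)
  qed
  have d: "distinct [1..<Suc r]" and s: "set [1..<Suc r] = {1..r}" by auto
  have i1: "fold mult_t_minus_1 [1..<Suc r] (?h1 a) v = of_bool (\<forall>i\<in>{1..r}. v i = int (dot (N i) a) + 1)" for a
    by (subst fold_mult_indicator[OF d, where n = "\<lambda>i. int (dot (N i) a)"]) (auto simp: s simp del: upt_Suc)
  have i2: "fold mult_t_minus_1 [1..<Suc r] (?h2 a) v = of_bool (\<forall>i\<in>{1..r}. v i = int (dot (N i) a))" for a
    by (subst fold_mult_indicator[OF d, where n = "\<lambda>i. int (dot (N i) a) - 1"]) (auto simp: s simp del: upt_Suc)
  have c1: "(\<Sum>a\<in>F. of_bool (\<forall>i\<in>{1..r}. v i = int (dot (N i) a) + 1)) =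
      int (card {a. \<forall>i\<in>{1..r}. v i = int (dot (N i) a) + 1})"
  proof -
    have "{a. \<forall>i\<in>{1..r}. v i = int (dot (N i) a) + 1} \<subseteq> F" using r by (auto simp: F_def intro!: bexI[of _ 1])
    then show ?thesis using F by (simp add: sum.If_cases Int_absorb1 of_bool_def)
  qed
  have c2: "(\<Sum>a\<in>F. of_bool (\<forall>i\<in>{1..r}. v i = int (dot (N i) a))) =
      int (card {a. \<forall>i\<in>{1..r}. v i = int (dot (N i) a)})"
  proof -
    have "{a. \<forall>i\<in>{1..r}. v i = int (dot (N i) a)} \<subseteq> F" using r by (auto simp: F_def intro!: bexI[of _ 1])
    then show ?thesis using F by (simp add: sum.If_cases Int_absorb1 of_bool_def)
  qed
  show ?thesis
    by (subst fold_mult_cong[OF H], assumption)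
      (simp only: fold_mult_diff fold_mult_sum i1 i2 c1 c2)
qed

text \<open>Here \<open>N i\<close> is the weight vector of the \<open>i\<close>-th monomial valuation.\<close>

lemma nonneg_exponents_numerator:
  fixes N :: "nat \<Rightarrow> 'd::finite \<Rightarrow> nat"
  assumes N: "\<And>i k. i \<in> {1..r} \<Longrightarrow> N i k \<ge> 1" and r: "r \<ge> 1"
    and L: "\<And>v. L v = int (card {a. \<forall>i\<in>{1..r}. v i = int (dot (N i) a) + 1})
        - int (card {a. \<forall>i\<in>{1..r}. v i = int (dot (N i) a)})"
  shows "nonneg_exponents r L / ((\<Prod>i\<in>{1..r}. t_var i) - 1)
      * (\<Prod>k\<in>UNIV. 1 - t_pow r (\<lambda>i. int (N i k))) = 1"
proof -
  define wt where "wt a = (\<Sum>i = 1..r. Poly_Mapping.single i (dot (N i) a))" for a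
  have lookup_wt: "Poly_Mapping.lookup (wt a) j = (if j \<in> {1..r} then dot (N j) a else 0)" for a j
    by (simp add: wt_def lookup_sum lookup_single when_def)
  have add: "wt (\<lambda>k. a k + b k) = wt a + wt b" for a b
    by (simp add: wt_def dot_add single_add sum.distrib)
  have r1: "1 \<in> {1..r}" using r by auto
  have fin: "finite {a. wt a = b}" for b
  proof (rule finite_subset)
    show "{a. wt a = b} \<subseteq> {a. dot (N 1) a \<le> Poly_Mapping.lookup b 1}"
      using lookup_wt r1 by auto
  qed (rule finite_dot_le[OF N[OF r1]])
  define S where "S = Abs_mps (\<lambda>b. int (card {a. wt a = b}))"
  define m where "m = (\<Sum>i = 1..r. Poly_Mapping.single i (1::nat))"
  have lookup_m: "Poly_Mapping.lookup m j = (if j \<in> {1..r} then 1 else 0)" for j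
    by (simp add: m_def lookup_sum lookup_single when_def)
  have T: "(\<Prod>i\<in>{1..r}. t_var i) = mps_monom m"
    unfolding m_def mps_monom_sum t_var_def ..
  have "m \<noteq> 0" using lookup_m[of 1] r1 by (metis lookup_zero zero_neq_one)
  then have unit: "(mps_monom m - 1) * inverse (mps_monom m - 1) = 1"
    by (intro mps_inverse one_minus_monom_unit)
  have SP: "S * (\<Prod>k\<in>UNIV. 1 - t_pow r (\<lambda>i. int (N i k))) = 1"
  proof -
    have "t_pow r (\<lambda>i. int (N i k)) = mps_monom (wt (unit_exponent k))" for k
      by (simp add: t_pow_eq_monom wt_def dot_unit_exponent)
    with generating_series_times_prod[OF add fin] show ?thesis by (simp add: S_def)
  qed
  \<comment> \<open>Shifting by \<open>m\<close>, the exponent of the product of all variables, adds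
    1 to every value; so the two counts in \<open>L\<close> are the coefficients of
    \<open>mps_monom m * S\<close> and of \<open>S\<close>.\<close>
  have "nonneg_exponents r L = (mps_monom m - 1) * S"
  proof (rule mps_eqI)
    fix b
    have lhs: "mps_coeff (nonneg_exponents r L) b =
        (if Poly_Mapping.keys b \<subseteq> {1..r} then L (\<lambda>i. int (Poly_Mapping.lookup b i)) else 0)"
      by (simp add: nonneg_exponents_def mps_coeff_simps)
    have rhs: "mps_coeff ((mps_monom m - 1) * S) b = mps_coeff (mps_monom m * S) b - int (card {a. wt a = b})"
      by (simp add: left_diff_distrib mps_coeff_simps S_def)
    have ms: "mps_coeff (mps_monom m * S) b = int (card {a. m + wt a = b})"
    proof (cases "\<exists>b'. b = m + b'")
      case True
      then obtain b' where b': "b = m + b'" by blast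
      show ?thesis unfolding b' mps_coeff_monom_times(1) by (simp add: S_def mps_coeff_simps)
    next
      case False
      then have "mps_coeff (mps_monom m * S) b = 0" by (intro mps_coeff_monom_times(2)) auto
      moreover have "{a. m + wt a = b} = {}" using False by auto
      ultimately show ?thesis by (simp only: card.empty of_nat_0)
    qed
    show "mps_coeff (nonneg_exponents r L) b = mps_coeff ((mps_monom m - 1) * S) b"
    proof (cases "Poly_Mapping.keys b \<subseteq> {1..r}")
      case True
      then have b0: "Poly_Mapping.lookup b j = 0" if "j \<notin> {1..r}" for j
        using that by (meson in_keys_iff subsetD)
      have 1: "wt a = b \<longleftrightarrow> (\<forall>i\<in>{1..r}. int (Poly_Mapping.lookup b i) = int (dot (N i) a))" for a
        unfolding poly_mapping_eq_iff fun_eq_iff lookup_wt using b0 by auto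
      have 2: "m + wt a = b \<longleftrightarrow> (\<forall>i\<in>{1..r}. int (Poly_Mapping.lookup b i) = int (dot (N i) a) + 1)" for a
        unfolding poly_mapping_eq_iff fun_eq_iff lookup_add lookup_wt lookup_m
      proof (intro iffI ballI allI)
        fix i assume "\<forall>x. (if x \<in> {1..r} then 1 else 0) + (if x \<in> {1..r} then dot (N x) a else 0)
          = Poly_Mapping.lookup b x" "i \<in> {1..r}"
        from this(1)[rule_format, of i] this(2)
        show "int (Poly_Mapping.lookup b i) = int (dot (N i) a) + 1" by simp
      next
        fix x assume h: "\<forall>i\<in>{1..r}. int (Poly_Mapping.lookup b i) = int (dot (N i) a) + 1"
        show "(if x \<in> {1..r} then 1 else 0) + (if x \<in> {1..r} then dot (N x) a else 0)
          = Poly_Mapping.lookup b x"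
        proof (cases "x \<in> {1..r}")
          case True
          with bspec[OF h True] show ?thesis by simp
        qed (use b0 in auto)
      qed
      show ?thesis unfolding lhs rhs ms using True by (simp add: L 1 2)
    next
      case False
      then obtain j where j: "j \<notin> {1..r}" "Poly_Mapping.lookup b j \<noteq> 0"
        by (meson in_keys_iff subsetI)
      have "wt a \<noteq> b" "m + wt a \<noteq> b" for a
        using j lookup_wt[of a j] lookup_m[of j] by (auto simp: lookup_add)
      then show ?thesis unfolding lhs rhs ms using False by simp
    qed
  qed
  then have "nonneg_exponents r L / ((\<Prod>i\<in>{1..r}. t_var i) - 1) = S * ((mps_monom m - 1) * inverse (mps_monom m - 1))"
    unfolding T divide_mps_def by (simp only: ac_simps)
  then show ?thesis using unit SP by simp
qed

section \<open>Dimensions of quotients\<close>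

interpretation complex_functions: vector_space "\<lambda>(c::complex) (f :: 'a \<Rightarrow> complex) x. c * f x"
  by unfold_locales (auto simp: fun_eq_iff algebra_simps)

definition point_fun :: "'a \<Rightarrow> 'a \<Rightarrow> complex" where
  "point_fun a = (\<lambda>x. if x = a then 1 else 0)"

lemma sum_point_fun: "finite S \<Longrightarrow> (\<Sum>a\<in>S. u a * point_fun a x) = (if x \<in> S then u x else 0)"
  by (simp add: point_fun_def if_distrib[of "\<lambda>y. _ * y"] cong: if_cong)

lemma sum_fun_apply: "(\<Sum>a\<in>S. f a) x = (\<Sum>a\<in>S. f a x :: complex)"
  by (induction S rule: infinite_finite_induct) auto

lemma dim_finite_support:
  assumes S: "finite S"
  shows "complex_functions.dim {f :: 'a \<Rightarrow> complex. \<forall>x. x \<notin> S \<longrightarrow> f x = 0} = card S"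
proof -
  let ?V = "{f :: 'a \<Rightarrow> complex. \<forall>x. x \<notin> S \<longrightarrow> f x = 0}"
  have inj: "inj_on point_fun S"
    by (auto simp: inj_on_def point_fun_def fun_eq_iff split: if_splits)
  have "complex_functions.independent (point_fun ` S)"
  proof (subst complex_functions.dependent_finite)
    show "finite (point_fun ` S)" using S by simp
    show "\<not> (\<exists>u. (\<exists>v\<in>point_fun ` S. u v \<noteq> 0) \<and> (\<Sum>v\<in>point_fun ` S. (\<lambda>x. u v * v x)) = (0 :: 'a \<Rightarrow> complex))"
    proof (intro notI, elim exE conjE bexE)
      fix u v assume v: "v \<in> point_fun ` S" "u v \<noteq> 0"
        and "(\<Sum>v\<in>point_fun ` S. (\<lambda>x. u v * v x)) = (0 :: 'a \<Rightarrow> complex)"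
      then have eq: "(\<Sum>a\<in>S. (\<lambda>x. u (point_fun a) * point_fun a x)) = (0 :: 'a \<Rightarrow> complex)"
        by (simp add: sum.reindex[OF inj])
      then have 0: "(\<Sum>a\<in>S. u (point_fun a) * point_fun a x) = 0" for x
      proof -
        have "(\<Sum>a\<in>S. (\<lambda>x. u (point_fun a) * point_fun a x)) x = (0 :: 'a \<Rightarrow> complex) x"
          by (rule fun_cong[OF eq])
        then show ?thesis by (simp only: sum_fun_apply zero_fun_apply)
      qed
      from v obtain a where "a \<in> S" "u (point_fun a) \<noteq> 0" by auto
      with 0[of a] sum_point_fun[OF S, of "\<lambda>a. u (point_fun a)" a] show False by simp
    qed
  qed
  moreover have "point_fun ` S \<subseteq> ?V" by (auto simp: point_fun_def)
  moreover have "?V \<subseteq> complex_functions.span (point_fun ` S)"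
  proof
    fix f assume f: "f \<in> ?V"
    have "f = (\<Sum>a\<in>S. (\<lambda>x. f a * point_fun a x))"
      by (rule ext) (use f in \<open>auto simp: sum_fun_apply sum_point_fun[OF S]\<close>)
    also have "\<dots> \<in> complex_functions.span (point_fun ` S)"
      by (intro complex_functions.span_sum complex_functions.span_scale complex_functions.span_base) auto
    finally show "f \<in> complex_functions.span (point_fun ` S)" .
  qed
  ultimately have "card (point_fun ` S) = complex_functions.dim ?V"
    by (intro complex_functions.basis_card_eq_dim)
  then show ?thesis using card_image[OF inj] by simp
qed

text \<open>\<open>W\<close> is cut out of \<open>V\<close> by the coordinates in \<open>S\<close>,
  so the quotient is the space of functions on \<open>S\<close>. As \<open>quot_dim\<close> is a
  definite description, all bases modulo \<open>W\<close> have to be shown to have the same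
  cardinality.\<close>

lemma quot_dim_eq_card:
  fixes V :: "('a \<Rightarrow> complex) set"
  assumes S: "finite S" and pt: "\<And>a. a \<in> S \<Longrightarrow> point_fun a \<in> V"
    and sub: "complex_functions.subspace V"
    and W: "\<And>f. f \<in> W \<longleftrightarrow> f \<in> V \<and> (\<forall>a\<in>S. f a = 0)"
  shows "quot_dim V W = card S"
proof -
  have inj: "inj_on point_fun S"
    by (auto simp: inj_on_def point_fun_def fun_eq_iff split: if_splits)
  have comb: "(\<lambda>x. f x - (\<Sum>b\<in>B. c b * b x)) \<in> V" if "f \<in> V" "B \<subseteq> V" for f B c
  proof -
    have "(\<Sum>b\<in>B. (\<lambda>x. c b * b x)) \<in> V"
      by (rule complex_functions.subspace_sum[OF sub])
        (use that complex_functions.subspace_scale[OF sub] in auto)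
    from complex_functions.subspace_diff[OF sub that(1) this] show ?thesis
      by (simp add: fun_diff_def sum_fun_apply)
  qed
  have "basis_modulo V W (point_fun ` S)"
    unfolding basis_modulo_def
  proof (intro conjI ballI)
    show "finite (point_fun ` S)" "point_fun ` S \<subseteq> V" using S pt by auto
    fix f assume f: "f \<in> V"
    have sum: "(\<Sum>b\<in>point_fun ` S. c b * b a) = c (point_fun a)" if "a \<in> S" for a c
      using that by (simp add: sum.reindex[OF inj] sum_point_fun[OF S, of "\<lambda>a. c (point_fun a)"])
    show "\<exists>!c. c \<in> point_fun ` S \<rightarrow>\<^sub>E UNIV \<and> (\<lambda>a. f a - (\<Sum>b\<in>point_fun ` S. c b * b a)) \<in> W"
    proof (rule ex1I)
      let ?c = "\<lambda>b\<in>point_fun ` S. f (inv_into S point_fun b)"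
      have "?c (point_fun a) = f a" if "a \<in> S" for a
        using that by (simp add: inv_into_f_f[OF inj])
      then show "?c \<in> point_fun ` S \<rightarrow>\<^sub>E UNIV \<and> (\<lambda>a. f a - (\<Sum>b\<in>point_fun ` S. ?c b * b a)) \<in> W"
        unfolding W using comb[OF f, of "point_fun ` S" ?c] pt by (auto simp: sum)
      fix c assume c: "c \<in> point_fun ` S \<rightarrow>\<^sub>E UNIV \<and> (\<lambda>a. f a - (\<Sum>b\<in>point_fun ` S. c b * b a)) \<in> W"
      then have "c (point_fun a) = f a" if "a \<in> S" for a
        using that unfolding W by (auto simp: sum)
      then show "c = ?c"
        using c by (intro ext) (auto simp: inv_into_f_f[OF inj] PiE_def extensional_def restrict_def)
    qed
  qed
  moreover have "card B = card S" if B: "basis_modulo V W B" for B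
  proof -
    \<comment> \<open>Restriction to \<open>S\<close> has kernel \<open>W\<close> on
      \<open>V\<close>, so it takes any basis modulo \<open>W\<close> to a basis of the functions
      supported in \<open>S\<close>.\<close>
    let ?\<rho> = "\<lambda>f x. if x \<in> S then f x else 0 :: complex"
    have finB: "finite B" and BV: "B \<subseteq> V"
      and uniq: "\<And>f. f \<in> V \<Longrightarrow> \<exists>!c. c \<in> B \<rightarrow>\<^sub>E UNIV \<and> (\<lambda>a. f a - (\<Sum>b\<in>B. c b * b a)) \<in> W"
      using B unfolding basis_modulo_def by auto
    \<comment> \<open>A linear relation on \<open>S\<close> would give the zero function a second
      representation modulo \<open>W\<close>.\<close>
    have indep: "u b = 0" if u: "\<And>a. a \<in> S \<Longrightarrow> (\<Sum>b\<in>B. u b * b a) = 0" and b: "b \<in> B" for u b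
    proof -
      have z: "(\<lambda>_. 0) \<in> V" using complex_functions.subspace_0[OF sub] by (simp add: zero_fun_def)
      have "restrict u B \<in> B \<rightarrow>\<^sub>E UNIV \<and> (\<lambda>a. 0 - (\<Sum>b\<in>B. restrict u B b * b a)) \<in> W"
        unfolding W using comb[OF z BV, of "restrict u B"] u by auto
      moreover have "restrict (\<lambda>_. 0) B \<in> B \<rightarrow>\<^sub>E UNIV \<and> (\<lambda>a. 0 - (\<Sum>b\<in>B. restrict (\<lambda>_. 0) B b * b a)) \<in> W"
        unfolding W using comb[OF z BV, of "restrict (\<lambda>_. 0) B"] by auto
      ultimately have "restrict u B = restrict (\<lambda>_. 0) B" using uniq[OF z] by blast
      then show ?thesis using b by (metis restrict_apply')
    qed
    have injB: "inj_on ?\<rho> B"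
    proof (rule inj_onI, rule ccontr)
      fix b b' assume b: "b \<in> B" "b' \<in> B" "?\<rho> b = ?\<rho> b'" "b \<noteq> b'"
      let ?u = "\<lambda>x. if x = b then 1 else if x = b' then - 1 else 0"
      have "(\<Sum>x\<in>B. ?u x * x a) = 0" if a: "a \<in> S" for a
      proof -
        have "b a = b' a" using fun_cong[OF b(3), of a] a by simp
        have "(\<Sum>x\<in>B. ?u x * x a) = (\<Sum>x\<in>{b, b'}. ?u x * x a)"
          by (rule sum.mono_neutral_right) (use finB b in auto)
        also have "\<dots> = 0" using b(4) \<open>b a = b' a\<close> by simp
        finally show ?thesis .
      qed
      from indep[of ?u b, OF this b(1)] show False by simp
    qed
    let ?V = "{f :: 'a \<Rightarrow> complex. \<forall>x. x \<notin> S \<longrightarrow> f x = 0}"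
    have "complex_functions.independent (?\<rho> ` B)"
    proof (subst complex_functions.dependent_finite)
      show "finite (?\<rho> ` B)" using finB by simp
      show "\<not> (\<exists>u. (\<exists>v\<in>?\<rho> ` B. u v \<noteq> 0) \<and> (\<Sum>v\<in>?\<rho> ` B. (\<lambda>x. u v * v x)) = (0 :: 'a \<Rightarrow> complex))"
      proof (intro notI, elim exE conjE bexE)
        fix u v assume v: "v \<in> ?\<rho> ` B" "u v \<noteq> 0"
          and "(\<Sum>v\<in>?\<rho> ` B. (\<lambda>x. u v * v x)) = (0 :: 'a \<Rightarrow> complex)"
        then have eq: "(\<Sum>b\<in>B. (\<lambda>x. u (?\<rho> b) * ?\<rho> b x)) = (0 :: 'a \<Rightarrow> complex)"
          by (simp add: sum.reindex[OF injB])
        then have 0: "(\<Sum>b\<in>B. u (?\<rho> b) * ?\<rho> b x) = 0" for x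
        proof -
          have "(\<Sum>b\<in>B. (\<lambda>x. u (?\<rho> b) * ?\<rho> b x)) x = (0 :: 'a \<Rightarrow> complex) x"
            by (rule fun_cong[OF eq])
          then show ?thesis by (simp only: sum_fun_apply zero_fun_apply)
        qed
        have "(\<Sum>b\<in>B. u (?\<rho> b) * b a) = 0" if "a \<in> S" for a using 0[of a] that by simp
        from indep[of "\<lambda>b. u (?\<rho> b)", OF this] v show False by auto
      qed
    qed
    moreover have "?\<rho> ` B \<subseteq> ?V" by auto
    moreover have "?V \<subseteq> complex_functions.span (?\<rho> ` B)"
    proof
      fix f assume f: "f \<in> ?V"
      have "(\<Sum>a\<in>S. (\<lambda>x. f a * point_fun a x)) \<in> V"
        by (rule complex_functions.subspace_sum[OF sub])
          (use pt complex_functions.subspace_scale[OF sub] in auto)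
      also have "(\<Sum>a\<in>S. (\<lambda>x. f a * point_fun a x)) = f"
        by (rule ext) (use f in \<open>auto simp: sum_fun_apply sum_point_fun[OF S]\<close>)
      finally obtain c where "(\<lambda>a. f a - (\<Sum>b\<in>B. c b * b a)) \<in> W" using uniq by blast
      then have eq: "f a = (\<Sum>b\<in>B. c b * b a)" if "a \<in> S" for a
        using that unfolding W by auto
      have "f = (\<Sum>b\<in>B. (\<lambda>x. c b * ?\<rho> b x))"
      proof
        fix x show "f x = (\<Sum>b\<in>B. (\<lambda>x. c b * ?\<rho> b x)) x"
          by (cases "x \<in> S") (use f eq[of x] in \<open>simp_all add: sum_fun_apply\<close>)
      qed
      also have "\<dots> \<in> complex_functions.span (?\<rho> ` B)"
        by (intro complex_functions.span_sum complex_functions.span_scale complex_functions.span_base) auto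
      finally show "f \<in> complex_functions.span (?\<rho> ` B)" .
    qed
    ultimately have "card (?\<rho> ` B) = complex_functions.dim ?V"
      by (intro complex_functions.basis_card_eq_dim)
    then show ?thesis using card_image[OF injB] dim_finite_support[OF S] by simp
  qed
  moreover have "card (point_fun ` S) = card S" by (rule card_image[OF inj])
  ultimately show ?thesis
    unfolding quot_dim_def by (intro the_equality) (metis, blast)
qed

section \<open>Holomorphic functions of several variables\<close>

lemma holomorphic_sev_const: "open U \<Longrightarrow> holomorphic_sev (\<lambda>_. c) U"
  unfolding holomorphic_sev_def by (auto intro!: exI[of _ "\<lambda>_. 0"])

lemma holomorphic_sev_nth: "open U \<Longrightarrow> holomorphic_sev (\<lambda>x. x $ k) U"
  unfolding holomorphic_sev_def
  by (auto intro!: exI[of _ "\<lambda>x. x $ k"] bounded_linear_imp_has_derivative bounded_linear_vec_nth)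

lemma holomorphic_sev_add:
  assumes "holomorphic_sev f U" "holomorphic_sev g U"
  shows "holomorphic_sev (\<lambda>x. f x + g x) U"
  unfolding holomorphic_sev_def
proof (intro conjI ballI)
  show "open U" using assms by (simp add: holomorphic_sev_def)
  fix p assume "p \<in> U"
  then obtain D E where "(f has_derivative D) (at p)" "\<forall>c x. D (c *s x) = c * D x"
    "(g has_derivative E) (at p)" "\<forall>c x. E (c *s x) = c * E x"
    using assms unfolding holomorphic_sev_def by meson
  then show "\<exists>D. ((\<lambda>x. f x + g x) has_derivative D) (at p) \<and> (\<forall>c x. D (c *s x) = c * D x)"
    by (intro exI[of _ "\<lambda>x. D x + E x"]) (auto intro: has_derivative_add simp: algebra_simps)
qed

lemma holomorphic_sev_mult:
  assumes "holomorphic_sev f U" "holomorphic_sev g U"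
  shows "holomorphic_sev (\<lambda>x. f x * g x) U"
  unfolding holomorphic_sev_def
proof (intro conjI ballI)
  show "open U" using assms by (simp add: holomorphic_sev_def)
  fix p assume "p \<in> U"
  then obtain D E where "(f has_derivative D) (at p)" "\<forall>c x. D (c *s x) = c * D x"
    "(g has_derivative E) (at p)" "\<forall>c x. E (c *s x) = c * E x"
    using assms unfolding holomorphic_sev_def by meson
  then show "\<exists>D. ((\<lambda>x. f x * g x) has_derivative D) (at p) \<and> (\<forall>c x. D (c *s x) = c * D x)"
    by (intro exI[of _ "\<lambda>x. f p * E x + D x * g p"] conjI has_derivative_mult) (auto simp: algebra_simps)
qed

lemma holomorphic_sev_sum:
  assumes "open U" "\<And>i. i \<in> I \<Longrightarrow> holomorphic_sev (f i) U"
  shows "holomorphic_sev (\<lambda>x. \<Sum>i\<in>I. f i x) U"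
  using assms(2)
  by (induction I rule: infinite_finite_induct)
    (auto intro: holomorphic_sev_const holomorphic_sev_add assms(1))

lemma holomorphic_sev_prod:
  assumes "open U" "\<And>i. i \<in> I \<Longrightarrow> holomorphic_sev (f i) U"
  shows "holomorphic_sev (\<lambda>x. \<Prod>i\<in>I. f i x) U"
  using assms(2)
  by (induction I rule: infinite_finite_induct)
    (auto intro: holomorphic_sev_const holomorphic_sev_mult assms(1))

lemma holomorphic_sev_power:
  assumes "holomorphic_sev f U"
  shows "holomorphic_sev (\<lambda>x. f x ^ n) U"
proof -
  have "open U" using assms by (simp add: holomorphic_sev_def)
  then show ?thesis
    by (induction n) (auto intro: holomorphic_sev_const holomorphic_sev_mult assms)
qed

lemma holomorphic_sev_monomial: "open U \<Longrightarrow> holomorphic_sev (\<lambda>y. \<Prod>l\<in>L. y $ l ^ e l) U"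
  by (intro holomorphic_sev_prod holomorphic_sev_power holomorphic_sev_nth)

lemma holomorphic_sev_imp_continuous_on: "holomorphic_sev f U \<Longrightarrow> continuous_on U f"
  unfolding holomorphic_sev_def
  by (meson continuous_at_imp_continuous_on has_derivative_continuous)

lemma bounded_linear_axis: "bounded_linear (axis k :: complex \<Rightarrow> complex^'n)"
  by (rule bounded_linear_intro[where K = 1])
    (auto simp: axis_def vec_eq_iff norm_vec_def L2_set_def if_distrib[of norm] if_distrib[of "\<lambda>x. x\<^sup>2"] cong: if_cong)

lemma holomorphic_sev_compose:
  fixes F :: "complex^'d \<Rightarrow> complex^'d"
  assumes f: "holomorphic_sev f V" and U: "open U"
    and F: "\<And>k. holomorphic_sev (\<lambda>x. F x $ k) U" and im: "\<And>x. x \<in> U \<Longrightarrow> F x \<in> V"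
  shows "holomorphic_sev (\<lambda>x. f (F x)) U"
  unfolding holomorphic_sev_def
proof (intro conjI ballI)
  show "open U" by fact
  fix p assume p: "p \<in> U"
  then have "\<forall>k. \<exists>D. ((\<lambda>x. F x $ k) has_derivative D) (at p) \<and> (\<forall>c x. D (c *s x) = c * D x)"
    using F unfolding holomorphic_sev_def by blast
  then obtain D where D: "\<And>k. ((\<lambda>x. F x $ k) has_derivative D k) (at p)"
    "\<And>k c x. D k (c *s x) = c * D k x"
    by metis
  have "((\<lambda>x. \<Sum>k\<in>UNIV. axis k (F x $ k)) has_derivative (\<lambda>h. \<Sum>k\<in>UNIV. axis k (D k h))) (at p)"
    by (intro has_derivative_sum bounded_linear.has_derivative[OF bounded_linear_axis] D)
  moreover have "(\<Sum>k\<in>UNIV. axis k (z k)) = (\<chi> k. z k)" for z :: "'d \<Rightarrow> complex"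
    by (simp add: vec_eq_iff axis_def if_distrib cong: if_cong)
  ultimately have dF: "(F has_derivative (\<lambda>h. \<chi> k. D k h)) (at p)"
    by (simp add: vec_lambda_eta)
  obtain E where E: "(f has_derivative E) (at (F p))" "\<forall>c x. E (c *s x) = c * E x"
    using f im[OF p] unfolding holomorphic_sev_def by blast
  have "((\<lambda>x. f (F x)) has_derivative (\<lambda>h. E (\<chi> k. D k h))) (at p)"
    using has_derivative_compose[OF dF E(1)] .
  moreover have "E (\<chi> k. D k (c *s h)) = c * E (\<chi> k. D k h)" for c h
  proof -
    have "(\<chi> k. D k (c *s h)) = c *s (\<chi> k. D k h)" by (simp add: vec_eq_iff D(2))
    then show ?thesis using E(2) by simp
  qed
  ultimately show "\<exists>D. ((\<lambda>x. f (F x)) has_derivative D) (at p) \<and> (\<forall>c x. D (c *s x) = c * D x)"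
    by blast
qed


section \<open>Convergent power series\<close>

definition monomial_at :: "complex^'d \<Rightarrow> ('d::finite \<Rightarrow> nat) \<Rightarrow> complex" where
  "monomial_at x a = (\<Prod>k\<in>UNIV. x $ k ^ a k)"

text \<open>The radius is kept explicit so that a series and the series derived from it can be
  evaluated on one polydisc.\<close>

definition converges_at_radius :: "real \<Rightarrow> (('d::finite \<Rightarrow> nat) \<Rightarrow> complex) \<Rightarrow> bool" where
  "converges_at_radius \<rho> g \<longleftrightarrow> \<rho> > 0 \<and> (\<lambda>a. norm (g a) * \<rho> ^ (\<Sum>i\<in>UNIV. a i)) summable_on UNIV"

lemma local_ring_iff: "g \<in> local_ring \<longleftrightarrow> (\<exists>\<rho>. converges_at_radius \<rho> g)"
  by (auto simp: local_ring_def converges_at_radius_def)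

lemma germ_eval_eq: "germ_eval g x = infsum (\<lambda>a. g a * monomial_at x a) UNIV"
  by (simp add: germ_eval_def monomial_at_def)

lemma monomial_at_add: "monomial_at x (\<lambda>k. a k + b k) = monomial_at x a * monomial_at x b"
  by (simp add: monomial_at_def power_add prod.distrib)

lemma norm_monomial_at_le:
  assumes "\<And>k. norm (x $ k) \<le> \<rho>"
  shows "norm (monomial_at x a) \<le> \<rho> ^ (\<Sum>i\<in>UNIV. a i)"
proof -
  have "norm (monomial_at x a) \<le> (\<Prod>k\<in>UNIV. \<rho> ^ a k)"
    unfolding monomial_at_def prod_norm[symmetric]
    by (rule prod_mono) (auto simp: norm_power intro: power_mono assms)
  then show ?thesis by (simp add: power_sum)
qed

lemma germ_norm_summable:
  assumes g: "converges_at_radius \<rho> g" and x: "\<And>k. norm (x $ k) \<le> \<rho>"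
  shows "(\<lambda>a. norm (g a * monomial_at x a)) summable_on UNIV"
proof (rule summable_on_comparison_test)
  show "(\<lambda>a. norm (g a) * \<rho> ^ (\<Sum>i\<in>UNIV. a i)) summable_on UNIV"
    using g by (simp add: converges_at_radius_def)
  show "norm (g a * monomial_at x a) \<le> norm (g a) * \<rho> ^ (\<Sum>i\<in>UNIV. a i)" for a
    using norm_monomial_at_le[of x \<rho> a, OF x] by (simp add: norm_mult mult_left_mono)
qed auto

lemmas germ_summable = abs_summable_summable[OF germ_norm_summable]

section \<open>Termwise differentiation of convergent power series\<close>

lemma monomial_at_has_derivative:
  "((\<lambda>x. monomial_at x a) has_derivative
     (\<lambda>h. \<Sum>i\<in>UNIV. of_nat (a i) * h $ i * x $ i ^ (a i - 1) * (\<Prod>j\<in>UNIV - {i}. x $ j ^ a j))) (at x within S)"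
  unfolding monomial_at_def
  by (intro has_derivative_prod has_derivative_power bounded_linear_imp_has_derivative bounded_linear_vec_nth)

text \<open>In the factorization of \<open>\<rho> ^ n - \<sigma> ^ n\<close> by
  \<open>\<rho> - \<sigma>\<close> the other factor has n summands, each at least
  \<open>\<sigma> ^ (n - 1)\<close>.\<close>

lemma mult_power_le_power:
  fixes \<sigma> \<rho> :: real
  assumes "0 \<le> \<sigma>" "\<sigma> < \<rho>"
  shows "n * \<sigma> ^ (n - 1) \<le> \<rho> ^ n / (\<rho> - \<sigma>)"
proof -
  have "(\<rho> - \<sigma>) * (n * \<sigma> ^ (n - 1)) \<le> (\<rho> - \<sigma>) * (\<Sum>i<n. \<rho> ^ (n - Suc i) * \<sigma> ^ i)"
  proof (rule mult_left_mono)
    have "real n * \<sigma> ^ (n - 1) = (\<Sum>i<n. \<sigma> ^ (n - 1))" by simp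
    also have "\<dots> \<le> (\<Sum>i<n. \<rho> ^ (n - Suc i) * \<sigma> ^ i)"
    proof (rule sum_mono)
      fix i assume "i \<in> {..<n}"
      then have "\<sigma> ^ (n - 1) = \<sigma> ^ (n - Suc i) * \<sigma> ^ i" by (simp flip: power_add)
      also have "\<dots> \<le> \<rho> ^ (n - Suc i) * \<sigma> ^ i"
        using assms by (intro mult_right_mono power_mono) auto
      finally show "\<sigma> ^ (n - 1) \<le> \<rho> ^ (n - Suc i) * \<sigma> ^ i" .
    qed
    finally show "real n * \<sigma> ^ (n - 1) \<le> (\<Sum>i<n. \<rho> ^ (n - Suc i) * \<sigma> ^ i)" .
  qed (use assms in auto)
  also have "\<dots> = \<rho> ^ n - \<sigma> ^ n" 
    using power_diff_sumr2[of \<sigma> n \<rho>] by (metis minus_diff_eq minus_mult_left)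
  also have "\<dots> \<le> \<rho> ^ n" using assms by simp
  finally show ?thesis using assms by (simp add: field_simps)
qed

text \<open>Differentiation produces the degree as a factor; passing from radius
  \<open>\<rho>\<close> to \<open>\<sigma>\<close> absorbs it, and the resulting bound is summable
  against the coefficients of a series convergent at \<open>\<rho>\<close>.\<close>

lemma norm_monomial_derivative_le:
  fixes x h :: "complex^'d::finite"
  assumes "\<And>k. norm (x $ k) \<le> \<sigma>" "0 \<le> \<sigma>" "\<sigma> < \<rho>"
  shows "norm (\<Sum>i\<in>UNIV. of_nat (a i) * h $ i * x $ i ^ (a i - 1) * (\<Prod>j\<in>UNIV - {i}. x $ j ^ a j))
    \<le> \<rho> ^ (\<Sum>i\<in>UNIV. a i) / (\<rho> - \<sigma>) * norm h"
proof -
  let ?n = "\<Sum>i\<in>UNIV. a i"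
  have "norm (of_nat (a i) * h $ i * x $ i ^ (a i - 1) * (\<Prod>j\<in>UNIV - {i}. x $ j ^ a j))
      \<le> a i * norm h * \<sigma> ^ (?n - 1)" for i
  proof (cases "a i = 0")
    case False
    have "norm (\<Prod>j\<in>UNIV - {i}. x $ j ^ a j) \<le> (\<Prod>j\<in>UNIV - {i}. \<sigma> ^ a j)"
      unfolding prod_norm[symmetric]
      by (rule prod_mono) (auto simp: norm_power intro: power_mono assms)
    also have "\<dots> = \<sigma> ^ (\<Sum>j\<in>UNIV - {i}. a j)" by (simp add: power_sum)
    finally have 1: "norm (\<Prod>j\<in>UNIV - {i}. x $ j ^ a j) \<le> \<sigma> ^ (\<Sum>j\<in>UNIV - {i}. a j)" .
    have 2: "norm (x $ i ^ (a i - 1)) \<le> \<sigma> ^ (a i - 1)"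
      unfolding norm_power by (intro power_mono assms) auto
    have n: "?n - 1 = (a i - 1) + (\<Sum>j\<in>UNIV - {i}. a j)"
      using False sum.remove[of UNIV i a] by simp
    have b: "norm (x $ i ^ (a i - 1)) * norm (\<Prod>j\<in>UNIV - {i}. x $ j ^ a j) \<le> \<sigma> ^ (?n - 1)"
      unfolding n power_add by (rule mult_mono[OF 2 1]) (use assms in auto)
    have a: "a i * norm (h $ i) \<le> a i * norm h"
      by (intro mult_left_mono Finite_Cartesian_Product.norm_nth_le) auto
    have "(a i * norm (h $ i)) * (norm (x $ i ^ (a i - 1)) * norm (\<Prod>j\<in>UNIV - {i}. x $ j ^ a j))
        \<le> (a i * norm h) * \<sigma> ^ (?n - 1)"
      by (rule mult_mono[OF a b]) auto
    then show ?thesis by (simp add: norm_mult mult.assoc)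
  qed simp
  then have "norm (\<Sum>i\<in>UNIV. of_nat (a i) * h $ i * x $ i ^ (a i - 1) * (\<Prod>j\<in>UNIV - {i}. x $ j ^ a j))
      \<le> (\<Sum>i\<in>UNIV. a i * norm h * \<sigma> ^ (?n - 1))"
    by (intro order_trans[OF norm_sum] sum_mono) auto
  also have "\<dots> = (?n * \<sigma> ^ (?n - 1)) * norm h"
    by (simp add: sum_distrib_left sum_distrib_right mult_ac)
  also have "\<dots> \<le> \<rho> ^ ?n / (\<rho> - \<sigma>) * norm h"
    by (intro mult_right_mono mult_power_le_power assms) auto
  finally show ?thesis .
qed

definition polydisc :: "real \<Rightarrow> (complex^'d) set" where
  "polydisc \<rho> = {x. \<forall>k. norm (x $ k) < \<rho>}"

lemma open_polydisc: "open (polydisc \<rho> :: (complex^'d::finite) set)"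
proof -
  have "polydisc \<rho> = (\<Inter>k\<in>UNIV. {x :: complex^'d. norm (x $ k) < \<rho>})"
    by (auto simp: polydisc_def)
  moreover have "open {x :: complex^'d. norm (x $ k) < \<rho>}" for k
    by (intro open_Collect_less continuous_intros)
  ultimately show ?thesis by (auto intro: open_INT)
qed

lemma convex_polydisc: "convex (polydisc \<rho> :: (complex^'d::finite) set)"
proof (rule convexI)
  fix x y :: "complex^'d" and u v :: real
  assume h: "x \<in> polydisc \<rho>" "y \<in> polydisc \<rho>" "0 \<le> u" "0 \<le> v" "u + v = 1"
  show "u *\<^sub>R x + v *\<^sub>R y \<in> polydisc \<rho>"
    unfolding polydisc_def
  proof (intro CollectI allI)
    fix k
    have "norm ((u *\<^sub>R x + v *\<^sub>R y) $ k) \<le> u * norm (x $ k) + v * norm (y $ k)"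
      using h norm_triangle_ineq[of "u *\<^sub>R (x $ k)" "v *\<^sub>R (y $ k)"] by simp
    also have "\<dots> < \<rho>" using h by (intro convex_bound_lt) (auto simp: polydisc_def)
    finally show "norm ((u *\<^sub>R x + v *\<^sub>R y) $ k) < \<rho>" .
  qed
qed

text \<open>The exponents are enumerated by the natural numbers and the series is differentiated
  term by term on the polydisc of the smaller radius \<open>\<sigma>\<close>, where the derivatives
  have the summable majorant \<open>M\<close>.\<close>

lemma holomorphic_germ_eval_aux:
  fixes g :: "('d::finite \<Rightarrow> nat) \<Rightarrow> complex"
  assumes g: "converges_at_radius \<rho> g" and \<sigma>: "0 \<le> \<sigma>" "\<sigma> < \<rho>" and p: "p \<in> polydisc \<sigma>"
  shows "\<exists>D. (germ_eval g has_derivative D) (at p) \<and> (\<forall>c x. D (c *s x) = c * D x)"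
proof -
  have "infinite (UNIV :: ('d \<Rightarrow> nat) set)"
  proof
    assume "finite (UNIV :: ('d \<Rightarrow> nat) set)"
    then have "finite (range (\<lambda>n::nat. (\<lambda>_::'d. n)))" by (rule finite_subset[rotated]) simp
    then have "finite (UNIV :: nat set)" by (rule finite_imageD) (auto simp: inj_on_def fun_eq_iff)
    then show False by simp
  qed
  then have bij: "bij_betw (from_nat_into UNIV) UNIV (UNIV :: ('d \<Rightarrow> nat) set)"
    by (rule bij_betw_from_nat_into[rotated]) simp
  define e where "e = from_nat_into (UNIV :: ('d \<Rightarrow> nat) set)"
  have e: "bij_betw e UNIV UNIV" unfolding e_def by (rule bij)
  define f where "f n x = g (e n) * monomial_at x (e n)" for n x
  define f' where "f' n x h = g (e n) * (\<Sum>i\<in>UNIV. of_nat (e n i) * h $ i * x $ i ^ (e n i - 1) *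
    (\<Prod>j\<in>UNIV - {i}. x $ j ^ e n j))" for n and x h :: "complex^'d"
  define M where "M n = norm (g (e n)) * \<rho> ^ (\<Sum>i\<in>UNIV. e n i) / (\<rho> - \<sigma>)" for n
  have "(\<lambda>n. norm (g (e n)) * \<rho> ^ (\<Sum>i\<in>UNIV. e n i)) summable_on UNIV"
    using g summable_on_reindex_bij_betw[OF e, of "\<lambda>a. norm (g a) * \<rho> ^ (\<Sum>i\<in>UNIV. a i)"]
    by (simp add: converges_at_radius_def)
  then have "summable (\<lambda>n. norm (g (e n)) * \<rho> ^ (\<Sum>i\<in>UNIV. e n i))"
    using \<sigma> by (subst (asm) summable_on_UNIV_nonneg_real_iff) auto
  then have sM: "summable M" unfolding M_def by (rule summable_divide)
  have f'M: "norm (f' n x h) \<le> M n * norm h" if "x \<in> polydisc \<sigma>" for n x h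
  proof -
    have "norm (f' n x h) \<le> norm (g (e n)) * (\<rho> ^ (\<Sum>i\<in>UNIV. e n i) / (\<rho> - \<sigma>) * norm h)"
      unfolding f'_def norm_mult
      by (intro mult_left_mono norm_monomial_derivative_le)
        (use that \<sigma> in \<open>auto simp: polydisc_def less_imp_le\<close>)
    then show ?thesis by (simp add: M_def)
  qed
  have sf': "summable (\<lambda>n. f' n x h)" if "x \<in> polydisc \<sigma>" for x h
    by (rule summable_comparison_test'[of "\<lambda>n. M n * norm h" 0])
      (use sM f'M[OF that] in \<open>auto intro: summable_mult2\<close>)
  define g' where "g' x h = suminf (\<lambda>n. f' n x h)" for x h
  have sums: "(\<lambda>n. f n x) sums germ_eval g x" if x: "x \<in> polydisc \<sigma>" for x
  proof -
    have "(\<lambda>a. g a * monomial_at x a) summable_on UNIV"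
      by (rule germ_summable[OF g]) (use x \<sigma> in \<open>auto simp: polydisc_def intro: less_imp_le less_trans\<close>)
    then have "(\<lambda>n. f n x) summable_on UNIV"
      unfolding f_def using summable_on_reindex_bij_betw[OF e, of "\<lambda>a. g a * monomial_at x a"] by simp
    moreover have "infsum (\<lambda>n. f n x) UNIV = germ_eval g x"
      unfolding f_def germ_eval_eq by (rule infsum_reindex_bij_betw[OF e])
    ultimately have "((\<lambda>n. f n x) has_sum germ_eval g x) UNIV"
      using has_sum_infsum by metis
    then show ?thesis by (rule has_sum_imp_sums)
  qed
  have "\<exists>G. \<forall>x\<in>polydisc \<sigma>. (\<lambda>n. f n x) sums (G x) \<and> (G has_derivative g' x) (at x within polydisc \<sigma>)"
  proof (rule has_derivative_series[OF convex_polydisc])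
    show "(f n has_derivative f' n x) (at x within polydisc \<sigma>)" for n x
      unfolding f_def f'_def by (intro has_derivative_mult_right monomial_at_has_derivative)
    fix \<epsilon> :: real assume "\<epsilon> > 0"
    then obtain N where N: "\<And>n. n \<ge> N \<Longrightarrow> norm (suminf (\<lambda>i. M (i + n))) < \<epsilon>"
      using suminf_exist_split[OF _ sM] by blast
    show "\<forall>\<^sub>F n in sequentially. \<forall>x\<in>polydisc \<sigma>. \<forall>h. norm ((\<Sum>i<n. f' i x h) - g' x h) \<le> \<epsilon> * norm h"
    proof (rule eventually_sequentiallyI[of N], intro ballI allI)
      fix n and x h :: "complex^'d" assume n: "n \<ge> N" and x: "x \<in> polydisc \<sigma>"
      have s: "summable (\<lambda>i. M (i + n) * norm h)"
        using sM by (intro summable_mult2) (simp add: summable_iff_shift)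
      have "norm ((\<Sum>i<n. f' i x h) - g' x h) = norm (suminf (\<lambda>i. f' (i + n) x h))"
        unfolding g'_def using suminf_minus_initial_segment[OF sf'[OF x, of h], of n]
        by (simp add: norm_minus_commute)
      also have "\<dots> \<le> suminf (\<lambda>i. M (i + n) * norm h)"
        by (rule norm_suminf_le[OF _ s]) (rule f'M[OF x])
      also have "\<dots> = suminf (\<lambda>i. M (i + n)) * norm h"
        using sM by (intro suminf_mult2[symmetric]) (simp add: summable_iff_shift)
      also have "\<dots> \<le> \<epsilon> * norm h"
        using N[OF n] by (intro mult_right_mono) auto
      finally show "norm ((\<Sum>i<n. f' i x h) - g' x h) \<le> \<epsilon> * norm h" .
    qed
  qed (use p sums in auto)
  then obtain G where G: "\<And>x. x \<in> polydisc \<sigma> \<Longrightarrow> (\<lambda>n. f n x) sums G x"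
    "\<And>x. x \<in> polydisc \<sigma> \<Longrightarrow> (G has_derivative g' x) (at x within polydisc \<sigma>)"
    by blast
  have "G x = germ_eval g x" if "x \<in> polydisc \<sigma>" for x
    using sums_unique2[OF G(1) sums] that by blast
  then have "(germ_eval g has_derivative g' p) (at p within polydisc \<sigma>)"
    using G(2)[OF p] p by (metis has_derivative_transform)
  then have "(germ_eval g has_derivative g' p) (at p)"
    using at_within_open[OF p open_polydisc] by simp
  moreover have "g' p (c *s h) = c * g' p h" for c h
  proof -
    have "f' n p (c *s h) = c * f' n p h" for n
      by (simp add: f'_def sum_distrib_left algebra_simps)
    then show ?thesis unfolding g'_def using suminf_mult[OF sf'[OF p]] by simp
  qed
  ultimately show ?thesis by blast
qed

lemma holomorphic_germ_eval:
  fixes g :: "('d::finite \<Rightarrow> nat) \<Rightarrow> complex"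
  assumes g: "converges_at_radius \<rho> g"
  shows "holomorphic_sev (germ_eval g) (polydisc \<rho>)"
  unfolding holomorphic_sev_def
proof (intro conjI ballI open_polydisc)
  fix p :: "complex^'d" assume p: "p \<in> polydisc \<rho>"
  define \<mu> where "\<mu> = Max (range (\<lambda>k. norm (p $ k)))"
  have "\<mu> \<in> range (\<lambda>k. norm (p $ k))" unfolding \<mu>_def by (rule Max_in) auto
  then obtain k where "\<mu> = norm (p $ k)" by blast
  then have m: "0 \<le> \<mu>" "\<mu> < \<rho>" using p by (auto simp: polydisc_def)
  have le: "norm (p $ k) \<le> \<mu>" for k unfolding \<mu>_def by (rule Max_ge) auto
  have "p \<in> polydisc ((\<mu> + \<rho>) / 2)"
    unfolding polydisc_def
  proof (intro CollectI allI)
    fix k show "norm (p $ k) < (\<mu> + \<rho>) / 2" 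
      by (rule le_less_trans[OF le]) (use m in \<open>simp add: field_simps\<close>)
  qed
  then show "\<exists>D. (germ_eval g has_derivative D) (at p) \<and> (\<forall>c x. D (c *s x) = c * D x)"
    by (intro holomorphic_germ_eval_aux[OF g, of "(\<mu> + \<rho>) / 2"]) (use m in auto)
qed

section \<open>Division of a convergent power series by monomials\<close>

lemma exponent_below:
  fixes a :: "'d::finite \<Rightarrow> nat"
  assumes "m \<le> (\<Sum>k\<in>UNIV. a k)"
  shows "\<exists>b. (\<forall>k. b k \<le> a k) \<and> (\<Sum>k\<in>UNIV. b k) = m"
  using assms
proof (induction m)
  case 0
  show ?case by (rule exI[of _ "\<lambda>_. 0"]) simp
next
  case (Suc m)
  then obtain b where b: "\<And>k. b k \<le> a k" "(\<Sum>k\<in>UNIV. b k) = m" by auto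
  have "\<exists>k. b k < a k"
  proof (rule ccontr)
    assume "\<nexists>k. b k < a k"
    with b(1) have "b = a" by (intro ext) (meson le_neq_implies_less)
    with b(2) Suc.prems show False by simp
  qed
  then obtain k where k: "b k < a k" by blast
  have "(\<Sum>i\<in>UNIV. (b(k := Suc (b k))) i) = Suc m"
    using b(2) by (simp add: sum.remove[of UNIV k])
  with k b(1) show ?case by (intro exI[of _ "b(k := Suc (b k))"]) auto
qed

text \<open>A generator of the ideal of all monomials of degree \<open>\<ge> m\<close> dividing \<open>x\<^sup>a\<close>, or \<open>a\<close> itself if
  the degree is smaller.\<close>

definition truncate_exponent :: "nat \<Rightarrow> ('d::finite \<Rightarrow> nat) \<Rightarrow> 'd \<Rightarrow> nat" where
  "truncate_exponent m a =
     (if m \<le> (\<Sum>k\<in>UNIV. a k) then SOME b. (\<forall>k. b k \<le> a k) \<and> (\<Sum>k\<in>UNIV. b k) = m else a)"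

lemma truncate_exponent_le: "truncate_exponent m a k \<le> a k"
  and sum_truncate_exponent: "(\<Sum>k\<in>UNIV. truncate_exponent m a k) = min m (\<Sum>k\<in>UNIV. a k)"
proof -
  have "(\<forall>k. truncate_exponent m a k \<le> a k) \<and> (\<Sum>k\<in>UNIV. truncate_exponent m a k) = min m (\<Sum>k\<in>UNIV. a k)"
  proof (cases "m \<le> (\<Sum>k\<in>UNIV. a k)")
    case True
    from someI_ex[OF exponent_below[OF True]] True show ?thesis by (simp add: truncate_exponent_def)
  qed (simp add: truncate_exponent_def)
  then show "truncate_exponent m a k \<le> a k"
    "(\<Sum>k\<in>UNIV. truncate_exponent m a k) = min m (\<Sum>k\<in>UNIV. a k)" by auto
qed

lemma truncate_exponent_id:
  assumes "(\<Sum>k\<in>UNIV. a k) \<le> m"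
  shows "truncate_exponent m a = a"
proof (rule ccontr)
  assume "truncate_exponent m a \<noteq> a"
  then obtain k where "truncate_exponent m a k < a k"
    using truncate_exponent_le by (metis ext le_neq_implies_less)
  then have "(\<Sum>k\<in>UNIV. truncate_exponent m a k) < (\<Sum>k\<in>UNIV. a k)"
    by (intro sum_strict_mono_ex1) (auto simp: truncate_exponent_le)
  with assms show False by (simp add: sum_truncate_exponent)
qed

text \<open>The cofactor of \<open>x^b\<close> when \<open>g\<close> is written as a finite sum of
  multiples of monomials: a term of \<open>g\<close> goes to the truncation \<open>b\<close> of its
  exponent, and \<open>c\<close> is the exponent that remains.\<close>

definition subseries :: "nat \<Rightarrow> (('d::finite \<Rightarrow> nat) \<Rightarrow> complex) \<Rightarrow> ('d \<Rightarrow> nat) \<Rightarrow> ('d \<Rightarrow> nat) \<Rightarrow> complex" where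
  "subseries m g b c = (if truncate_exponent m (\<lambda>k. b k + c k) = b then g (\<lambda>k. b k + c k) else 0)"

lemma inj_shift: "inj (\<lambda>c k. b k + c k :: nat)"
  by (auto simp: inj_def fun_eq_iff)

lemma subseries_converges:
  assumes g: "converges_at_radius \<rho> g"
  shows "converges_at_radius \<rho> (subseries m g b)"
  unfolding converges_at_radius_def
proof
  show \<rho>: "\<rho> > 0" using g by (simp add: converges_at_radius_def)
  let ?f = "\<lambda>a. norm (g a) * \<rho> ^ (\<Sum>i\<in>UNIV. a i)"
  have "?f summable_on UNIV" using g by (simp add: converges_at_radius_def)
  then have "?f summable_on range (\<lambda>c k. b k + c k)" by (rule summable_on_subset_banach) simp
  then have "(?f \<circ> (\<lambda>c k. b k + c k)) summable_on UNIV"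
    by (simp add: summable_on_reindex inj_shift)
  then have "(\<lambda>c. (1 / \<rho> ^ (\<Sum>i\<in>UNIV. b i)) * (?f \<circ> (\<lambda>c k. b k + c k)) c) summable_on UNIV"
    by (rule summable_on_cmult_right)
  then show "(\<lambda>a. norm (subseries m g b a) * \<rho> ^ (\<Sum>i\<in>UNIV. a i)) summable_on UNIV"
    by (rule summable_on_comparison_test)
      (use \<rho> in \<open>auto simp: subseries_def sum.distrib power_add\<close>)
qed

lemma infsum_finite_sum:
  fixes F :: "'b \<Rightarrow> 'a \<Rightarrow> complex"
  assumes "finite G" "\<And>b. b \<in> G \<Longrightarrow> F b summable_on A"
  shows "(\<lambda>a. \<Sum>b\<in>G. F b a) summable_on A \<and> infsum (\<lambda>a. \<Sum>b\<in>G. F b a) A = (\<Sum>b\<in>G. infsum (F b) A)"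
  using assms
proof (induction G)
  case (insert b G)
  from insert.IH[OF insert.prems] have IH: "(\<lambda>a. \<Sum>b\<in>G. F b a) summable_on A"
    "infsum (\<lambda>a. \<Sum>b\<in>G. F b a) A = (\<Sum>b\<in>G. infsum (F b) A)" by simp_all
  have b: "F b summable_on A" using insert.prems by simp
  show ?case
    unfolding sum.insert[OF insert.hyps]
    using summable_on_add[OF b IH(1)] infsum_add[OF b IH(1)] IH(2) by simp
qed simp

text \<open>Every exponent belongs to exactly one class, that of its truncation. The truncation lies
  below it, so \<open>x^b\<close> factors out of the class of \<open>b\<close>, and there are
  finitely many classes.\<close>

lemma germ_eval_decompose:
  fixes g :: "('d::finite \<Rightarrow> nat) \<Rightarrow> complex"
  assumes g: "converges_at_radius \<rho> g" and x: "x \<in> polydisc \<rho>"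
  shows "germ_eval g x = (\<Sum>b | (\<Sum>k\<in>UNIV. b k) \<le> m. monomial_at x b * germ_eval (subseries m g b) x)"
proof -
  let ?G = "{b :: 'd \<Rightarrow> nat. (\<Sum>k\<in>UNIV. b k) \<le> m}"
  let ?F = "\<lambda>b a. if truncate_exponent m a = b then g a * monomial_at x a else 0"
  have fin: "finite ?G" by (rule finite_exponents_le)
  have x': "norm (x $ k) \<le> \<rho>" for k using x by (auto simp: polydisc_def intro: less_imp_le)
  have F: "?F b summable_on UNIV" for b
  proof (rule abs_summable_summable, rule summable_on_comparison_test[OF germ_norm_summable[OF g x']])
    show "norm (?F b a) \<le> norm (g a * monomial_at x a)" for a by simp
  qed auto
  have eq: "g a * monomial_at x a = (\<Sum>b\<in>?G. ?F b a)" for a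
  proof -
    have "truncate_exponent m a \<in> ?G" by (simp add: sum_truncate_exponent)
    then show ?thesis using fin by (simp add: sum.delta)
  qed
  have "germ_eval g x = infsum (\<lambda>a. \<Sum>b\<in>?G. ?F b a) UNIV"
    unfolding germ_eval_eq by (rule infsum_cong) (rule eq)
  also have "\<dots> = (\<Sum>b\<in>?G. infsum (?F b) UNIV)"
    by (rule conjunct2[OF infsum_finite_sum[OF fin F]])
  also have "\<dots> = (\<Sum>b\<in>?G. monomial_at x b * germ_eval (subseries m g b) x)"
  proof (rule sum.cong[OF refl])
    fix b
    have "infsum (?F b) UNIV = infsum (?F b) (range (\<lambda>c k. b k + c k))"
    proof (rule infsum_cong_neutral)
      fix a assume a: "a \<in> UNIV - range (\<lambda>c k. b k + c k)"
      have "a \<noteq> (\<lambda>k. b k + (a k - b k))"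
      proof
        assume "a = (\<lambda>k. b k + (a k - b k))"
        then have "a \<in> range (\<lambda>c k. b k + c k)" by (rule range_eqI[of _ _ "\<lambda>k. a k - b k"])
        with a show False by simp
      qed
      then have "truncate_exponent m a \<noteq> b" using truncate_exponent_le[of m a] by auto
      then show "?F b a = 0" by simp
    qed auto
    also have "\<dots> = infsum (?F b \<circ> (\<lambda>c k. b k + c k)) UNIV"
      by (rule infsum_reindex[OF inj_shift])
    also have "\<dots> = infsum (\<lambda>c. monomial_at x b * (subseries m g b c * monomial_at x c)) UNIV"
      by (rule infsum_cong) (simp add: subseries_def monomial_at_add)
    also have "\<dots> = monomial_at x b * germ_eval (subseries m g b) x"
      unfolding germ_eval_eq by (rule infsum_cmult_right')
    finally show "infsum (?F b) UNIV = monomial_at x b * germ_eval (subseries m g b) x" .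
  qed
  finally show ?thesis .
qed

lemma germ_eval_0: "germ_eval g 0 = g (\<lambda>_. 0)"
proof -
  have m: "monomial_at 0 a = 0" if a: "a \<noteq> (\<lambda>_. 0)" for a :: "'a \<Rightarrow> nat"
  proof -
    obtain k where "a k \<noteq> 0" using a by (auto simp: fun_eq_iff)
    then have "(0 :: complex ^ 'a) $ k ^ a k = 0" by simp
    then show ?thesis unfolding monomial_at_def by (intro prod_zero) auto
  qed
  have "germ_eval g 0 = infsum (\<lambda>a. g a * monomial_at 0 a) {\<lambda>_. 0}"
    unfolding germ_eval_eq by (rule infsum_cong_neutral) (use m in auto)
  then show ?thesis by (simp add: monomial_at_def)
qed

section \<open>Monomial maps\<close>

text \<open>The shape of the blowing-down map in a toric chart: row \<open>l\<close> is the vector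
  of the ray of the hyperplane \<open>y_l = 0\<close>, its entries being the orders of the
  coordinates along it.\<close>

definition monomial_map :: "('d \<Rightarrow> 'd \<Rightarrow> nat) \<Rightarrow> complex^'d \<Rightarrow> complex^('d::finite)" where
  "monomial_map A y = (\<chi> k. \<Prod>l\<in>UNIV. y $ l ^ A l k)"

lemma monomial_at_monomial_map:
  "monomial_at (monomial_map A y) a = (\<Prod>l\<in>UNIV. y $ l ^ dot (A l) a)"
proof -
  have "monomial_at (monomial_map A y) a = (\<Prod>k\<in>UNIV. \<Prod>l\<in>UNIV. y $ l ^ (A l k * a k))"
    by (simp add: monomial_at_def monomial_map_def prod_power_distrib power_mult)
  also have "\<dots> = (\<Prod>l\<in>UNIV. \<Prod>k\<in>UNIV. y $ l ^ (A l k * a k))" by (rule prod.swap)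
  finally show ?thesis by (simp add: dot_def power_sum)
qed

lemma holomorphic_sev_monomial_map: "open U \<Longrightarrow> holomorphic_sev (\<lambda>y. monomial_map A y $ k) U"
  unfolding monomial_map_def by (simp add: holomorphic_sev_monomial)

lemma continuous_on_monomial_map: "continuous_on S (monomial_map A)"
  unfolding monomial_map_def by (intro continuous_intros)

lemma open_monomial_map_polydisc: "open {y. monomial_map A y \<in> polydisc \<rho>}"
  using open_vimage[OF open_polydisc continuous_on_monomial_map] by (simp add: vimage_def)

text \<open>The series is split by truncation at degree \<open>m\<close>. A summand of degree
  exactly \<open>m\<close> is divisible since \<open>w l \<le> m\<close> and the rows with
  \<open>w l > 0\<close> have entries at least 1. The class of a smaller degree consists of the
  exponent \<open>b\<close> alone, to which \<open>supp\<close> applies. Over the origin only the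
  constant terms of the subseries survive.\<close>

lemma germ_eval_quotient:
  fixes g :: "('d::finite \<Rightarrow> nat) \<Rightarrow> complex"
  assumes g: "converges_at_radius \<rho> g"
    and A: "\<And>l k. w l > 0 \<Longrightarrow> 1 \<le> A l k" and m: "\<And>l. w l \<le> m"
    and supp: "\<And>a l. g a \<noteq> 0 \<Longrightarrow> w l \<le> dot (A l) a"
  obtains F where "holomorphic_sev F {y. monomial_map A y \<in> polydisc \<rho>}"
    and "\<And>y. monomial_map A y \<in> polydisc \<rho> \<Longrightarrow>
      germ_eval g (monomial_map A y) = (\<Prod>l\<in>UNIV. y $ l ^ w l) * F y"
    and "\<And>y. monomial_map A y = 0 \<Longrightarrow>
      F y = (\<Sum>b | (\<Sum>k\<in>UNIV. b k) \<le> m. g b * (\<Prod>l\<in>UNIV. y $ l ^ (dot (A l) b - w l)))"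
proof -
  let ?G = "{b :: 'd \<Rightarrow> nat. (\<Sum>k\<in>UNIV. b k) \<le> m}"
  let ?U = "{y. monomial_map A y \<in> polydisc \<rho>}"
  define F where "F y = (\<Sum>b\<in>?G. (\<Prod>l\<in>UNIV. y $ l ^ (dot (A l) b - w l)) *
    germ_eval (subseries m g b) (monomial_map A y))" for y
  have U: "open ?U" by (rule open_monomial_map_polydisc)
  have 1: "holomorphic_sev F ?U"
    unfolding F_def
    by (intro holomorphic_sev_sum holomorphic_sev_mult holomorphic_sev_monomial U
        holomorphic_sev_compose[OF holomorphic_germ_eval[OF subseries_converges[OF g]]]
        holomorphic_sev_monomial_map) simp
  have div: "w l \<le> dot (A l) b" if b: "b \<in> ?G" and c: "subseries m g b c \<noteq> 0" for b c l
  proof (cases "(\<Sum>k\<in>UNIV. b k) = m")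
    case True
    show ?thesis
    proof (cases "w l > 0")
      case True': True
      have "w l \<le> (\<Sum>k\<in>UNIV. b k)" using m True by simp
      also have "\<dots> \<le> dot (A l) b" by (rule sum_le_dot) (rule A[OF True'])
      finally show ?thesis .
    qed simp
  next
    case False
    from c have t: "truncate_exponent m (\<lambda>k. b k + c k) = b" and nz: "g (\<lambda>k. b k + c k) \<noteq> 0"
      by (auto simp: subseries_def split: if_splits)
    have "(\<Sum>k\<in>UNIV. b k + c k) \<le> m"
      using sum_truncate_exponent[of m "\<lambda>k. b k + c k"] False b unfolding t by auto
    from truncate_exponent_id[OF this] t nz have "g b \<noteq> 0" by simp
    then show ?thesis by (rule supp)
  qed
  have 2: "germ_eval g (monomial_map A y) = (\<Prod>l\<in>UNIV. y $ l ^ w l) * F y"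
    if y: "monomial_map A y \<in> polydisc \<rho>" for y
    unfolding germ_eval_decompose[OF g y, of m] F_def sum_distrib_left
  proof (rule sum.cong[OF refl])
    fix b assume b: "b \<in> ?G"
    show "monomial_at (monomial_map A y) b * germ_eval (subseries m g b) (monomial_map A y) =
      (\<Prod>l\<in>UNIV. y $ l ^ w l) * ((\<Prod>l\<in>UNIV. y $ l ^ (dot (A l) b - w l)) *
        germ_eval (subseries m g b) (monomial_map A y))"
    proof (cases "\<exists>c. subseries m g b c \<noteq> 0")
      case True
      then have "w l \<le> dot (A l) b" for l using div[OF b] by blast
      then have "y $ l ^ dot (A l) b = y $ l ^ w l * y $ l ^ (dot (A l) b - w l)" for l
        by (simp flip: power_add)
      then show ?thesis by (simp add: monomial_at_monomial_map prod.distrib)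
    next
      case False
      then have "germ_eval (subseries m g b) x = 0" for x by (simp add: germ_eval_eq)
      then show ?thesis by simp
    qed
  qed
  have 3: "F y = (\<Sum>b\<in>?G. g b * (\<Prod>l\<in>UNIV. y $ l ^ (dot (A l) b - w l)))"
    if y: "monomial_map A y = 0" for y
    unfolding F_def y germ_eval_0
    by (rule sum.cong) (simp_all add: subseries_def truncate_exponent_id)
  from that[OF 1 2 3] show thesis by blast
qed

section \<open>Independence of monomials\<close>

text \<open>Doubling the variable \<open>y_l\<close> multiplies each monomial by
  \<open>2 ^ E a l\<close>. Subtracting \<open>2 ^ E b l\<close> times the original relation removes
  \<open>b\<close>, and keeps \<open>a\<close> if \<open>l\<close> separates the two
  exponents.\<close>

lemma monomials_independent:
  fixes E :: "'a \<Rightarrow> 'd::finite \<Rightarrow> nat" and c :: "'a \<Rightarrow> complex"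
  assumes "finite P" "inj_on E P" "a \<in> P"
    and "\<And>y :: complex^'d. (\<Sum>a\<in>P. c a * (\<Prod>l\<in>UNIV. y $ l ^ E a l)) = 0"
  shows "c a = 0"
  using assms
proof (induction "card P" arbitrary: P c a rule: less_induct)
  case less
  show ?case
  proof (cases "P = {a}")
    case True
    from less.prems(4)[of "\<chi> l. 1"] True show ?thesis by simp
  next
    case False
    then obtain b where b: "b \<in> P" "b \<noteq> a" using less.prems(3) by auto
    then have "E b \<noteq> E a" using less.prems(2,3) by (auto dest: inj_onD)
    then obtain l where l: "E b l \<noteq> E a l" by auto
    let ?c = "\<lambda>a. c a * (2 ^ E a l - 2 ^ E b l)"
    have "?c a = 0"
    proof (rule less.hyps[of "P - {b}" a ?c])
      show "card (P - {b}) < card P" using less.prems(1) b by (metis card_Diff1_less)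
      show "(\<Sum>a\<in>P - {b}. ?c a * (\<Prod>l\<in>UNIV. y $ l ^ E a l)) = 0" for y :: "complex^'d"
      proof -
        let ?y = "\<chi> i. if i = l then 2 * y $ i else y $ i"
        have pr: "(\<Prod>i\<in>UNIV. ?y $ i ^ E a i) = 2 ^ E a l * (\<Prod>i\<in>UNIV. y $ i ^ E a i)" for a
          by (simp add: prod.remove[of UNIV l] power_mult_distrib)
        have "(\<Sum>a\<in>P - {b}. ?c a * (\<Prod>l\<in>UNIV. y $ l ^ E a l)) = (\<Sum>a\<in>P. ?c a * (\<Prod>l\<in>UNIV. y $ l ^ E a l))"
          by (rule sum.mono_neutral_left) (use less.prems(1) in auto)
        also have "\<dots> = (\<Sum>a\<in>P. c a * (\<Prod>i\<in>UNIV. ?y $ i ^ E a i)) -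
            2 ^ E b l * (\<Sum>a\<in>P. c a * (\<Prod>i\<in>UNIV. y $ i ^ E a i))"
          unfolding pr sum_distrib_left sum_subtractf[symmetric]
          by (rule sum.cong) (simp_all add: algebra_simps)
        also have "\<dots> = 0" unfolding less.prems(4) by simp
        finally show ?thesis .
      qed
    qed (use less.prems b in \<open>auto intro: inj_on_subset\<close>)
    moreover have "(2::complex) ^ E a l \<noteq> 2 ^ E b l"
    proof
      assume "(2::complex) ^ E a l = 2 ^ E b l"
      then have "norm ((2::complex) ^ E a l) = norm ((2::complex) ^ E b l)" by simp
      then have "(2::real) ^ E a l = 2 ^ E b l" by (simp add: norm_power)
      with l show False by simp
    qed
    ultimately show ?thesis by simp
  qed
qed

text \<open>A polynomial of degree less than \<open>m\<close> that vanishes to order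
  \<open>m\<close> at 0 is zero: taking limits kills its coefficients one by one, the lowest
  first.\<close>

lemma sum_powers_vanish:
  fixes c :: "'a \<Rightarrow> complex"
  assumes P: "finite P" "\<And>a. a \<in> P \<Longrightarrow> n a < m"
    and ev: "\<forall>\<^sub>F z in at 0. (\<Sum>a\<in>P. c a * z ^ n a) = z ^ m * h z"
    and h: "(h \<longlongrightarrow> L) (at 0)"
  shows "(\<Sum>a\<in>P. c a * z ^ n a) = 0"
proof -
  \<comment> \<open>Several \<open>a\<close> may have the same power \<open>n a\<close>; only the
    sums over these are the coefficients of the polynomial.\<close>
  define C where "C i = (\<Sum>a | a \<in> P \<and> n a = i. c a)" for i
  have eq: "(\<Sum>a\<in>P. c a * z ^ n a) = (\<Sum>i<m. C i * z ^ i)" for z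
  proof -
    have "(\<Sum>a\<in>P. c a * z ^ n a) = (\<Sum>i<m. \<Sum>a | a \<in> P \<and> n a = i. c a * z ^ n a)"
      by (rule sum.group[symmetric]) (use P in auto)
    also have "\<dots> = (\<Sum>i<m. C i * z ^ i)"
      by (rule sum.cong) (auto simp: C_def sum_distrib_right)
    finally show ?thesis .
  qed
  have "C i = 0" if "i < m" for i
    using that
  proof (induction i rule: less_induct)
    case (less i)
    have tail: "(\<Sum>j<m. C j * z ^ j) = z ^ i * (\<Sum>j\<in>{i..<m}. C j * z ^ (j - i))" for z
    proof -
      have "(\<Sum>j<m. C j * z ^ j) = (\<Sum>j\<in>{i..<m}. C j * z ^ j)"
        by (rule sum.mono_neutral_right) (use less in auto)
      also have "\<dots> = z ^ i * (\<Sum>j\<in>{i..<m}. C j * z ^ (j - i))"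
        unfolding sum_distrib_left by (rule sum.cong) (simp_all add: mult.left_commute flip: power_add)
      finally show ?thesis .
    qed
    have "\<forall>\<^sub>F z in at 0. (\<Sum>j\<in>{i..<m}. C j * z ^ (j - i)) = z ^ (m - i) * h z"
    proof -
      have "\<forall>\<^sub>F z in at 0. z \<noteq> (0::complex)" by (simp add: eventually_at_filter)
      with ev show ?thesis
      proof eventually_elim
        case (elim z)
        then have "z ^ i * (\<Sum>j\<in>{i..<m}. C j * z ^ (j - i)) = z ^ i * (z ^ (m - i) * h z)"
          using less.prems by (simp add: eq tail mult.assoc[symmetric] flip: power_add)
        with elim show ?case by simp
      qed
    qed
    moreover have "((\<lambda>z. z ^ (m - i) * h z) \<longlongrightarrow> 0 ^ (m - i) * L) (at 0)"
      by (intro tendsto_intros h)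
    ultimately have 1: "((\<lambda>z. \<Sum>j\<in>{i..<m}. C j * z ^ (j - i)) \<longlongrightarrow> 0 ^ (m - i) * L) (at 0)"
      by (rule tendsto_cong[THEN iffD2])
    have 2: "((\<lambda>z. \<Sum>j\<in>{i..<m}. C j * z ^ (j - i)) \<longlongrightarrow> (\<Sum>j\<in>{i..<m}. C j * 0 ^ (j - i))) (at 0)"
      by (intro tendsto_intros)
    have "(\<Sum>j\<in>{i..<m}. C j * 0 ^ (j - i)) = (\<Sum>j\<in>{i}. C j * 0 ^ (j - i))"
      by (rule sum.mono_neutral_right) (use less.prems in auto)
    moreover have "0 ^ (m - i) * L = 0" using less.prems by simp
    ultimately show ?case using tendsto_unique[OF _ 1 2] less.prems by simp
  qed
  then show ?thesis unfolding eq by simp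
qed

section \<open>Toric charts of iterated blowing-ups\<close>

datatype 'd ray = Coord 'd | Div nat

primrec ray_vec :: "(nat \<Rightarrow> 'd \<Rightarrow> nat) \<Rightarrow> 'd ray \<Rightarrow> 'd \<Rightarrow> nat" where
  "ray_vec N (Coord i) = unit_exponent i"
| "ray_vec N (Div b) = N b"

text \<open>Linear independence of the rays of a cone, in the form of a trivial kernel over the
  integers; from this the values \<open>dot (A l) a\<close> determine the exponent
  \<open>a\<close>.\<close>

definition nondegenerate :: "('d::finite \<Rightarrow> 'd \<Rightarrow> nat) \<Rightarrow> bool" where
  "nondegenerate A \<longleftrightarrow> (\<forall>u :: 'd \<Rightarrow> int. (\<forall>l. (\<Sum>k\<in>UNIV. int (A l k) * u k) = 0) \<longrightarrow> (\<forall>k. u k = 0))"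

lemma nondegenerate_dot_inj:
  assumes "nondegenerate A" "\<And>l. dot (A l) a = dot (A l) b"
  shows "a = b"
proof -
  have "(\<Sum>k\<in>UNIV. int (A l k) * (int (a k) - int (b k))) = int (dot (A l) a) - int (dot (A l) b)" for l
    by (simp add: dot_def right_diff_distrib sum_subtractf)
  then have "int (a k) - int (b k) = 0" for k
    using assms(1)[unfolded nondegenerate_def, THEN spec[of _ "\<lambda>k. int (a k) - int (b k)"]] assms(2)
    by simp
  then show ?thesis by (auto simp: fun_eq_iff)
qed

lemma nondegenerate_column:
  assumes "nondegenerate A"
  shows "\<exists>l. A l k \<noteq> 0"
proof (rule ccontr)
  assume "\<nexists>l. A l k \<noteq> 0"
  then have "(\<Sum>i\<in>UNIV. int (A l i) * (if i = k then 1 else 0)) = 0" for l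
    by (simp add: if_distrib[of "\<lambda>x. _ * x"] cong: if_cong)
  with assms[unfolded nondegenerate_def, THEN spec[of _ "\<lambda>i. if i = k then 1 else 0 :: int"]]
  have "(if k = k then 1 else 0 :: int) = 0" by blast
  then show False by simp
qed

text \<open>Star subdivision: the new row is the sum of all rows, from which the remaining ones
  recover the row replaced.\<close>

lemma nondegenerate_blow_up:
  assumes A: "nondegenerate A"
  shows "nondegenerate (A(k := \<lambda>i. \<Sum>l\<in>UNIV. A l i))"
  unfolding nondegenerate_def
proof (intro allI impI)
  fix u :: "'a \<Rightarrow> int" and i
  let ?r = "\<lambda>l. \<Sum>i\<in>UNIV. int (A l i) * u i"
  assume h: "\<forall>l. (\<Sum>i\<in>UNIV. int ((A(k := \<lambda>i. \<Sum>l\<in>UNIV. A l i)) l i) * u i) = 0"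
  have l: "?r l = 0" if "l \<noteq> k" for l using h[rule_format, of l] that by simp
  have "(\<Sum>i\<in>UNIV. (\<Sum>l\<in>UNIV. int (A l i)) * u i) = 0" using h[rule_format, of k] by simp
  also have "(\<Sum>i\<in>UNIV. (\<Sum>l\<in>UNIV. int (A l i)) * u i) = (\<Sum>l\<in>UNIV. ?r l)"
    unfolding sum_distrib_right by (rule sum.swap)
  also have "\<dots> = ?r k" using l by (simp add: sum.remove[of UNIV k])
  finally have "?r l = 0" for l using l by (cases "l = k") auto
  then show "u i = 0" using A unfolding nondegenerate_def by blast
qed

lemma cspan1_scale: "c \<noteq> 0 \<Longrightarrow> cspan1 (c *s w) = cspan1 w"
proof -
  assume c: "c \<noteq> 0"
  have "(\<lambda>d. d *s (c *s w)) = (\<lambda>d. d *s w) \<circ> (\<lambda>d. d * c)"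
    by (simp add: fun_eq_iff vector_smult_assoc)
  then have "cspan1 (c *s w) = (\<lambda>d. d *s w) ` range (\<lambda>d. d * c)"
    unfolding cspan1_def image_comp by (rule arg_cong)
  also have "range (\<lambda>d. d * c) = UNIV"
    using c by (intro surjI[of _ "\<lambda>d. d / c"]) simp
  finally show ?thesis by (simp add: cspan1_def)
qed

lemma cspan1_eqD:
  assumes "cspan1 w = cspan1 w'" "w' \<noteq> 0"
  obtains c where "c \<noteq> 0" "w' = c *s w"
proof -
  have "w' \<in> cspan1 w'" unfolding cspan1_def by (rule range_eqI[of _ _ 1]) simp
  then obtain c where c: "w' = c *s w" using assms(1) by (auto simp: cspan1_def)
  moreover have "c \<noteq> 0" using c assms(2) by auto
  ultimately show thesis using that by blast
qed

text \<open>Homogeneous coordinates, normalized in position \<open>k\<close>, of the direction from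
  the centre that belongs to the point \<open>z\<close> of the k-th chart of the blowing-up.\<close>

definition direction :: "'d \<Rightarrow> complex^'d \<Rightarrow> complex^('d::finite)" where
  "direction k z = (\<chi> i. if i = k then 1 else z $ i)"

lemma direction_nth: "direction k z $ i = (if i = k then 1 else z $ i)"
  by (simp add: direction_def)

lemma direction_nonzero: "direction k z \<noteq> 0"
  by (metis direction_nth zero_index zero_neq_one)

lemma blowup_chart_eq:
  "blowup_chart j \<psi> k z = (if z $ k = 0 then Exc j (cspan1 (direction k z)) else \<psi> (z $ k *s direction k z))"
  by (simp add: blowup_chart_def direction_def Let_def)

text \<open>\<open>K\<close> is the set of charts \<open>\<psi>\<close> with their cones: the hyperplane \<open>y\<^sub>l = 0\<close> of \<open>\<psi>\<close> is the divisor of the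
  ray \<open>R l\<close>, which is either the strict transform of \<open>{x\<^sub>k = 0}\<close> (\<open>Coord k\<close>) or an exceptional
  divisor \<open>E\<^sub>b\<close> (\<open>Div b\<close>).  The primitive vector of \<open>E\<^sub>b\<close> is \<open>N b\<close>, and \<open>D b\<close> is the strict transform.
  In \<open>history\<close>, \<open>R\<close> is the cone of the centre of the \<open>b\<close>-th blowing-up.\<close>

locale toric_atlas =
  fixes j :: nat and X :: "('d::finite) variety"
    and K :: "((complex^'d \<Rightarrow> 'd pt) \<times> ('d \<Rightarrow> 'd ray)) set"
    and N :: "nat \<Rightarrow> 'd \<Rightarrow> nat" and D :: "nat \<Rightarrow> 'd pt set"
  assumes atlas: "atlas X = fst ` K"
    and inj_chart: "(\<psi>, R) \<in> K \<Longrightarrow> inj \<psi>"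
    and points: "points X = (\<Union>(\<psi>, R)\<in>K. range \<psi>)"
    and centre: "(\<psi>, R) \<in> K \<Longrightarrow> (\<psi>', R') \<in> K \<Longrightarrow> \<psi> 0 \<in> range \<psi>' \<Longrightarrow> \<psi> = \<psi>' \<and> R = R'"
    and inj_rays: "(\<psi>, R) \<in> K \<Longrightarrow> inj R"
    and labels: "(\<psi>, R) \<in> K \<Longrightarrow> R l = Div b \<Longrightarrow> 1 \<le> b \<and> b \<le> j"
    and nondeg: "(\<psi>, R) \<in> K \<Longrightarrow> nondegenerate (\<lambda>l. ray_vec N (R l))"
    and down_chart: "(\<psi>, R) \<in> K \<Longrightarrow> down X (\<psi> y) = monomial_map (\<lambda>l. ray_vec N (R l)) y"
    and divisor: "(\<psi>, R) \<in> K \<Longrightarrow> \<psi> y \<in> D b \<longleftrightarrow> (\<exists>l. R l = Div b \<and> y $ l = 0)"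
    and divisor_points: "D b \<subseteq> points X"
    and exceptional: "Exc i L \<in> points X \<Longrightarrow> 1 \<le> i \<and> i \<le> j \<and> Exc i L \<in> D i"
    and generic: "(\<psi>, R) \<in> K \<Longrightarrow> R l = Div b \<Longrightarrow> y $ l = 0 \<Longrightarrow> (\<And>m. m \<noteq> l \<Longrightarrow> y $ m \<noteq> 0)
        \<Longrightarrow> \<exists>L. \<psi> y = Exc b L"
    and action: "(\<psi>, R) \<in> K \<Longrightarrow> \<exists>\<Lambda>. \<Lambda> ` torus = torus \<and>
        (\<forall>t\<in>torus. \<forall>y. act X t (\<psi> y) = \<psi> (\<chi> l. \<Lambda> t $ l * y $ l))"
    and history: "1 \<le> b \<Longrightarrow> b \<le> j \<Longrightarrow> \<exists>R. inj R \<and> (\<forall>l c. R l = Div c \<longrightarrow> 1 \<le> c \<and> c < b) \<and>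
        N b = (\<lambda>k. \<Sum>l\<in>UNIV. ray_vec N (R l) k) \<and> nondegenerate (\<lambda>l. ray_vec N (R l))"
    and avoid_coord: "3 \<le> CARD('d) \<Longrightarrow> (\<psi>, R) \<in> K \<Longrightarrow> a \<noteq> b \<Longrightarrow> Div a \<in> range R \<Longrightarrow> Div b \<in> range R
        \<Longrightarrow> \<exists>\<psi>' R'. (\<psi>', R') \<in> K \<and> Div a \<in> range R' \<and> Div b \<in> range R' \<and> Coord k \<notin> range R'"
    and label_exists: "1 \<le> b \<Longrightarrow> b \<le> j \<Longrightarrow> \<exists>\<psi> R. (\<psi>, R) \<in> K \<and> Div b \<in> range R"
begin

text \<open>In a chart the torus acts through a map onto the full torus, so some element acts as
  doubling, which fixes only the centre of the chart. No other chart contains this centre, so the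
  description in \<open>centred_chart\<close> has a unique solution.\<close>

lemma fixed_point_is_centre:
  assumes "Q \<in> points X" "\<And>t. t \<in> torus \<Longrightarrow> act X t Q = Q"
  obtains \<psi> R where "(\<psi>, R) \<in> K" "\<psi> 0 = Q" "centred_chart X Q = \<psi>"
proof -
  obtain \<psi> R z where K: "(\<psi>, R) \<in> K" and z: "Q = \<psi> z" using assms(1) points by auto
  obtain \<Lambda> where L: "\<Lambda> ` torus = torus" "\<And>t y. t \<in> torus \<Longrightarrow> act X t (\<psi> y) = \<psi> (\<chi> l. \<Lambda> t $ l * y $ l)"
    using action[OF K] by blast
  have "(\<chi> l. 2) \<in> (torus :: (complex^'d) set)" by (simp add: torus_def)
  then obtain t where t: "t \<in> torus" "\<Lambda> t = (\<chi> l. 2)" using L(1) by (metis imageE)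
  have "\<psi> (\<chi> l. \<Lambda> t $ l * z $ l) = \<psi> z" using L(2)[OF t(1), of z] assms(2)[OF t(1)] z by simp
  then have "(\<chi> l. \<Lambda> t $ l * z $ l) = z" using inj_chart[OF K] by (simp add: inj_eq)
  then have "z = 0" using t(2) by (simp add: vec_eq_iff)
  with z have c: "\<psi> 0 = Q" by simp
  have "centred_chart X Q = \<psi>"
    unfolding centred_chart_def
  proof (rule the_equality)
    show "\<psi> \<in> atlas X \<and> \<psi> 0 = Q" using K c atlas by force
    fix \<psi>' assume "\<psi>' \<in> atlas X \<and> \<psi>' 0 = Q"
    then obtain R' where "(\<psi>', R') \<in> K" "\<psi> 0 = \<psi>' 0" using atlas c by force
    with centre[OF K, of \<psi>' R'] show "\<psi>' = \<psi>" by auto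
  qed
  with K c that show thesis by blast
qed

end

lemma toric_atlas_affine_space: "toric_atlas 0 affine_space {(Base, Coord)} N (\<lambda>_. {})"
proof
  have nd: "nondegenerate (\<lambda>l. unit_exponent l)"
    unfolding nondegenerate_def unit_exponent_def
    by (simp add: of_nat_eq_0_iff if_distrib[of int] if_distrib[of "\<lambda>x. x * _"] cong: if_cong)
  then show "nondegenerate (\<lambda>l. ray_vec N (R l))" if "(\<psi>, R) \<in> {(Base, Coord)}" for \<psi> :: "complex^'a \<Rightarrow> 'a pt" and R
    using that by simp
  show "down affine_space (\<psi> y) = monomial_map (\<lambda>l. ray_vec N (R l)) y"
    if "(\<psi>, R) \<in> {(Base, Coord)}" for \<psi> :: "complex^'a \<Rightarrow> 'a pt" and R y
    using that by (simp add: affine_space_def monomial_map_def vec_eq_iff unit_exponent_def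
        if_distrib[of "\<lambda>x. _ ^ x"] cong: if_cong)
  show "\<exists>\<Lambda>. \<Lambda> ` torus = torus \<and> (\<forall>t\<in>torus. \<forall>y. act affine_space t (\<psi> y) = \<psi> (\<chi> l. \<Lambda> t $ l * y $ l))"
    if "(\<psi>, R) \<in> {(Base, Coord)}" for \<psi> :: "complex^'a \<Rightarrow> 'a pt" and R
    using that by (intro exI[of _ id]) (simp add: affine_space_def)
qed (auto simp: affine_space_def inj_def)

context toric_atlas
begin

text \<open>Star subdivision of the cone \<open>R\<close> of \<open>Q\<close>. As \<open>Q\<close>
  is the centre of its chart, no other chart contains it: only this chart is replaced, by charts in
  each of which one ray is exchanged for the new ray.\<close>

lemma toric_atlas_blow_up:
  assumes card: "2 \<le> CARD('d)" and Q: "Q \<in> points X" "\<And>t. t \<in> torus \<Longrightarrow> act X t Q = Q"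
  shows "\<exists>K' N' D'. toric_atlas (Suc j) (blow_up (Suc j) Q X) K' N' D'"
proof -
  obtain \<psi> R where K: "(\<psi>, R) \<in> K" and \<psi>0: "\<psi> 0 = Q" and cc: "centred_chart X Q = \<psi>"
    using fixed_point_is_centre[OF Q] by blast
  let ?X = "blow_up (Suc j) Q X"
  define \<beta> where "\<beta> = blowup_chart (Suc j) \<psi>"
  have \<beta>: "\<beta> k z = (if z $ k = 0 then Exc (Suc j) (cspan1 (direction k z)) else \<psi> (z $ k *s direction k z))" for k z
    unfolding \<beta>_def by (rule blowup_chart_eq)
  define Kold where "Kold = {(\<phi>, S) \<in> K. Q \<notin> range \<phi>}"
  define Knew where "Knew = range (\<lambda>k. (\<beta> k, R(k := Div (Suc j))))"
  define N' where "N' = N(Suc j := \<lambda>k. \<Sum>l\<in>UNIV. ray_vec N (R l) k)"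
  define new where "new W = {Exc (Suc j) (cspan1 w) | w. w \<noteq> 0 \<and> W w}" for W :: "complex^'d \<Rightarrow> bool"
  \<comment> \<open>An older divisor loses \<open>Q\<close> and gains the directions tangent to it,
    those whose coordinate at its ray is 0.\<close>
  define D' where "D' b = (if b = Suc j then new (\<lambda>_. True)
    else (D b - {Q}) \<union> new (\<lambda>w. \<exists>l. R l = Div b \<and> w $ l = 0))" for b
  have points_X: "points ?X = (points X - {Q}) \<union> new (\<lambda>_. True)"
    and atlas_X: "atlas ?X = {\<phi> \<in> atlas X. Q \<notin> range \<phi>} \<union> range \<beta>"
    by (simp_all add: blow_up_def Let_def cc \<beta>_def new_def)
  have chart_point: "\<phi> y \<in> points X" if "(\<phi>, S) \<in> K" for \<phi> S y using that points by auto
  have not_new: "p \<noteq> Exc (Suc j) L" if "p \<in> points X" for p L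
    using exceptional[of "Suc j" L] that by auto
  have chart_not_new: "\<phi> y \<noteq> Exc (Suc j) L" "Exc (Suc j) L \<noteq> \<phi> y" if "(\<phi>, S) \<in> K" for \<phi> S y L
    using not_new[OF chart_point[OF that]] by metis+
  have down_old: "down ?X p = down X p" if "p \<in> points X" for p
    using not_new[OF that] by (simp add: blow_up_def Let_def split: pt.split)
  have down_new: "down ?X (Exc (Suc j) L) = down X Q" for L
    by (simp add: blow_up_def Let_def)
  have act_old: "act ?X t p = act X t p" if "p \<in> points X" for p t
    using not_new[OF that] by (simp add: blow_up_def Let_def split: pt.split)
  have act_new: "act ?X t (Exc (Suc j) L) = Exc (Suc j) {y'. \<exists>y\<in>L. \<psi> y' = act X t (\<psi> y)}" for t L
    by (simp add: blow_up_def Let_def cc)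
  have inj_\<psi>: "inj \<psi>" by (rule inj_chart[OF K])
  have KoldD: "(\<phi>, S) \<in> K" "Q \<notin> range \<phi>" if "(\<phi>, S) \<in> Kold" for \<phi> S
    using that by (auto simp: Kold_def)
  have KnewD: "\<exists>k. \<phi> = \<beta> k \<and> S = R(k := Div (Suc j))" if "(\<phi>, S) \<in> Knew" for \<phi> S
    using that by (auto simp: Knew_def)
  have through_Q: "\<phi> = \<psi> \<and> S = R" if "(\<phi>, S) \<in> K" "Q \<in> range \<phi>" for \<phi> S
    using centre[OF K that(1)] that(2) \<psi>0 by auto
  have old_not_new: "\<phi> y \<notin> new W" if "(\<phi>, S) \<in> K" for \<phi> S y W
    using chart_not_new[OF that] by (auto simp: new_def)
  have R_label: "R l \<noteq> Div (Suc j)" for l using labels[OF K, of l "Suc j"] by auto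
  have ray_vec_old: "ray_vec N' r = ray_vec N r" if "r \<noteq> Div (Suc j)" for r
    using that by (cases r) (auto simp: N'_def)
  have label_old: "S l \<noteq> Div (Suc j)" if "(\<phi>, S) \<in> K" for \<phi> S l
    using labels[OF that, of l "Suc j"] by auto
  have vec_old: "(\<lambda>l. ray_vec N' (S l)) = (\<lambda>l. ray_vec N (S l))" if "(\<phi>, S) \<in> K" for \<phi> S
    using ray_vec_old label_old[OF that] by auto
  let ?A = "\<lambda>l. ray_vec N (R l)"
  have vec_new: "(\<lambda>l. ray_vec N' ((R(k := Div (Suc j))) l)) = ?A(k := \<lambda>i. \<Sum>l\<in>UNIV. ?A l i)" for k
    using ray_vec_old R_label by (auto simp: fun_eq_iff N'_def)
  have dir_nz: "z $ k \<noteq> 0 \<Longrightarrow> z $ k *s direction k z \<noteq> 0" for z :: "complex^'d" and k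
    using direction_nonzero by simp
  have \<psi>_eq: "\<psi> y = \<psi> y' \<longleftrightarrow> y = y'" for y y' using inj_\<psi> by (simp add: inj_eq)
  have \<psi>_Q: "\<psi> y = Q \<longleftrightarrow> y = 0" for y using \<psi>_eq[of y 0] \<psi>0 by simp
  \<comment> \<open>A point of the new divisor is a line, so a property may be tested on any one of
    its vectors only if it is invariant under scaling.\<close>
  have mem_new: "Exc (Suc j) (cspan1 w) \<in> new W \<longleftrightarrow> W w"
    if "w \<noteq> 0" and inv: "\<And>c w. c \<noteq> 0 \<Longrightarrow> W (c *s w) \<longleftrightarrow> W w" for w W
  proof
    assume "Exc (Suc j) (cspan1 w) \<in> new W"
    then obtain w' where w': "cspan1 w' = cspan1 w" "W w'" by (auto simp: new_def)
    then show "W w" using cspan1_eqD[OF w'(1) that(1)] inv by metis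
  qed (use that in \<open>auto simp: new_def\<close>)
  \<comment> \<open>The centre of the k-th chart is the k-th coordinate direction, while every
    direction in the chart of \<open>k'\<close> has a nonzero coordinate at
    \<open>k'\<close>.\<close>
  have \<beta>_centre: "k = k'" if h: "\<beta> k 0 \<in> range (\<beta> k')" for k k'
  proof -
    obtain y where y: "\<beta> k 0 = \<beta> k' y" using h by blast
    then have yk: "y $ k' = 0" using chart_not_new[OF K] by (auto simp: \<beta> split: if_splits)
    with y have "cspan1 (direction k 0) = cspan1 (direction k' y)" by (simp add: \<beta>)
    then obtain c where c: "direction k' y = c *s direction k 0"
      using cspan1_eqD[OF _ direction_nonzero] by metis
    have "direction k' y $ k' = c * direction k 0 $ k'" using c by simp
    then show ?thesis by (simp add: direction_nth split: if_splits)
  qed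
  have "toric_atlas (Suc j) ?X (Kold \<union> Knew) N' D'"
  proof
    show "atlas ?X = fst ` (Kold \<union> Knew)"
      unfolding atlas_X atlas image_Un Kold_def Knew_def by (force simp: image_image)
  next
    fix \<phi> S assume "(\<phi>, S) \<in> Kold \<union> Knew"
    then show "inj \<phi>"
    proof
      assume "(\<phi>, S) \<in> Knew"
      then obtain k where \<phi>: "\<phi> = \<beta> k" using KnewD by blast
      show "inj \<phi>"
        unfolding \<phi>
      proof (rule injI)
        fix y y' assume eq: "\<beta> k y = \<beta> k y'"
        consider "y $ k = 0" "y' $ k = 0" | "y $ k \<noteq> 0" "y' $ k \<noteq> 0"
          using eq chart_not_new[OF K] by (auto simp: \<beta> split: if_splits)
        then show "y = y'"
        proof cases
          case 1
          then have "cspan1 (direction k y) = cspan1 (direction k y')" using eq by (simp add: \<beta>)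
          then obtain c where c: "direction k y' = c *s direction k y"
            using cspan1_eqD[OF _ direction_nonzero] by metis
          then have "direction k y' $ k = c * direction k y $ k" by simp
          then have "c = 1" by (simp add: direction_nth)
          with c have d: "direction k y' $ i = direction k y $ i" for i by simp
          show ?thesis
            unfolding vec_eq_iff
          proof
            fix i show "y $ i = y' $ i" using d[of i] 1 by (cases "i = k") (auto simp: direction_nth)
          qed
        next
          case 2
          then have "\<psi> (y $ k *s direction k y) = \<psi> (y' $ k *s direction k y')" using eq by (simp add: \<beta>)
          then have d: "y $ k * direction k y $ i = y' $ k * direction k y' $ i" for i
            unfolding \<psi>_eq by (metis vector_smult_component)
          have "y $ k = y' $ k" using d[of k] by (simp add: direction_nth)
          show ?thesis
            unfolding vec_eq_iff
          proof
            fix i show "y $ i = y' $ i"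
              using d[of i] 2 \<open>y $ k = y' $ k\<close> by (cases "i = k") (auto simp: direction_nth)
          qed
        qed
      qed
    qed (use KoldD inj_chart in blast)
  next
    show "points ?X = (\<Union>(\<phi>, S)\<in>Kold \<union> Knew. range \<phi>)"
    proof (intro equalityI subsetI)
      fix p assume "p \<in> points ?X"
      then consider "p \<in> points X" "p \<noteq> Q" | "p \<in> new (\<lambda>_. True)" unfolding points_X by blast
      then show "p \<in> (\<Union>(\<phi>, S)\<in>Kold \<union> Knew. range \<phi>)"
      proof cases
        case 1
        then obtain \<phi> S y where S: "(\<phi>, S) \<in> K" "p = \<phi> y" using points by auto
        show ?thesis
        proof (cases "Q \<in> range \<phi>")
          case True
          then have p: "p = \<psi> y" using through_Q S by blast
          then have "y \<noteq> 0" using 1 \<psi>_Q by blast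
          then obtain k where k: "y $ k \<noteq> 0" by (auto simp: vec_eq_iff)
          \<comment> \<open>The inverse of the blowing-down map in this chart, available where
            \<open>y $ k\<close> is not 0.\<close>
          let ?z = "\<chi> i. if i = k then y $ k else y $ i / y $ k"
          have "?z $ k *s direction k ?z = y" using k by (simp add: vec_eq_iff direction_nth)
          then have "p = \<beta> k ?z" using k p by (simp add: \<beta>)
          then show ?thesis by (auto simp: Knew_def)
        qed (use S in \<open>auto simp: Kold_def\<close>)
      next
        case 2
        then obtain w where w: "w \<noteq> 0" "p = Exc (Suc j) (cspan1 w)" by (auto simp: new_def)
        then obtain k where k: "w $ k \<noteq> 0" by (auto simp: vec_eq_iff)
        let ?z = "\<chi> i. if i = k then 0 else w $ i / w $ k"
        have "w = w $ k *s direction k ?z" using k by (simp add: vec_eq_iff direction_nth)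
        then have "cspan1 w = cspan1 (direction k ?z)" using cspan1_scale[OF k] by metis
        then have "p = \<beta> k ?z" using w by (simp add: \<beta>)
        then show ?thesis by (auto simp: Knew_def)
      qed
    next
      fix p assume "p \<in> (\<Union>(\<phi>, S)\<in>Kold \<union> Knew. range \<phi>)"
      then obtain \<phi> S y where S: "(\<phi>, S) \<in> Kold \<union> Knew" "p = \<phi> y" by auto
      show "p \<in> points ?X"
      proof (cases "(\<phi>, S) \<in> Kold")
        case True
        then show ?thesis using KoldD[OF True] chart_point[OF KoldD(1)[OF True], of y] S(2)
          unfolding points_X by auto
      next
        case False
        then obtain k where "p = \<beta> k y" using S KnewD by blast
        then show ?thesis
          unfolding points_X using dir_nz[of y k] chart_point[OF K] \<psi>_Q direction_nonzero[of k y]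
          by (auto simp: \<beta> new_def)
      qed
    qed
  next
    fix \<phi> S \<phi>' S' assume S: "(\<phi>, S) \<in> Kold \<union> Knew" "(\<phi>', S') \<in> Kold \<union> Knew" and r: "\<phi> 0 \<in> range \<phi>'"
    show "\<phi> = \<phi>' \<and> S = S'"
    proof (cases "(\<phi>, S) \<in> Kold")
      case True
      note old = KoldD[OF True]
      show ?thesis
      proof (cases "(\<phi>', S') \<in> Kold")
        case True': True
        show ?thesis using centre[OF old(1) KoldD(1)[OF True'] r] .
      next
        case False
        then obtain k where "\<phi>' = \<beta> k" using S KnewD by blast
        then obtain y where y: "\<phi> 0 = \<beta> k y" using r by auto
        then have "y $ k \<noteq> 0" using chart_not_new[OF old(1)] by (auto simp: \<beta> split: if_splits)
        then have "\<phi> 0 \<in> range \<psi>" using y by (auto simp: \<beta>)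
        then have "\<phi> = \<psi>" using centre[OF old(1) K] by blast
        with old(2) \<psi>0 show ?thesis by blast
      qed
    next
      case False
      then obtain k where k: "\<phi> = \<beta> k" "S = R(k := Div (Suc j))" using S KnewD by blast
      show ?thesis
      proof (cases "(\<phi>', S') \<in> Kold")
        case True
        then show ?thesis using r k chart_not_new[OF KoldD(1)[OF True]] by (auto simp: \<beta>)
      next
        case False
        then obtain k' where k': "\<phi>' = \<beta> k'" "S' = R(k' := Div (Suc j))" using S KnewD by blast
        then have "k = k'" using \<beta>_centre r k by blast
        then show ?thesis using k k' by simp
      qed
    qed
  next
    fix \<phi> S assume S: "(\<phi>, S) \<in> Kold \<union> Knew"
    show "inj S"
    proof (cases "(\<phi>, S) \<in> Kold")
      case True
      then show ?thesis using KoldD inj_rays by blast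
    next
      case False
      then obtain k where k: "S = R(k := Div (Suc j))" using S KnewD by blast
      show ?thesis
        unfolding k using inj_rays[OF K] R_label
        by (auto simp: inj_def) (metis R_label)+
    qed
  next
    fix \<phi> S l b assume S: "(\<phi>, S) \<in> Kold \<union> Knew" and b: "S l = Div b"
    show "1 \<le> b \<and> b \<le> Suc j"
    proof (cases "(\<phi>, S) \<in> Kold")
      case True
      then show ?thesis using labels[OF KoldD(1)[OF True] b] by auto
    next
      case False
      then obtain k where k: "S = R(k := Div (Suc j))" using S KnewD by blast
      show ?thesis using b labels[OF K, of l b] unfolding k by (cases "l = k") auto
    qed
  next
    fix \<phi> S assume S: "(\<phi>, S) \<in> Kold \<union> Knew"
    show "nondegenerate (\<lambda>l. ray_vec N' (S l))"
    proof (cases "(\<phi>, S) \<in> Kold")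
      case True
      then show ?thesis using vec_old[OF KoldD(1)[OF True]] nondeg[OF KoldD(1)[OF True]] by simp
    next
      case False
      then obtain k where k: "S = R(k := Div (Suc j))" using S KnewD by blast
      show ?thesis unfolding k vec_new by (rule nondegenerate_blow_up[OF nondeg[OF K]])
    qed
  next
    fix \<phi> S y assume S: "(\<phi>, S) \<in> Kold \<union> Knew"
    show "down ?X (\<phi> y) = monomial_map (\<lambda>l. ray_vec N' (S l)) y"
    proof (cases "(\<phi>, S) \<in> Kold")
      case True
      note old = KoldD(1)[OF True]
      show ?thesis using down_old[OF chart_point[OF old]] down_chart[OF old] vec_old[OF old] by simp
    next
      case False
      then obtain k where k: "\<phi> = \<beta> k" "S = R(k := Div (Suc j))" using S KnewD by blast
      have "down ?X (\<beta> k y) = down X (\<psi> (y $ k *s direction k y))"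
        using down_new down_old[OF chart_point[OF K]] \<psi>0 by (simp add: \<beta>)
      also have "\<dots> = monomial_map ?A (y $ k *s direction k y)" by (rule down_chart[OF K])
      \<comment> \<open>The factor \<open>y $ k\<close> occurs in every coordinate of the vector, so
        its exponent is the sum of the rows of \<open>?A\<close>, the new ray.\<close>
      also have "\<dots> = monomial_map (?A(k := \<lambda>i. \<Sum>l\<in>UNIV. ?A l i)) y"
        unfolding vec_eq_iff
      proof
        fix i
        have "monomial_map ?A (y $ k *s direction k y) $ i
            = (\<Prod>l\<in>UNIV. y $ k ^ ?A l i) * (\<Prod>l\<in>UNIV. direction k y $ l ^ ?A l i)"
          by (simp add: monomial_map_def power_mult_distrib prod.distrib)
        also have "(\<Prod>l\<in>UNIV. y $ k ^ ?A l i) = y $ k ^ (\<Sum>l\<in>UNIV. ?A l i)" by (simp add: power_sum)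
        also have "(\<Prod>l\<in>UNIV. direction k y $ l ^ ?A l i) = (\<Prod>l\<in>UNIV - {k}. y $ l ^ ?A l i)"
          by (simp add: prod.remove[of UNIV k] direction_nth)
        also have "y $ k ^ (\<Sum>l\<in>UNIV. ?A l i) * (\<Prod>l\<in>UNIV - {k}. y $ l ^ ?A l i)
            = monomial_map (?A(k := \<lambda>i. \<Sum>l\<in>UNIV. ?A l i)) y $ i"
          by (simp add: monomial_map_def prod.remove[of UNIV k])
        finally show "monomial_map ?A (y $ k *s direction k y) $ i =
            monomial_map (?A(k := \<lambda>i. \<Sum>l\<in>UNIV. ?A l i)) y $ i" .
      qed
      finally show ?thesis unfolding k vec_new .
    qed
  next
    fix \<phi> S y b assume S: "(\<phi>, S) \<in> Kold \<union> Knew"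
    show "\<phi> y \<in> D' b \<longleftrightarrow> (\<exists>l. S l = Div b \<and> y $ l = 0)"
    proof (cases "(\<phi>, S) \<in> Kold")
      case True
      note old = KoldD[OF True]
      have "\<phi> y \<noteq> Q" using old(2) by auto
      then show ?thesis
        using divisor[OF old(1), of y b] old_not_new[OF old(1)] label_old[OF old(1)] by (auto simp: D'_def)
    next
      case False
      then obtain k where k: "\<phi> = \<beta> k" "S = R(k := Div (Suc j))" using S KnewD by blast
      show ?thesis
      proof (cases "b = Suc j")
        case True
        have "\<beta> k y \<in> new (\<lambda>_. True) \<longleftrightarrow> y $ k = 0"
          using old_not_new[OF K] mem_new[OF direction_nonzero, of "\<lambda>_. True"] by (simp add: \<beta>)
        then show ?thesis using True k R_label by (auto simp: D'_def)
      next
        case b: False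
        let ?W = "\<lambda>w :: complex^'d. \<exists>l. R l = Div b \<and> w $ l = 0"
        have inv: "?W (c *s w) \<longleftrightarrow> ?W w" if "c \<noteq> 0" for c w using that by simp
        have rhs: "(\<exists>l. S l = Div b \<and> y $ l = 0) \<longleftrightarrow> ?W (direction k y)"
          unfolding k using b by (auto simp: direction_nth)
        have exc_D: "Exc (Suc j) L \<notin> D b" for L
          using divisor_points[of b] not_new by blast
        show ?thesis
        proof (cases "y $ k = 0")
          case True
          then show ?thesis unfolding rhs k(1) D'_def using b exc_D mem_new[OF direction_nonzero, of ?W, OF inv]
            by (simp add: \<beta>)
        next
          case False
          then have "\<beta> k y = \<psi> (y $ k *s direction k y)" by (simp add: \<beta>)
          moreover have "\<psi> (y $ k *s direction k y) \<in> D b \<longleftrightarrow> ?W (direction k y)"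
            unfolding divisor[OF K] by (rule inv[OF False])
          ultimately show ?thesis
            unfolding rhs k(1) D'_def using b old_not_new[OF K] dir_nz[OF False] \<psi>_Q by simp
        qed
      qed
    qed
  next
    show "D' b \<subseteq> points ?X" for b
      unfolding points_X D'_def using divisor_points[of b] by (auto simp: new_def)
  next
    fix i L assume "Exc i L \<in> points ?X"
    then consider "Exc i L \<in> points X" "Exc i L \<noteq> Q" | "Exc i L \<in> new (\<lambda>_. True)" unfolding points_X by blast
    then show "1 \<le> i \<and> i \<le> Suc j \<and> Exc i L \<in> D' i"
    proof cases
      case 1
      with exceptional[OF 1(1)] show ?thesis by (auto simp: D'_def)
    qed (auto simp: D'_def new_def)
  next
    fix \<phi> S l b and y :: "complex^'d"
    assume S: "(\<phi>, S) \<in> Kold \<union> Knew" and l: "S l = Div b" "y $ l = 0" "\<And>m. m \<noteq> l \<Longrightarrow> y $ m \<noteq> 0"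
    show "\<exists>L. \<phi> y = Exc b L"
    proof (cases "(\<phi>, S) \<in> Kold")
      case True
      then show ?thesis using generic[OF KoldD(1)[OF True] l] by blast
    next
      case False
      then obtain k where k: "\<phi> = \<beta> k" "S = R(k := Div (Suc j))" using S KnewD by blast
      show ?thesis
      proof (cases "l = k")
        case True
        then show ?thesis using l k by (auto simp: \<beta>)
      next
        case False
        then have yk: "y $ k \<noteq> 0" using l(3) by auto
        have "\<exists>L. \<psi> (y $ k *s direction k y) = Exc b L"
        proof (rule generic[OF K, of l b])
          show "R l = Div b" using l(1) k False by simp
          show "(y $ k *s direction k y) $ l = 0" using l(2) False by (simp add: direction_nth)
          show "(y $ k *s direction k y) $ m \<noteq> 0" if "m \<noteq> l" for m
            using l(3)[OF that] yk by (simp add: direction_nth)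
        qed
        then show ?thesis using yk k by (simp add: \<beta>)
      qed
    qed
  next
    fix \<phi> S assume S: "(\<phi>, S) \<in> Kold \<union> Knew"
    show "\<exists>\<Lambda>. \<Lambda> ` torus = torus \<and> (\<forall>t\<in>torus. \<forall>y. act ?X t (\<phi> y) = \<phi> (\<chi> l. \<Lambda> t $ l * y $ l))"
    proof (cases "(\<phi>, S) \<in> Kold")
      case True
      note old = KoldD(1)[OF True]
      show ?thesis using action[OF old] act_old[OF chart_point[OF old]] by simp
    next
      case False
      then obtain k where k: "\<phi> = \<beta> k" using S KnewD by blast
      obtain \<Lambda> where L: "\<Lambda> ` torus = torus" "\<And>t y. t \<in> torus \<Longrightarrow> act X t (\<psi> y) = \<psi> (\<chi> l. \<Lambda> t $ l * y $ l)"
        using action[OF K] by blast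
      \<comment> \<open>The new chart coordinates are the k-th old coordinate and the quotients of
        the others by it; these are their scaling factors.\<close>
      define \<Lambda>' where "\<Lambda>' t = (\<chi> l. if l = k then \<Lambda> t $ k else \<Lambda> t $ l / \<Lambda> t $ k)" for t
      have Lt: "\<Lambda> t $ l \<noteq> 0" if "t \<in> torus" for t l using that L(1) by (auto simp: torus_def)
      have "\<Lambda>' ` torus = torus"
      proof (intro equalityI subsetI)
        fix x assume "x \<in> \<Lambda>' ` torus"
        then obtain t where t: "t \<in> torus" "x = \<Lambda>' t" by blast
        then show "x \<in> torus" using Lt[OF t(1)] by (simp add: torus_def \<Lambda>'_def)
      next
        fix x :: "complex^'d" assume x: "x \<in> torus"
        let ?x = "\<chi> l. if l = k then x $ k else x $ l * x $ k"
        have "?x \<in> torus" using x by (auto simp: torus_def)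
        then have "?x \<in> \<Lambda> ` torus" by (simp only: L(1))
        then obtain t where t: "t \<in> torus" "\<Lambda> t = ?x" by (elim imageE) simp
        have "\<Lambda>' t = x" using t x by (simp add: \<Lambda>'_def vec_eq_iff torus_def)
        with t show "x \<in> \<Lambda>' ` torus" by blast
      qed
      moreover have "act ?X t (\<beta> k y) = \<beta> k (\<chi> l. \<Lambda>' t $ l * y $ l)" if t: "t \<in> torus" for t y
      proof -
        let ?y = "\<chi> l. \<Lambda>' t $ l * y $ l"
        have yk: "?y $ k = \<Lambda> t $ k * y $ k" by (simp add: \<Lambda>'_def)
        have dir: "(\<chi> l. \<Lambda> t $ l * direction k y $ l) = \<Lambda> t $ k *s direction k ?y"
          using Lt[OF t] by (simp add: vec_eq_iff direction_nth \<Lambda>'_def)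
        show ?thesis
        proof (cases "y $ k = 0")
          case True
          have "{y'. \<exists>u\<in>cspan1 (direction k y). \<psi> y' = act X t (\<psi> u)}
              = (\<lambda>u. \<chi> l. \<Lambda> t $ l * u $ l) ` cspan1 (direction k y)"
            using L(2)[OF t] \<psi>_eq by auto
          also have "\<dots> = cspan1 (\<chi> l. \<Lambda> t $ l * direction k y $ l)"
            unfolding cspan1_def image_image
            by (rule image_cong) (simp_all add: vec_eq_iff)
          also have "\<dots> = cspan1 (direction k ?y)" unfolding dir by (rule cspan1_scale[OF Lt[OF t]])
          finally show ?thesis using True yk by (simp add: \<beta> act_new)
        next
          case False
          have "act ?X t (\<beta> k y) = act X t (\<psi> (y $ k *s direction k y))"
            using False act_old[OF chart_point[OF K]] by (simp add: \<beta>)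
          also have "\<dots> = \<psi> (\<chi> l. \<Lambda> t $ l * (y $ k *s direction k y) $ l)" by (rule L(2)[OF t])
          also have "(\<chi> l. \<Lambda> t $ l * (y $ k *s direction k y) $ l) = y $ k *s (\<chi> l. \<Lambda> t $ l * direction k y $ l)"
            by (simp add: vec_eq_iff)
          also have "\<dots> = ?y $ k *s direction k ?y"
            unfolding dir yk by (simp add: vector_smult_assoc mult.commute)
          finally show ?thesis using False yk Lt[OF t, of k] by (simp add: \<beta>)
        qed
      qed
      ultimately show ?thesis unfolding k by blast
    qed
  next
    fix b assume b: "1 \<le> b" "b \<le> Suc j"
    show "\<exists>R. inj R \<and> (\<forall>l c. R l = Div c \<longrightarrow> 1 \<le> c \<and> c < b) \<and>
        N' b = (\<lambda>k. \<Sum>l\<in>UNIV. ray_vec N' (R l) k) \<and> nondegenerate (\<lambda>l. ray_vec N' (R l))"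
    proof (cases "b = Suc j")
      case True
      have "N' (Suc j) = (\<lambda>k. \<Sum>l\<in>UNIV. ray_vec N' (R l) k)"
        using ray_vec_old[OF R_label] by (simp add: N'_def)
      then show ?thesis
        using True inj_rays[OF K] labels[OF K] nondeg[OF K] vec_old[OF K]
        by (intro exI[of _ R]) (auto simp: less_Suc_eq_le)
    next
      case False
      then have bj: "b \<le> j" using b by simp
      then obtain T where T: "inj T" "\<And>l c. T l = Div c \<Longrightarrow> 1 \<le> c \<and> c < b"
        "N b = (\<lambda>k. \<Sum>l\<in>UNIV. ray_vec N (T l) k)" "nondegenerate (\<lambda>l. ray_vec N (T l))"
        using history[OF b(1)] by blast
      have "T l \<noteq> Div (Suc j)" for l using T(2)[of l "Suc j"] bj by auto
      then have "(\<lambda>l. ray_vec N' (T l)) = (\<lambda>l. ray_vec N (T l))" using ray_vec_old by auto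
      then have "ray_vec N' (T l) = ray_vec N (T l)" for l by meson
      moreover have "N' b = N b" using False by (simp add: N'_def)
      ultimately show ?thesis using T by (intro exI[of _ T]) auto
    qed
  next
    fix \<phi> S a b k
    assume c3: "3 \<le> CARD('d)" and S: "(\<phi>, S) \<in> Kold \<union> Knew" and ab: "a \<noteq> b" "Div a \<in> range S" "Div b \<in> range S"
    \<comment> \<open>If the chart that avoids \<open>Coord k\<close> is the one being subdivided, a
      ray different from those of \<open>Div a\<close> and \<open>Div b\<close> is exchanged, which
      is possible in dimension at least 3.\<close>
    have old: "\<exists>\<psi>' R'. (\<psi>', R') \<in> Kold \<union> Knew \<and> Div a \<in> range R' \<and> Div b \<in> range R' \<and> Coord k \<notin> range R'"
      if T: "(\<phi>', T) \<in> K" "Div a \<in> range T" "Div b \<in> range T" for \<phi>' T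
    proof -
      obtain \<phi>'' T' where T': "(\<phi>'', T') \<in> K" "Div a \<in> range T'" "Div b \<in> range T'" "Coord k \<notin> range T'"
        using avoid_coord[OF c3 T(1) ab(1) T(2,3)] by blast
      show ?thesis
      proof (cases "Q \<in> range \<phi>''")
        case False
        then have "(\<phi>'', T') \<in> Kold" using T' by (simp add: Kold_def)
        with T' show ?thesis by blast
      next
        case True
        then have TR: "T' = R" using through_Q T' by blast
        obtain la lb where l: "R la = Div a" "R lb = Div b" using T'(2,3) unfolding TR by (auto simp: image_iff)
        have "card {la, lb} < CARD('d)" using c3 by (simp add: card_insert_if)
        then obtain m where m: "m \<noteq> la" "m \<noteq> lb"
          by (metis UNIV_eq_I insertCI less_irrefl insertE singletonD)
        let ?R = "R(m := Div (Suc j))"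
        have "?R la = Div a" "?R lb = Div b" using l m by auto
        then have "Div a \<in> range ?R" "Div b \<in> range ?R" by (metis rangeI)+
        moreover have "Coord k \<notin> range ?R" using T'(4) unfolding TR by auto
        moreover have "(\<beta> m, ?R) \<in> Knew" by (auto simp: Knew_def)
        ultimately show ?thesis by blast
      qed
    qed
    \<comment> \<open>Here the ray exchanged for the new one is \<open>Coord k\<close> if it belongs
      to the cone, and otherwise any ray other than \<open>Div c\<close>.\<close>
    have new_case: "\<exists>\<psi>' R'. (\<psi>', R') \<in> Kold \<union> Knew \<and> Div (Suc j) \<in> range R' \<and> Div c \<in> range R' \<and> Coord k \<notin> range R'"
      if c: "Div c \<in> range R" for c
    proof -
      obtain lc where lc: "R lc = Div c" using c by (auto simp: image_iff)
      obtain m where m: "m \<noteq> lc" "\<And>l. l \<noteq> m \<Longrightarrow> R l \<noteq> Coord k"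
      proof (cases "Coord k \<in> range R")
        case True
        then obtain l where "R l = Coord k" by (auto simp: image_iff)
        with lc inj_rays[OF K] that[of l] show ?thesis by (metis injD ray.distinct(1))
      next
        case False
        have "card {lc} < CARD('d)" using card by simp
        then obtain m where "m \<noteq> lc" by (metis UNIV_eq_I insertCI less_irrefl)
        with False that[of m] show ?thesis by (metis rangeI)
      qed
      let ?R = "R(m := Div (Suc j))"
      have "?R m = Div (Suc j)" "?R lc = Div c" using lc m by auto
      then have "Div (Suc j) \<in> range ?R" "Div c \<in> range ?R" by (metis rangeI)+
      moreover have "Coord k \<notin> range ?R"
      proof
        assume "Coord k \<in> range ?R"
        then obtain x where "?R x = Coord k" by (elim imageE) simp
        then show False using m(2)[of x] by (cases "x = m") auto
      qed
      moreover have "(\<beta> m, ?R) \<in> Knew" by (auto simp: Knew_def)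
      ultimately show ?thesis by blast
    qed
    show "\<exists>\<psi>' R'. (\<psi>', R') \<in> Kold \<union> Knew \<and> Div a \<in> range R' \<and> Div b \<in> range R' \<and> Coord k \<notin> range R'"
    proof (cases "(\<phi>, S) \<in> Kold")
      case True
      then show ?thesis using old[OF KoldD(1)[OF True] ab(2,3)] by blast
    next
      case False
      then obtain m where m: "S = R(m := Div (Suc j))" using S KnewD by blast
      have mem: "Div c \<in> range R" if "Div c \<in> range S" "c \<noteq> Suc j" for c
        using that unfolding m by (auto split: if_splits)
      consider "a = Suc j" | "b = Suc j" | "a \<noteq> Suc j" "b \<noteq> Suc j" by blast
      then show ?thesis
      proof cases
        case 1
        with new_case[OF mem[OF ab(3)]] ab(1) show ?thesis by blast
      next
        case 2
        with new_case[OF mem[OF ab(2)]] ab(1) show ?thesis by blast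
      next
        case 3
        with old[OF K mem[OF ab(2)] mem[OF ab(3)]] show ?thesis by blast
      qed
    qed
  next
    fix b assume b: "1 \<le> b" "b \<le> Suc j"
    show "\<exists>\<phi> S. (\<phi>, S) \<in> Kold \<union> Knew \<and> Div b \<in> range S"
    proof (cases "b = Suc j")
      case True
      obtain k :: 'd where True by blast
      have "(\<beta> k, R(k := Div (Suc j))) \<in> Knew" by (auto simp: Knew_def)
      moreover have "Div b \<in> range (R(k := Div (Suc j)))" using True by (auto intro: range_eqI[of _ _ k])
      ultimately show ?thesis by blast
    next
      case False
      then obtain \<phi> S where S: "(\<phi>, S) \<in> K" "Div b \<in> range S" using label_exists[of b] b by auto
      show ?thesis
      proof (cases "Q \<in> range \<phi>")
        case True
        then have "S = R" using through_Q S by blast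
        then obtain l where l: "R l = Div b" using S by (auto simp: image_iff)
        \<comment> \<open>In dimension at least 2 a ray other than \<open>Div b\<close> can be
          exchanged, so this divisor still occurs in one of the new charts.\<close>
        have "card {l} < CARD('d)" using card by simp
        then obtain m where "m \<noteq> l" by (metis UNIV_eq_I insertCI less_irrefl)
        then have "(R(m := Div (Suc j))) l = Div b" using l by simp
        then have "Div b \<in> range (R(m := Div (Suc j)))" by (metis rangeI)
        moreover have "(\<beta> m, R(m := Div (Suc j))) \<in> Knew" by (auto simp: Knew_def)
        ultimately show ?thesis by blast
      next
        case False
        then have "(\<phi>, S) \<in> Kold" using S by (simp add: Kold_def)
        with S show ?thesis by blast
      qed
    qed
  qed
  then show ?thesis by blast
qed

end

lemma toric_atlas_level:
  fixes C :: "('d::finite) pt list"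
  assumes card: "2 \<le> CARD('d)" and C: "toric_constellation C" and j: "j \<le> length C"
  shows "\<exists>K N D. toric_atlas j (level C j) K N D"
  using j
proof (induction j)
  case 0
  show ?case using toric_atlas_affine_space by auto
next
  case (Suc j)
  then obtain K N D where "toric_atlas j (level C j) K N D" by auto
  then interpret toric_atlas j "level C j" K N D .
  have Q: "C ! j \<in> points (level C j)" "act (level C j) t (C ! j) = C ! j" if "t \<in> torus" for t
  proof -
    have "C ! j \<in> points (level C j) \<and> act (level C j) t (C ! j) = C ! j"
    proof (cases "j = 0")
      case True
      then show ?thesis using C by (auto simp: toric_constellation_def affine_space_def vec_eq_iff)
    next
      case False
      then have *: "C ! j \<in> points (level C j)" "(\<lambda>t. act (level C j) t (C ! j)) ` torus = {C ! j}"
        using C Suc.prems by (auto simp: toric_constellation_def)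
      have "act (level C j) t (C ! j) \<in> (\<lambda>t. act (level C j) t (C ! j)) ` torus" using that by blast
      with * show ?thesis by simp
    qed
    then show "C ! j \<in> points (level C j)" "act (level C j) t (C ! j) = C ! j" by auto
  qed
  have "(\<chi> l. 1) \<in> (torus :: (complex^'d) set)" by (simp add: torus_def)
  with toric_atlas_blow_up[OF card Q(1) Q(2)] show ?case by auto
qed

section \<open>Monomial valuations\<close>

text \<open>A small constant is added to all coordinates outside \<open>Z\<close>. With
  \<open>Z\<close> a single index this reaches the generic points of a divisor, with
  \<open>Z\<close> empty the points off the exceptional locus.\<close>

lemma perturb_coordinates:
  fixes y :: "complex^'d::finite"
  assumes "open V" "y \<in> V"
  obtains y' where "y' \<in> V" "\<And>m. m \<in> Z \<Longrightarrow> y' $ m = y $ m" "\<And>m. m \<notin> Z \<Longrightarrow> y' $ m \<noteq> 0"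
proof -
  let ?f = "\<lambda>\<epsilon>. \<chi> m. if m \<in> Z then y $ m else y $ m + \<epsilon>"
  have "((\<lambda>\<epsilon>. if m \<in> Z then y $ m else y $ m + \<epsilon>) \<longlongrightarrow> y $ m) (at 0)" for m
  proof (cases "m \<in> Z")
    case False
    have "((\<lambda>\<epsilon>. y $ m + \<epsilon>) \<longlongrightarrow> y $ m + 0) (at 0)" by (intro tendsto_intros)
    with False show ?thesis by simp
  qed simp
  then have "(?f \<longlongrightarrow> (\<chi> m. y $ m)) (at 0)" by (rule tendsto_vec_lambda)
  then have "(?f \<longlongrightarrow> y) (at 0)" by (simp add: vec_lambda_eta)
  then have "\<forall>\<^sub>F \<epsilon> in at 0. ?f \<epsilon> \<in> V" using assms by (rule topological_tendstoD)
  moreover have "\<forall>\<^sub>F \<epsilon> in at 0. \<forall>m\<in>UNIV. \<epsilon> \<noteq> - (y $ m)"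
    by (rule eventually_ball_finite) (auto intro: eventually_neq_at_within)
  ultimately have "\<forall>\<^sub>F \<epsilon> in at 0. ?f \<epsilon> \<in> V \<and> (\<forall>m\<in>UNIV. \<epsilon> \<noteq> - (y $ m))" by (rule eventually_conj)
  then obtain \<epsilon> where \<epsilon>: "?f \<epsilon> \<in> V" "\<And>m. \<epsilon> \<noteq> - (y $ m)"
    using eventually_happens'[OF at_neq_bot] by blast
  show thesis
  proof (rule that[OF \<epsilon>(1)])
    show "?f \<epsilon> $ m \<noteq> 0" if "m \<notin> Z" for m
      using \<epsilon>(2)[of m] that by (simp add: eq_neg_iff_add_eq_0 add.commute)
  qed simp
qed

lemma converges_finite_support:
  assumes "finite {a. g a \<noteq> 0}" "\<rho> > 0"
  shows "converges_at_radius \<rho> g"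
  unfolding converges_at_radius_def
proof
  have "(\<lambda>a. norm (g a) * \<rho> ^ (\<Sum>i\<in>UNIV. a i)) summable_on {a. g a \<noteq> 0}"
    using assms(1) by (rule summable_on_finite)
  then show "(\<lambda>a. norm (g a) * \<rho> ^ (\<Sum>i\<in>UNIV. a i)) summable_on UNIV"
    by (rule summable_on_cong_neutral[THEN iffD1, rotated -1]) auto
qed fact

lemma converges_dominated:
  assumes "converges_at_radius \<rho> g" "\<And>a. norm (f a) \<le> norm (g a)"
  shows "converges_at_radius \<rho> f"
  unfolding converges_at_radius_def
proof
  show "\<rho> > 0" using assms(1) by (simp add: converges_at_radius_def)
  show "(\<lambda>a. norm (f a) * \<rho> ^ (\<Sum>i\<in>UNIV. a i)) summable_on UNIV"
    by (rule summable_on_comparison_test[of "\<lambda>a. norm (g a) * \<rho> ^ (\<Sum>i\<in>UNIV. a i)"])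
      (use assms in \<open>auto simp: converges_at_radius_def intro: mult_right_mono\<close>)
qed

lemma local_ring_scale: "g \<in> local_ring \<Longrightarrow> (\<lambda>a. c * g a) \<in> local_ring"
  unfolding local_ring_iff converges_at_radius_def
  by (auto simp: norm_mult mult.assoc intro!: summable_on_cmult_right)

lemma local_ring_add:
  assumes "f \<in> local_ring" "g \<in> local_ring"
  shows "(\<lambda>a. f a + g a) \<in> local_ring"
proof -
  obtain \<rho> \<sigma> where r: "converges_at_radius \<rho> f" "converges_at_radius \<sigma> g"
    using assms by (auto simp: local_ring_iff)
  have pos: "0 < \<rho>" "0 < \<sigma>" using r by (auto simp: converges_at_radius_def)
  have small: "(\<lambda>a. norm (h a) * (min \<rho> \<sigma>) ^ (\<Sum>i\<in>UNIV. a i)) summable_on UNIV"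
    if "converges_at_radius \<tau> h" "min \<rho> \<sigma> \<le> \<tau>" for \<tau> h
    by (rule summable_on_comparison_test[of "\<lambda>a. norm (h a) * \<tau> ^ (\<Sum>i\<in>UNIV. a i)"])
      (use that pos in \<open>auto simp: converges_at_radius_def intro!: mult_left_mono power_mono\<close>)
  have "(\<lambda>a. norm (f a) * (min \<rho> \<sigma>) ^ (\<Sum>i\<in>UNIV. a i) + norm (g a) * (min \<rho> \<sigma>) ^ (\<Sum>i\<in>UNIV. a i)) summable_on UNIV"
    by (rule summable_on_add[OF small[OF r(1)] small[OF r(2)]]) auto
  then have "(\<lambda>a. norm (f a + g a) * (min \<rho> \<sigma>) ^ (\<Sum>i\<in>UNIV. a i)) summable_on UNIV"
    by (rule summable_on_comparison_test)
      (use pos in \<open>auto simp: distrib_right[symmetric] intro!: mult_right_mono norm_triangle_ineq\<close>)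
  then show ?thesis using pos unfolding local_ring_def by (auto intro!: exI[of _ "min \<rho> \<sigma>"])
qed

locale constellation = toric_atlas "length C" "sky C" K N D
  for C :: "('d::finite) pt list" and K N D +
  assumes card_ge_2: "2 \<le> CARD('d)" and nonempty: "C \<noteq> []"
begin

text \<open>\<open>N b\<close> is the sum of the rays of the cone that was subdivided; these are
  independent, so no coordinate is 0 on all of them.\<close>

lemma N_pos: "b \<in> indices C \<Longrightarrow> 1 \<le> N b k"
proof -
  assume "b \<in> indices C"
  then obtain R where R: "N b = (\<lambda>k. \<Sum>l\<in>UNIV. ray_vec N (R l) k)" "nondegenerate (\<lambda>l. ray_vec N (R l))"
    using history[of b] by auto
  obtain l where l: "ray_vec N (R l) k \<noteq> 0" using nondegenerate_column[OF R(2)] by blast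
  have "ray_vec N (R l) k \<le> N b k" unfolding R(1) by (rule member_le_sum) auto
  with l show ?thesis by simp
qed

lemma chart_in_points: "(\<psi>, R) \<in> K \<Longrightarrow> \<psi> y \<in> points (sky C)"
  unfolding points by (rule UN_I[of "(\<psi>, R)"]) auto

lemma label_unique: "(\<psi>, R) \<in> K \<Longrightarrow> R l = Div b \<Longrightarrow> R k = Div b \<longleftrightarrow> k = l"
  using injD[OF inj_rays, of \<psi> R k l] by auto

lemma topspace_sky: "topspace (manifold_topology (sky C)) = points (sky C)"
proof
  show "topspace (manifold_topology (sky C)) \<subseteq> points (sky C)"
    using openin_manifold_topology openin_topspace by blast
  have "\<psi> -` points (sky C) = UNIV" if "\<psi> \<in> atlas (sky C)" for \<psi>
    using that chart_in_points unfolding atlas by force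
  then have "openin (manifold_topology (sky C)) (points (sky C))"
    unfolding openin_manifold_topology by auto
  then show "points (sky C) \<subseteq> topspace (manifold_topology (sky C))" by (rule openin_subset)
qed

text \<open>In each chart \<open>D b\<close> is a hyperplane or empty, hence closed. Its points with
  no other zero coordinate have the form \<open>Exc b L\<close> by \<open>generic\<close>, and they
  are dense in it.\<close>

lemma exc_div_eq: "exc_div C b = D b"
proof
  let ?S = "{p \<in> points (sky C). \<exists>l. p = Exc b l}"
  let ?T = "manifold_topology (sky C)"
  have "openin ?T (points (sky C) - D b)"
    unfolding openin_manifold_topology
  proof (intro conjI ballI)
    fix \<psi> assume "\<psi> \<in> atlas (sky C)"
    then obtain R where K: "(\<psi>, R) \<in> K" unfolding atlas by auto
    have "\<psi> -` (points (sky C) - D b) = (\<Inter>l\<in>{l. R l = Div b}. {y. y $ l \<noteq> 0})"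
      using chart_in_points[OF K] divisor[OF K] by auto
    moreover have "open {y :: complex^'d. y $ l \<noteq> 0}" for l
      by (intro open_Collect_neq continuous_intros)
    ultimately show "open (\<psi> -` (points (sky C) - D b))" by (auto intro: open_INT)
  qed auto
  then have "closedin ?T (D b)"
    unfolding closedin_def topspace_sky using divisor_points by auto
  then show "exc_div C b \<subseteq> D b"
    unfolding exc_div_def by (rule closure_of_minimal[rotated]) (use exceptional in auto)
  show "D b \<subseteq> exc_div C b"
  proof
    fix p assume p: "p \<in> D b"
    then have pp: "p \<in> points (sky C)" using divisor_points by blast
    then obtain \<psi> R y where K: "(\<psi>, R) \<in> K" and y: "p = \<psi> y" using points by auto
    then obtain l where l: "R l = Div b" "y $ l = 0" using p divisor by blast
    show "p \<in> exc_div C b"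
      unfolding exc_div_def in_closure_of topspace_sky
    proof (intro conjI allI impI pp, elim conjE)
      fix T assume T: "p \<in> T" "openin ?T T"
      then have "open (\<psi> -` T)" using K atlas by (force simp: openin_manifold_topology)
      moreover have "y \<in> \<psi> -` T" using T y by simp
      ultimately obtain y' where y': "y' \<in> \<psi> -` T" "y' $ l = y $ l" "\<And>m. m \<noteq> l \<Longrightarrow> y' $ m \<noteq> 0"
        using perturb_coordinates[of "\<psi> -` T" y "{l}"] by (metis singletonD singletonI)
      obtain L where "\<psi> y' = Exc b L" using generic[OF K l(1), of y'] y' l by auto
      moreover have "\<psi> y' \<in> points (sky C)" by (rule chart_in_points[OF K])
      ultimately show "\<exists>q. q \<in> ?S \<and> q \<in> T" using y'(1) by auto
    qed
  qed
qed

lemma exc_locus_iff: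
  assumes K: "(\<psi>, R) \<in> K"
  shows "\<psi> y \<in> exc_locus C \<longleftrightarrow> (\<exists>l b. R l = Div b \<and> y $ l = 0)"
  unfolding exc_locus_def exc_div_eq using divisor[OF K] labels[OF K] by fastforce

lemma exc_locus_points: "exc_locus C \<subseteq> points (sky C)"
  unfolding exc_locus_def exc_div_eq using divisor_points by auto

abbreviation rows :: "('d \<Rightarrow> 'd ray) \<Rightarrow> 'd \<Rightarrow> 'd \<Rightarrow> nat" where
  "rows R \<equiv> \<lambda>l. ray_vec N (R l)"

lemma rows_pos: "(\<psi>, R) \<in> K \<Longrightarrow> R l = Div b \<Longrightarrow> 1 \<le> rows R l k"
  using labels N_pos[of b k] by auto

lemma monomial_map_exc:
  assumes K: "(\<psi>, R) \<in> K" and l: "R l = Div b" "y $ l = 0"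
  shows "monomial_map (rows R) y = 0"
  unfolding vec_eq_iff
proof
  fix k
  have "y $ l ^ rows R l k = 0" using rows_pos[OF K l(1), of k] l(2) by (simp add: zero_power)
  then have "(\<Prod>l\<in>UNIV. y $ l ^ rows R l k) = 0" by (intro prod_zero) auto
  then show "monomial_map (rows R) y $ k = 0 $ k" by (simp add: monomial_map_def)
qed

lemma loc_eq_chart:
  assumes K: "(\<psi>, R) \<in> K"
  shows "loc_eq \<psi> (D b) y = (\<Prod>k | R k = Div b. y $ k)"
proof -
  have "{k. \<psi> -` D b = {y. y $ k = 0}} = {k. R k = Div b}"
  proof (intro equalityI subsetI)
    fix k assume "k \<in> {k. \<psi> -` D b = {y. y $ k = 0}}"
    \<comment> \<open>The point whose only zero coordinate is the k-th shows to which divisor this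
      hyperplane belongs.\<close>
    moreover have "(\<chi> i. if i = k then 0 else 1) \<in> {y :: complex^'d. y $ k = 0}" by simp
    ultimately have "\<psi> (\<chi> i. if i = k then 0 else 1) \<in> D b" by blast
    then show "k \<in> {k. R k = Div b}" unfolding divisor[OF K] by (auto split: if_splits)
  next
    fix k assume "k \<in> {k. R k = Div b}"
    then have "\<psi> y \<in> D b \<longleftrightarrow> y $ k = 0" for y
      unfolding divisor[OF K] using label_unique[OF K, of k b] by auto
    then show "k \<in> {k. \<psi> -` D b = {y. y $ k = 0}}" by auto
  qed
  then show ?thesis by (simp add: loc_eq_def)
qed

lemma pullback_chart: "(\<psi>, R) \<in> K \<Longrightarrow> pullback C g (\<psi> y) = germ_eval g (monomial_map (rows R) y)"
  by (simp add: pullback_def down_chart)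

lemma zero_in_polydisc: "converges_at_radius \<rho> g \<Longrightarrow> 0 \<in> polydisc \<rho>"
  by (simp add: converges_at_radius_def polydisc_def)

lemma vanishes_along_if:
  assumes g: "g \<in> local_ring" and b: "b \<in> indices C" and m: "\<And>a. g a \<noteq> 0 \<Longrightarrow> m \<le> dot (N b) a"
  shows "vanishes_along C b g m"
  unfolding vanishes_along_def exc_div_eq
proof
  fix \<psi> assume "\<psi> \<in> atlas (sky C)"
  then obtain R where K: "(\<psi>, R) \<in> K" unfolding atlas by auto
  show "\<exists>U h. holomorphic_sev h U \<and> \<psi> -` D b \<subseteq> U \<and>
      (\<forall>y\<in>U. pullback C g (\<psi> y) = loc_eq \<psi> (D b) y ^ m * h y)"
  proof (cases "\<exists>l. R l = Div b")
    case False
    then have "\<psi> -` D b = {}" using divisor[OF K] by auto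
    then show ?thesis by (intro exI[of _ "{}"]) (simp add: holomorphic_sev_def)
  next
    case True
    then obtain l0 where l0: "R l0 = Div b" by blast
    obtain \<rho> where \<rho>: "converges_at_radius \<rho> g" using g local_ring_iff by blast
    \<comment> \<open>Only the equation of the b-th divisor is divided out, although the pull-back
      also vanishes along other hyperplanes of the chart.\<close>
    let ?w = "\<lambda>l. if l = l0 then m else 0"
    obtain F where F: "holomorphic_sev F {y. monomial_map (rows R) y \<in> polydisc \<rho>}"
      "\<And>y. monomial_map (rows R) y \<in> polydisc \<rho> \<Longrightarrow>
        germ_eval g (monomial_map (rows R) y) = (\<Prod>l\<in>UNIV. y $ l ^ ?w l) * F y"
    proof (rule germ_eval_quotient[OF \<rho>, of ?w "rows R" m])
      show "1 \<le> rows R l k" if "0 < ?w l" for l k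
        using that rows_pos[OF K] l0 by (auto split: if_splits)
      show "?w l \<le> dot (rows R l) a" if "g a \<noteq> 0" for a l using m[OF that] l0 by simp
    qed auto
    have lk: "{k. R k = Div b} = {l0}" using label_unique[OF K l0] by auto
    have w: "(\<Prod>l\<in>UNIV. y $ l ^ ?w l) = y $ l0 ^ m" for y :: "complex^'d"
      by (simp add: prod.remove[of UNIV l0])
    show ?thesis
    proof (intro exI conjI ballI)
      show "holomorphic_sev F {y. monomial_map (rows R) y \<in> polydisc \<rho>}" by (rule F)
      show "\<psi> -` D b \<subseteq> {y. monomial_map (rows R) y \<in> polydisc \<rho>}"
        using divisor[OF K] monomial_map_exc[OF K] zero_in_polydisc[OF \<rho>] by auto
      show "pullback C g (\<psi> y) = loc_eq \<psi> (D b) y ^ m * F y"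
        if "y \<in> {y. monomial_map (rows R) y \<in> polydisc \<rho>}" for y
        using that unfolding pullback_chart[OF K] loc_eq_chart[OF K] lk by (simp add: F(2) w)
    qed
  qed
qed

text \<open>The terms of weight at least \<open>m\<close> form a series \<open>q\<close> that is
  divisible by the m-th power of the local equation. So the polynomial of the remaining terms is
  divisible near the divisor too. Its degree in the transverse coordinate is less than
  \<open>m\<close>; hence it vanishes, and with it all its coefficients.\<close>

lemma vanishes_along_only_if:
  assumes g: "g \<in> local_ring" and b: "b \<in> indices C" and v: "vanishes_along C b g m" and a: "g a \<noteq> 0"
  shows "m \<le> dot (N b) a"
proof -
  obtain \<rho> where \<rho>: "converges_at_radius \<rho> g" using g local_ring_iff by blast
  obtain \<psi> R l0 where K: "(\<psi>, R) \<in> K" and l0: "R l0 = Div b" using label_exists[of b] b by force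
  have lk: "{k. R k = Div b} = {l0}" using label_unique[OF K l0] by auto
  have "\<psi> \<in> atlas (sky C)" using K atlas by force
  then obtain U h where h: "holomorphic_sev h U" and U: "\<psi> -` D b \<subseteq> U"
    and eq: "\<And>y. y \<in> U \<Longrightarrow> pullback C g (\<psi> y) = loc_eq \<psi> (D b) y ^ m * h y"
    using v unfolding vanishes_along_def exc_div_eq by metis
  define P where "P = {a. dot (N b) a < m}"
  have finP: "finite P" unfolding P_def
    by (rule finite_subset[OF _ finite_dot_le[of "N b" m]]) (auto intro: N_pos[OF b, unfolded One_nat_def] simp: Suc_leI N_pos[OF b])
  define q where "q a = (if a \<in> P then 0 else g a)" for a
  have q: "converges_at_radius \<rho> q"
    by (rule converges_dominated[OF \<rho>]) (simp add: q_def)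
  let ?w = "\<lambda>l. if l = l0 then m else 0"
  obtain F where F: "holomorphic_sev F {y. monomial_map (rows R) y \<in> polydisc \<rho>}"
    "\<And>y. monomial_map (rows R) y \<in> polydisc \<rho> \<Longrightarrow>
      germ_eval q (monomial_map (rows R) y) = (\<Prod>l\<in>UNIV. y $ l ^ ?w l) * F y"
  proof (rule germ_eval_quotient[OF q, of ?w "rows R" m])
    show "1 \<le> rows R l k" if "0 < ?w l" for l k
      using that rows_pos[OF K] l0 by (auto split: if_splits)
    show "?w l \<le> dot (rows R l) a" if "q a \<noteq> 0" for a l
      using that l0 by (auto simp: q_def P_def split: if_splits)
  qed auto
  let ?V = "{y. monomial_map (rows R) y \<in> polydisc \<rho>}"
  have w: "(\<Prod>l\<in>UNIV. y $ l ^ ?w l) = y $ l0 ^ m" for y :: "complex^'d"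
    by (simp add: prod.remove[of UNIV l0])
  have split: "germ_eval g x = (\<Sum>a\<in>P. g a * monomial_at x a) + germ_eval q x" if x: "x \<in> polydisc \<rho>" for x
  proof -
    have xr: "norm (x $ k) \<le> \<rho>" for k using x by (auto simp: polydisc_def intro: less_imp_le)
    let ?p = "\<lambda>a. if a \<in> P then g a * monomial_at x a else 0"
    have sp: "?p summable_on UNIV"
      by (rule summable_on_cong_neutral[THEN iffD1, OF _ _ _ summable_on_finite[OF finP, of ?p]]) auto
    have "germ_eval g x = infsum (\<lambda>a. ?p a + q a * monomial_at x a) UNIV"
      unfolding germ_eval_eq by (rule infsum_cong) (simp add: q_def)
    also have "\<dots> = infsum ?p UNIV + germ_eval q x"
      unfolding germ_eval_eq by (rule infsum_add[OF sp germ_summable[OF q xr]])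
    also have "infsum ?p UNIV = infsum (\<lambda>a. g a * monomial_at x a) P"
      by (rule infsum_cong_neutral) auto
    finally show ?thesis using finP by simp
  qed
  have zero: "(\<Sum>a\<in>P. g a * (\<Prod>l\<in>UNIV. y $ l ^ dot (rows R l) a)) = 0" for y :: "complex^'d"
  proof -
    \<comment> \<open>The curve moves only in the direction transverse to the divisor and meets it
      at \<open>z = 0\<close>.\<close>
    let ?Y = "\<lambda>z. \<chi> l. if l = l0 then z else y $ l"
    let ?c = "\<lambda>a. g a * (\<Prod>l\<in>UNIV - {l0}. y $ l ^ dot (rows R l) a)"
    have mon: "g a * (\<Prod>l\<in>UNIV. ?Y z $ l ^ dot (rows R l) a) = ?c a * z ^ dot (N b) a" for a z
      by (simp add: prod.remove[of UNIV l0] l0)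
    have "((\<lambda>z. if l = l0 then z else y $ l) \<longlongrightarrow> (if l = l0 then 0 else y $ l)) (at 0)" for l
      by (cases "l = l0") auto
    then have lim: "(?Y \<longlongrightarrow> ?Y 0) (at 0)" by (rule tendsto_vec_lambda)
    have in0: "?Y 0 \<in> U \<inter> ?V"
    proof
      have "\<psi> (?Y 0) \<in> D b" unfolding divisor[OF K] using l0 by (intro exI[of _ l0]) simp
      then show "?Y 0 \<in> U" using U by blast
      show "?Y 0 \<in> ?V" using monomial_map_exc[OF K l0, of "?Y 0"] zero_in_polydisc[OF \<rho>] by simp
    qed
    have opn: "open (U \<inter> ?V)"
      using h by (intro open_Int open_monomial_map_polydisc) (simp add: holomorphic_sev_def)
    have cont: "isCont (\<lambda>y. h y - F y) (?Y 0)"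
    proof (rule continuous_on_interior[of "U \<inter> ?V"])
      show "continuous_on (U \<inter> ?V) (\<lambda>y. h y - F y)"
        by (intro continuous_on_diff continuous_on_subset[OF holomorphic_sev_imp_continuous_on[OF h]]
            continuous_on_subset[OF holomorphic_sev_imp_continuous_on[OF F(1)]]) auto
      show "?Y 0 \<in> interior (U \<inter> ?V)" unfolding interior_open[OF opn] by (rule in0)
    qed
    have "(\<Sum>a\<in>P. ?c a * (y $ l0) ^ dot (N b) a) = 0"
    proof (rule sum_powers_vanish[OF finP])
      show "dot (N b) a < m" if "a \<in> P" for a using that by (simp add: P_def)
      show "((\<lambda>z. h (?Y z) - F (?Y z)) \<longlongrightarrow> h (?Y 0) - F (?Y 0)) (at 0)"
        using isCont_tendsto_compose[OF cont lim] .
      show "\<forall>\<^sub>F z in at 0. (\<Sum>a\<in>P. ?c a * z ^ dot (N b) a) = z ^ m * (h (?Y z) - F (?Y z))"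
        using topological_tendstoD[OF lim opn in0]
      proof eventually_elim
        case (elim z)
        have "(\<Sum>a\<in>P. g a * monomial_at (monomial_map (rows R) (?Y z)) a) + z ^ m * F (?Y z)
            = germ_eval g (monomial_map (rows R) (?Y z))"
          using elim split[of "monomial_map (rows R) (?Y z)"] F(2)[of "?Y z"] w[of "?Y z"] by simp
        also have "\<dots> = z ^ m * h (?Y z)"
          using elim eq[of "?Y z"] unfolding pullback_chart[OF K] loc_eq_chart[OF K] lk by simp
        finally show ?case unfolding monomial_at_monomial_map mon by (simp add: algebra_simps)
      qed
    qed
    moreover have Y: "?Y (y $ l0) = y" by (simp add: vec_eq_iff)
    have "g a * (\<Prod>l\<in>UNIV. y $ l ^ dot (rows R l) a) = ?c a * (y $ l0) ^ dot (N b) a" for a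
      using mon[of a "y $ l0"] unfolding Y .
    ultimately show ?thesis by (simp only:)
  qed
  show ?thesis
  proof (rule ccontr)
    assume "\<not> m \<le> dot (N b) a"
    then have aP: "a \<in> P" by (simp add: P_def)
    have "g a = 0"
    proof (rule monomials_independent[OF finP _ aP zero])
      show "inj_on (\<lambda>a l. dot (rows R l) a) P"
        using nondegenerate_dot_inj[OF nondeg[OF K]] by (auto simp: inj_on_def fun_eq_iff)
    qed
    with a show False by simp
  qed
qed

section \<open>Valuations of series, the matrix and the Poincare series\<close>

lemma valuation_ge_iff:
  assumes "g \<in> local_ring" "b \<in> indices C"
  shows "enat n \<le> valuation C b g \<longleftrightarrow> (\<forall>a. g a \<noteq> 0 \<longrightarrow> n \<le> dot (N b) a)"
proof
  assume n: "enat n \<le> valuation C b g"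
  show "\<forall>a. g a \<noteq> 0 \<longrightarrow> n \<le> dot (N b) a"
  proof (intro allI impI)
    fix a assume a: "g a \<noteq> 0"
    have "valuation C b g \<le> enat (dot (N b) a)"
      unfolding valuation_def
      by (rule Sup_least) (use vanishes_along_only_if[OF assms] a in auto)
    with n show "n \<le> dot (N b) a" using order_trans by fastforce
  qed
next
  assume "\<forall>a. g a \<noteq> 0 \<longrightarrow> n \<le> dot (N b) a"
  then have "vanishes_along C b g n" by (intro vanishes_along_if assms) auto
  then show "enat n \<le> valuation C b g" unfolding valuation_def by (intro Sup_upper) auto
qed

lemma valuation_eq_iff:
  assumes "g \<in> local_ring" "b \<in> indices C"
  shows "valuation C b g = enat n \<longleftrightarrow>
    (\<forall>a. g a \<noteq> 0 \<longrightarrow> n \<le> dot (N b) a) \<and> (\<exists>a. g a \<noteq> 0 \<and> dot (N b) a = n)"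
proof -
  have "valuation C b g = enat n \<longleftrightarrow> enat n \<le> valuation C b g \<and> \<not> enat (Suc n) \<le> valuation C b g"
    by (cases "valuation C b g") auto
  also have "\<dots> \<longleftrightarrow> (\<forall>a. g a \<noteq> 0 \<longrightarrow> n \<le> dot (N b) a) \<and> (\<exists>a. g a \<noteq> 0 \<and> dot (N b) a = n)"
    unfolding valuation_ge_iff[OF assms] by (metis Suc_leI le_antisym not_less_eq_eq order_refl)
  finally show ?thesis .
qed

lemma point_fun_local_ring: "point_fun a \<in> local_ring"
proof -
  have "{x. point_fun a x \<noteq> 0} \<subseteq> {a}" by (auto simp: point_fun_def)
  then have "finite {x. point_fun a x \<noteq> 0}" by (rule finite_subset) simp
  then have "converges_at_radius 1 (point_fun a)" by (rule converges_finite_support) simp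
  then show ?thesis unfolding local_ring_iff by blast
qed

lemma coord_fun_eq: "coord_fun k = point_fun (unit_exponent k)"
  by (simp add: coord_fun_def point_fun_def unit_exponent_def fun_eq_iff)

lemma matrix_entry_eq: "b \<in> indices C \<Longrightarrow> matrix_entry C b k = int (N b k)"
proof -
  assume b: "b \<in> indices C"
  have "valuation C b (coord_fun k) = enat (N b k)"
    unfolding coord_fun_eq valuation_eq_iff[OF point_fun_local_ring b]
    by (auto simp: point_fun_def dot_unit_exponent)
  then show ?thesis by (simp add: matrix_entry_def)
qed

definition column :: "'d \<Rightarrow> nat \<Rightarrow> int" where
  "column k = (\<lambda>j. if j \<in> indices C then int (N j k) else 0)"

lemma matrix_columns_eq: "matrix_columns C = range column"
  unfolding matrix_columns_def column_def by (intro image_cong) (auto simp: matrix_entry_eq fun_eq_iff)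

lemma val_ideal_eq:
  "val_ideal C v = {g \<in> local_ring. \<forall>i\<in>indices C. \<forall>a. g a \<noteq> 0 \<longrightarrow> nat (v i) \<le> dot (N i) a}"
  unfolding val_ideal_def using valuation_ge_iff by auto

lemma hilbert_fun_eq:
  "hilbert_fun C v = card {a. (\<forall>i\<in>indices C. nat (v i) \<le> dot (N i) a) \<and>
      \<not> (\<forall>i\<in>indices C. nat (v i + 1) \<le> dot (N i) a)}" (is "_ = card ?S")
  unfolding hilbert_fun_def
proof (rule quot_dim_eq_card)
  have "?S \<subseteq> (\<Union>i\<in>indices C. {a. dot (N i) a \<le> nat (v i)})" by fastforce
  moreover have "finite (\<Union>i\<in>indices C. {a. dot (N i) a \<le> nat (v i)})"
    by (intro finite_UN_I finite_dot_le N_pos) auto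
  ultimately show "finite ?S" by (rule finite_subset)
  show "point_fun a \<in> val_ideal C v" if "a \<in> ?S" for a
    using that point_fun_local_ring unfolding val_ideal_eq by (auto simp: point_fun_def)
  show "complex_functions.subspace (val_ideal C v)"
    unfolding complex_functions.subspace_def
  proof (intro conjI ballI allI)
    have "converges_at_radius 1 (\<lambda>_::'d \<Rightarrow> nat. 0)" by (rule converges_finite_support) auto
    then show "0 \<in> val_ideal C v" unfolding val_ideal_eq local_ring_iff by (auto simp: zero_fun_def)
    show "f + g \<in> val_ideal C v" if "f \<in> val_ideal C v" "g \<in> val_ideal C v" for f g
    proof -
      have "(f + g) = (\<lambda>a. f a + g a)" by (simp add: fun_eq_iff)
      moreover have "f a \<noteq> 0 \<or> g a \<noteq> 0" if "f a + g a \<noteq> 0" for a using that by auto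
      ultimately show ?thesis using that local_ring_add[of f g] unfolding val_ideal_eq by fastforce
    qed
    show "(\<lambda>a. c * g a) \<in> val_ideal C v" if "g \<in> val_ideal C v" for c g
      using that local_ring_scale[of g c] unfolding val_ideal_eq by auto
  qed
  show "f \<in> val_ideal C (\<lambda>i. v i + 1) \<longleftrightarrow> f \<in> val_ideal C v \<and> (\<forall>a\<in>?S. f a = 0)" for f
  proof
    assume f: "f \<in> val_ideal C (\<lambda>i. v i + 1)"
    have le: "nat (v i) \<le> nat (v i + 1)" for i by (rule nat_mono) simp
    show "f \<in> val_ideal C v \<and> (\<forall>a\<in>?S. f a = 0)"
      using f le unfolding val_ideal_eq by (blast intro: order_trans)
  qed (unfold val_ideal_eq, blast)
qed

lemma poincare_series_times_prod:
  "poincare_series C * (\<Prod>k\<in>UNIV. 1 - t_pow (length C) (column k)) = 1"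
proof -
  have r: "length C \<ge> 1" using nonempty by (simp add: Suc_leI)
  have num: "poincare_numerator C v = int (card {a. \<forall>i\<in>indices C. v i = int (dot (N i) a) + 1})
      - int (card {a. \<forall>i\<in>indices C. v i = int (dot (N i) a)})" for v
    unfolding poincare_numerator_def hilbert_fun_eq
    by (rule fold_mult_hilbert[OF N_pos r])
  have "t_pow (length C) (column k) = t_pow (length C) (\<lambda>i. int (N i k))" for k
    unfolding t_pow_def column_def by (rule prod.cong) auto
  then show ?thesis
    unfolding poincare_series_def using nonneg_exponents_numerator[OF N_pos r num] by simp
qed

end

section \<open>Sections over the exceptional locus\<close>

context constellation
begin

text \<open>Sections are functions of a chart and a point, so the labels have to be recovered from
  the chart; they are unique by \<open>centre\<close>.\<close>

definition rays_of :: "(complex^'d \<Rightarrow> 'd pt) \<Rightarrow> 'd \<Rightarrow> 'd ray" where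
  "rays_of \<psi> = (SOME R. (\<psi>, R) \<in> K)"

lemma rays_of_eq: "(\<psi>, R) \<in> K \<Longrightarrow> rays_of \<psi> = R"
proof -
  assume K: "(\<psi>, R) \<in> K"
  then have "(\<psi>, rays_of \<psi>) \<in> K" unfolding rays_of_def by (rule someI[of "\<lambda>R. (\<psi>, R) \<in> K"])
  with centre[OF this K] show ?thesis by blast
qed

lemma chart_of_atlas: "\<psi> \<in> atlas (sky C) \<Longrightarrow> (\<psi>, rays_of \<psi>) \<in> K"
  using rays_of_eq unfolding atlas by force

text \<open>The multiplicity of the hyperplane \<open>y_l = 0\<close> in the divisor with
  coefficients \<open>N b i\<close>: the exponent of \<open>y_l\<close> in the trivialization of the
  line bundle that belongs to the column of \<open>i\<close>.\<close>

definition weight :: "'d \<Rightarrow> ('d \<Rightarrow> 'd ray) \<Rightarrow> 'd \<Rightarrow> nat" where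
  "weight i R l = (case R l of Coord _ \<Rightarrow> 0 | Div b \<Rightarrow> N b i)"

lemma weight_Div [simp]: "R l = Div b \<Longrightarrow> weight i R l = N b i"
  and weight_Coord [simp]: "R l = Coord k \<Longrightarrow> weight i R l = 0"
  by (simp_all add: weight_def)

text \<open>A common bound for all weights. As the entries of \<open>N b\<close> are at least 1, a
  monomial of larger degree exceeds the required value on every component and restricts to 0 on the
  exceptional locus.\<close>

definition top_degree :: "'d \<Rightarrow> nat" where
  "top_degree i = (\<Sum>b\<in>indices C. N b i)"

lemma weight_le_top_degree: "(\<psi>, R) \<in> K \<Longrightarrow> weight i R l \<le> top_degree i"
proof (cases "R l")
  case (Div b)
  assume K: "(\<psi>, R) \<in> K"
  have "N b i \<le> top_degree i"
    unfolding top_degree_def by (rule member_le_sum) (use labels[OF K Div] in auto)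
  with Div show ?thesis by simp
qed simp

text \<open>A finite set containing every exponent that can contribute on the exceptional locus when
  the valuations of a series are at least those of the i-th coordinate.\<close>

definition exponents :: "'d \<Rightarrow> ('d \<Rightarrow> nat) set" where
  "exponents i = {b. (\<Sum>k\<in>UNIV. b k) \<le> top_degree i \<and> (\<forall>j\<in>indices C. N j i \<le> dot (N j) b)}"

lemma finite_exponents: "finite (exponents i)"
  by (rule finite_subset[OF _ finite_exponents_le[of "top_degree i"]]) (auto simp: exponents_def)

lemma weight_le_dot:
  assumes K: "(\<psi>, R) \<in> K" and b: "b \<in> exponents i"
  shows "weight i R l \<le> dot (rows R l) b"
proof (cases "R l")
  case (Div c)
  with labels[OF K Div] b show ?thesis by (auto simp: exponents_def)
qed simp

definition same_column :: "'d \<Rightarrow> 'd set" where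
  "same_column i = {k. column k = column i}"

lemma same_columnD: "k \<in> same_column i \<Longrightarrow> b \<in> indices C \<Longrightarrow> N b k = N b i"
  unfolding same_column_def column_def by (auto dest: fun_cong[of _ _ b])

lemma same_columnI: "(\<And>b. b \<in> indices C \<Longrightarrow> N b k = N b i) \<Longrightarrow> k \<in> same_column i"
  unfolding same_column_def column_def by auto

lemma same_column_self: "i \<in> same_column i"
  by (simp add: same_column_def)

lemma unit_exponent_in_exponents:
  assumes k: "k \<in> same_column i"
  shows "unit_exponent k \<in> exponents i"
proof -
  have one: "1 \<in> indices C" using nonempty by (simp add: Suc_leI)
  have "1 \<le> N 1 i" by (rule N_pos[OF one])
  also have "N 1 i \<le> top_degree i" unfolding top_degree_def by (rule member_le_sum) (use one in auto)
  finally have "(\<Sum>j\<in>UNIV. unit_exponent k j) \<le> top_degree i" by (simp add: unit_exponent_def)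
  then show ?thesis using same_columnD[OF k] by (simp add: exponents_def dot_unit_exponent)
qed

text \<open>Apart from exceptional divisors, the pull-back of the k-th coordinate vanishes only on
  the hyperplane labelled \<open>Coord k\<close>.\<close>

lemma weight_eq_dot_unit_exponent:
  assumes K: "(\<psi>, R) \<in> K" and k: "k \<in> same_column i" and R: "R l \<noteq> Coord k"
  shows "dot (rows R l) (unit_exponent k) = weight i R l"
proof (cases "R l")
  case (Coord k')
  with R have "k \<noteq> k'" by auto
  then show ?thesis
    unfolding Coord ray_vec.simps dot_unit_exponent by (simp add: weight_def Coord unit_exponent_def)
next
  case (Div b)
  then show ?thesis using same_columnD[OF k] labels[OF K Div] by (simp add: dot_unit_exponent)
qed

text \<open>The pull-back of the monomial \<open>x^b\<close> divided by the local equation of the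
  bundle, on the exceptional locus. The natural subtraction is exact for
  \<open>b \<in> exponents i\<close>.\<close>

definition basic_section :: "'d \<Rightarrow> ('d \<Rightarrow> nat) \<Rightarrow> (complex^'d \<Rightarrow> 'd pt) \<times> (complex^'d) \<Rightarrow> complex" where
  "basic_section i b = (\<lambda>(\<psi>, y). if \<psi> \<in> atlas (sky C) \<and> \<psi> y \<in> exc_locus C
     then \<Prod>l\<in>UNIV. y $ l ^ (dot (rows (rays_of \<psi>) l) b - weight i (rays_of \<psi>) l) else 0)"

definition section_of ::
    "'d \<Rightarrow> (('d \<Rightarrow> nat) \<Rightarrow> complex) \<Rightarrow> (complex^'d \<Rightarrow> 'd pt) \<times> (complex^'d) \<Rightarrow> complex" where
  "section_of i c = (\<lambda>x. \<Sum>b\<in>exponents i. c b * basic_section i b x)"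

lemma section_of_outside: "\<not> (\<psi> \<in> atlas (sky C) \<and> \<psi> y \<in> exc_locus C) \<Longrightarrow> section_of i c (\<psi>, y) = 0"
  by (auto simp: section_of_def basic_section_def)

lemma section_of_chart:
  assumes K: "(\<psi>, R) \<in> K" and y: "\<psi> y \<in> exc_locus C"
  shows "section_of i c (\<psi>, y) =
    (\<Sum>b\<in>exponents i. c b * (\<Prod>l\<in>UNIV. y $ l ^ (dot (rows R l) b - weight i R l)))"
proof -
  have "\<psi> \<in> atlas (sky C)" using K atlas by force
  then show ?thesis using y by (simp add: section_of_def basic_section_def rays_of_eq[OF K])
qed

lemma section_of_cong:
  "(\<And>b. b \<in> exponents i \<Longrightarrow> c b = c' b) \<Longrightarrow> section_of i c = section_of i c'"
  unfolding section_of_def by simp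

lemma section_of_linear:
  "section_of i (\<lambda>b. \<alpha> * c b + \<beta> * c' b) = (\<lambda>x. \<alpha> * section_of i c x + \<beta> * section_of i c' x)"
  unfolding section_of_def by (simp add: sum_distrib_left sum.distrib algebra_simps)

lemma prod_loc_eq:
  assumes K: "(\<psi>, R) \<in> K"
  shows "(\<Prod>b\<in>indices C. loc_eq \<psi> (exc_div C b) y powi column i b) = (\<Prod>l\<in>UNIV. y $ l ^ weight i R l)"
proof -
  \<comment> \<open>The value 0 marks coordinate rays, since the labels of divisors start at
    1.\<close>
  define lab where "lab l = (case R l of Coord _ \<Rightarrow> 0 | Div b \<Rightarrow> b)" for l
  have lab: "R l = Div b \<longleftrightarrow> l \<in> {l. lab l \<noteq> 0} \<and> lab l = b" if "b \<in> indices C" for l b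
    using that labels[OF K, of l] by (auto simp: lab_def split: ray.splits)
  have "(\<Prod>b\<in>indices C. loc_eq \<psi> (exc_div C b) y powi column i b)
      = (\<Prod>b\<in>indices C. \<Prod>l | l \<in> {l. lab l \<noteq> 0} \<and> lab l = b. y $ l ^ weight i R l)"
  proof (rule prod.cong[OF refl])
    fix b assume b: "b \<in> indices C"
    have "loc_eq \<psi> (exc_div C b) y powi column i b = (\<Prod>l | R l = Div b. y $ l) ^ N b i"
      using b unfolding exc_div_eq loc_eq_chart[OF K] column_def by simp
    also have "\<dots> = (\<Prod>l | R l = Div b. y $ l ^ weight i R l)"
      unfolding prod_power_distrib by (rule prod.cong) auto
    also have "{l. R l = Div b} = {l. l \<in> {l. lab l \<noteq> 0} \<and> lab l = b}" using lab[OF b] by blast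
    finally show "loc_eq \<psi> (exc_div C b) y powi column i b =
        (\<Prod>l | l \<in> {l. lab l \<noteq> 0} \<and> lab l = b. y $ l ^ weight i R l)" .
  qed
  also have "\<dots> = (\<Prod>l | lab l \<noteq> 0. y $ l ^ weight i R l)"
  proof (rule prod.group)
    show "lab ` {l. lab l \<noteq> 0} \<subseteq> indices C"
      using labels[OF K] by (auto simp: lab_def split: ray.splits)
  qed auto
  also have "\<dots> = (\<Prod>l\<in>UNIV. y $ l ^ weight i R l)"
  proof (rule prod.mono_neutral_left)
    show "\<forall>l\<in>UNIV - {l. lab l \<noteq> 0}. y $ l ^ weight i R l = 1"
    proof
      fix l assume "l \<in> UNIV - {l. lab l \<noteq> 0}"
      then show "y $ l ^ weight i R l = 1"
        using labels[OF K, of l] by (cases "R l") (auto simp: lab_def)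
    qed
  qed auto
  finally show ?thesis .
qed

text \<open>Over the polydisc of convergence, division by the local equations gives the trivializing
  functions; on the exceptional locus the quotient is the finite sum that defines
  \<open>section_of\<close>.\<close>

lemma restricts_to_section_of:
  assumes g: "g \<in> local_ring" and v: "\<And>b a. b \<in> indices C \<Longrightarrow> g a \<noteq> 0 \<Longrightarrow> N b i \<le> dot (N b) a"
  shows "\<exists>U. exc_locus C \<subseteq> U \<and> restricts_to C (column i) U (pullback C g) (section_of i g)"
proof -
  obtain \<rho> where \<rho>: "converges_at_radius \<rho> g" using g local_ring_iff by blast
  let ?U = "{p \<in> points (sky C). down (sky C) p \<in> polydisc \<rho>}"
  have preimage: "\<psi> -` ?U = {y. monomial_map (rows R) y \<in> polydisc \<rho>}" if "(\<psi>, R) \<in> K" for \<psi> R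
    using chart_in_points[OF that] down_chart[OF that] by auto
  have exc: "exc_locus C \<subseteq> ?U"
  proof
    fix p assume p: "p \<in> exc_locus C"
    then have pp: "p \<in> points (sky C)" using exc_locus_points by blast
    then obtain \<psi> R y where K: "(\<psi>, R) \<in> K" "p = \<psi> y" using points by auto
    then obtain l b where "R l = Div b" "y $ l = 0" using exc_locus_iff p by blast
    then have "down (sky C) p = 0" using down_chart monomial_map_exc K by metis
    then show "p \<in> ?U" using pp zero_in_polydisc[OF \<rho>] by simp
  qed
  have "restricts_to C (column i) ?U (pullback C g) (section_of i g)"
    unfolding restricts_to_def
  proof (intro conjI ballI)
    show "openin (manifold_topology (sky C)) ?U"
      unfolding openin_manifold_topology
    proof (intro conjI ballI)
      fix \<psi> assume "\<psi> \<in> atlas (sky C)"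
      from preimage[OF chart_of_atlas[OF this]] show "open (\<psi> -` ?U)"
        using open_monomial_map_polydisc by simp
    qed auto
    fix \<psi> assume "\<psi> \<in> atlas (sky C)"
    then obtain R where K: "(\<psi>, R) \<in> K" using chart_of_atlas by blast
    obtain F where F: "holomorphic_sev F {y. monomial_map (rows R) y \<in> polydisc \<rho>}"
      "\<And>y. monomial_map (rows R) y \<in> polydisc \<rho> \<Longrightarrow>
        germ_eval g (monomial_map (rows R) y) = (\<Prod>l\<in>UNIV. y $ l ^ weight i R l) * F y"
      "\<And>y. monomial_map (rows R) y = 0 \<Longrightarrow> F y = (\<Sum>b | (\<Sum>k\<in>UNIV. b k) \<le> top_degree i.
        g b * (\<Prod>l\<in>UNIV. y $ l ^ (dot (rows R l) b - weight i R l)))"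
    proof (rule germ_eval_quotient[OF \<rho>, of "weight i R" "rows R" "top_degree i"])
      show "1 \<le> rows R l k" if "0 < weight i R l" for l k
        using that rows_pos[OF K, of l _ k] by (cases "R l") auto
      show "weight i R l \<le> top_degree i" for l by (rule weight_le_top_degree[OF K])
      show "weight i R l \<le> dot (rows R l) a" if "g a \<noteq> 0" for a l
        using v[OF _ that] labels[OF K, of l] by (cases "R l") auto
    qed auto
    show "\<exists>F. local_trivialization C (column i) ?U (pullback C g) \<psi> F \<and>
        (\<forall>y\<in>\<psi> -` (?U \<inter> exc_locus C). section_of i g (\<psi>, y) = F y)"
    proof (intro exI conjI ballI)
      show "local_trivialization C (column i) ?U (pullback C g) \<psi> F"
        unfolding local_trivialization_def preimage[OF K] prod_loc_eq[OF K] pullback_chart[OF K]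
        using F(1,2) preimage[OF K] by auto
      fix y assume "y \<in> \<psi> -` (?U \<inter> exc_locus C)"
      then have y: "\<psi> y \<in> exc_locus C" by simp
      then have "monomial_map (rows R) y = 0" using exc_locus_iff[OF K] monomial_map_exc[OF K] by blast
      from F(3)[OF this] have "F y = (\<Sum>b | (\<Sum>k\<in>UNIV. b k) \<le> top_degree i.
        g b * (\<Prod>l\<in>UNIV. y $ l ^ (dot (rows R l) b - weight i R l)))" .
      also have "\<dots> = section_of i g (\<psi>, y)"
        unfolding section_of_chart[OF K y]
      proof (rule sum.mono_neutral_right)
        show "\<forall>b\<in>{b. (\<Sum>k\<in>UNIV. b k) \<le> top_degree i} - exponents i.
            g b * (\<Prod>l\<in>UNIV. y $ l ^ (dot (rows R l) b - weight i R l)) = 0"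
          using v by (fastforce simp: exponents_def)
      qed (auto simp: finite_exponents_le exponents_def)
      finally show "section_of i g (\<psi>, y) = F y" by simp
    qed
  qed
  with exc show ?thesis by blast
qed

text \<open>Off the exceptional locus the local equations are invertible, so \<open>f\<close>
  determines the trivializing function there; these points are dense, and continuity does the
  rest.\<close>

lemma restricts_to_unique:
  assumes s: "restricts_to C v U f s" and t: "restricts_to C v V f t"
    and U: "exc_locus C \<subseteq> U" and V: "exc_locus C \<subseteq> V"
    and \<psi>: "\<psi> \<in> atlas (sky C)" and y: "\<psi> y \<in> exc_locus C" and v: "v = column i"
  shows "s (\<psi>, y) = t (\<psi>, y)"
proof -
  obtain R where K: "(\<psi>, R) \<in> K" using chart_of_atlas[OF \<psi>] by blast
  obtain F where F: "local_trivialization C v U f \<psi> F" "\<And>y. y \<in> \<psi> -` (U \<inter> exc_locus C) \<Longrightarrow> s (\<psi>, y) = F y"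
    using s \<psi> unfolding restricts_to_def by metis
  obtain G where G: "local_trivialization C v V f \<psi> G" "\<And>y. y \<in> \<psi> -` (V \<inter> exc_locus C) \<Longrightarrow> t (\<psi>, y) = G y"
    using t \<psi> unfolding restricts_to_def by metis
  let ?W = "\<psi> -` U \<inter> \<psi> -` V"
  have "open ?W"
    using s t \<psi> by (intro open_Int) (auto simp: restricts_to_def openin_manifold_topology)
  have "continuous_on ?W (\<lambda>z. F z - G z)"
    using F(1) G(1) unfolding local_trivialization_def
    by (intro continuous_on_diff) (meson Int_lower1 Int_lower2 continuous_on_subset holomorphic_sev_imp_continuous_on)+
  then have opn: "open (?W \<inter> (\<lambda>z. F z - G z) -` (- {0}))"
    using \<open>open ?W\<close> by (intro continuous_open_preimage) auto
  have "F y = G y"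
  proof (rule ccontr)
    assume "F y \<noteq> G y"
    then have "y \<in> ?W \<inter> (\<lambda>z. F z - G z) -` (- {0})" using y U V by auto
    then obtain z where z: "z \<in> ?W" "F z \<noteq> G z" "\<And>l. z $ l \<noteq> 0"
      using perturb_coordinates[OF opn, of y "{}"] by auto
    have nz: "\<psi> z \<notin> exc_locus C" using z(3) exc_locus_iff[OF K] by blast
    have "f (\<psi> z) = (\<Prod>l\<in>UNIV. z $ l ^ weight i R l) * F z"
      using F(1) z(1) nz unfolding local_trivialization_def v prod_loc_eq[OF K] by auto
    moreover have "f (\<psi> z) = (\<Prod>l\<in>UNIV. z $ l ^ weight i R l) * G z"
      using G(1) z(1) nz unfolding local_trivialization_def v prod_loc_eq[OF K] by auto
    moreover have "(\<Prod>l\<in>UNIV. z $ l ^ weight i R l) \<noteq> 0" using z(3) by simp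
    ultimately show False using z(2) by simp
  qed
  moreover have "\<psi> y \<in> U" "\<psi> y \<in> V" using y U V by blast+
  ultimately show ?thesis using F(2)[of y] G(2)[of y] y by simp
qed

text \<open>If the valuations of \<open>g\<close> are those of \<open>x\<^sub>i\<close>, follow the linear part of \<open>g\<close> through the
  blowing-ups: if \<open>x\<^sub>k\<close> occurs in \<open>g\<close> and \<open>\<nu>\<^sub>b(x\<^sub>k) > \<nu>\<^sub>b(x\<^sub>i)\<close> for the first time, then \<open>{x\<^sub>i = 0}\<close> does
  not pass through the centre, so that \<open>x\<^sub>i\<close> is the only monomial with the required \<open>\<nu>\<^sub>b\<close>.\<close>

lemma linear_term_of_same_column:
  assumes ge: "\<And>b a. b \<in> indices C \<Longrightarrow> g a \<noteq> 0 \<Longrightarrow> N b i \<le> dot (N b) a"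
    and attained: "\<And>b. b \<in> indices C \<Longrightarrow> \<exists>a. g a \<noteq> 0 \<and> dot (N b) a = N b i"
  shows "\<exists>k\<in>same_column i. g (unit_exponent k) \<noteq> 0"
proof -
  have step: "\<exists>k. g (unit_exponent k) \<noteq> 0 \<and> (\<forall>c\<in>{1..b}. N c k = N c i)"
    if "1 \<le> b" "b \<le> length C" for b
    using that
  proof (induction b rule: nat_induct_at_least)
    \<comment> \<open>The first cone has no exceptional ray, so its rays are all the coordinates:
      \<open>N 1\<close> has all entries 1, and a monomial attaining the value of \<open>x_i\<close>
      has degree 1.\<close>
    case base
    obtain R :: "'d \<Rightarrow> 'd ray" where R: "inj R" "\<And>l c. R l = Div c \<Longrightarrow> 1 \<le> c \<and> c < 1"
      "N 1 = (\<lambda>k. \<Sum>l\<in>UNIV. ray_vec N (R l) k)"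
      using history[OF order_refl[of 1] base] by blast
    have "\<exists>k. R l = Coord k" for l using R(2)[of l] by (cases "R l") auto
    then obtain f where f: "\<And>l. R l = Coord (f l)" by metis
    have "inj f" using R(1) f by (metis inj_def)
    then have bij: "bij f" by (simp add: finite_UNIV_inj_surj bij_def)
    have "N 1 k = 1" for k
    proof -
      have "N 1 k = (\<Sum>l\<in>UNIV. if f l = k then 1 else 0)"
        unfolding R(3) f by (simp add: unit_exponent_def eq_commute)
      also have "\<dots> = (\<Sum>l\<in>UNIV. if l = k then 1 else 0)"
        by (rule sum.reindex_bij_betw[OF bij, of "\<lambda>l. if l = k then 1 else 0 :: nat"])
      finally show ?thesis by simp
    qed
    then have N1: "N 1 = (\<lambda>_. 1)" by auto
    obtain a where a: "g a \<noteq> 0" "dot (N 1) a = N 1 i" using attained[of 1] base by auto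
    then have sum: "(\<Sum>k\<in>UNIV. a k) = 1" unfolding N1 dot_def by simp
    then obtain k where k: "a k \<noteq> 0" by (metis (no_types, lifting) sum.neutral zero_neq_one)
    have "a = unit_exponent k"
    proof
      fix l
      have "a k + (\<Sum>l\<in>UNIV - {k}. a l) = 1" using sum by (simp add: sum.remove[of UNIV k])
      with k have ak: "a k = 1" and "(\<Sum>l\<in>UNIV - {k}. a l) = 0" by linarith+
      then have "\<And>l. l \<noteq> k \<Longrightarrow> a l = 0" by auto
      with ak show "a l = unit_exponent k l" by (simp add: unit_exponent_def)
    qed
    then show ?case using a N1[unfolded One_nat_def] by (intro exI[of _ k]) auto
  next
    case (Suc b)
    then obtain k where k: "g (unit_exponent k) \<noteq> 0" "\<And>c. c \<in> {1..b} \<Longrightarrow> N c k = N c i" by auto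
    have bi: "Suc b \<in> indices C" using Suc by auto
    show ?case
    proof (cases "N (Suc b) k = N (Suc b) i")
      case True
      with k show ?thesis by (intro exI[of _ k]) (auto simp: le_Suc_eq)
    next
      case False
      have gt: "N (Suc b) i < N (Suc b) k"
        using ge[OF bi k(1)] False by (simp add: dot_unit_exponent)
      obtain R :: "'d \<Rightarrow> 'd ray" where R: "inj R" "\<And>l c. R l = Div c \<Longrightarrow> 1 \<le> c \<and> c < Suc b"
        "N (Suc b) = (\<lambda>k. \<Sum>l\<in>UNIV. ray_vec N (R l) k)" "nondegenerate (\<lambda>l. ray_vec N (R l))"
        using history[of "Suc b"] Suc.prems by (metis le_add1 plus_1_eq_Suc)
      \<comment> \<open>Suppose that \<open>Coord i\<close> is a ray. Exceptional rays contribute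
        equally to the values of \<open>x_k\<close> and \<open>x_i\<close> by induction; coordinate
        rays contribute at most 1 to the former and at least 1 to the latter. This contradicts
        \<open>gt\<close>.\<close>
      have noti: "Coord i \<notin> range R"
      proof
        assume "Coord i \<in> range R"
        then obtain l0 where l0: "R l0 = Coord i" by (auto simp: image_iff)
        have "(\<Sum>l\<in>UNIV. ray_vec N (R l) k) \<le> (\<Sum>l\<in>UNIV. ray_vec N (R l) i)"
        proof -
          have split: "(\<Sum>l\<in>UNIV. ray_vec N (R l) h) =
              (\<Sum>l | \<exists>c. R l = Div c. ray_vec N (R l) h) + (\<Sum>l | \<not> (\<exists>c. R l = Div c). ray_vec N (R l) h)" for h
            by (subst sum.union_disjoint[symmetric]) (auto intro: sum.cong)
          have "(\<Sum>l | \<exists>c. R l = Div c. ray_vec N (R l) k) = (\<Sum>l | \<exists>c. R l = Div c. ray_vec N (R l) i)"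
            by (rule sum.cong) (use R(2) k(2) in \<open>auto simp: less_Suc_eq_le\<close>)
          moreover have "(\<Sum>l | \<not> (\<exists>c. R l = Div c). ray_vec N (R l) k) \<le> 1"
          proof -
            have "(\<Sum>l | \<not> (\<exists>c. R l = Div c). ray_vec N (R l) k) = (\<Sum>l | R l = Coord k. 1)"
            proof (rule sum.mono_neutral_cong_right)
              show "\<forall>l\<in>{l. \<not> (\<exists>c. R l = Div c)} - {l. R l = Coord k}. ray_vec N (R l) k = 0"
              proof
                fix l assume "l \<in> {l. \<not> (\<exists>c. R l = Div c)} - {l. R l = Coord k}"
                then show "ray_vec N (R l) k = 0" by (cases "R l") (auto simp: unit_exponent_def)
              qed
            qed (auto simp: unit_exponent_def)
            also have "\<dots> = card {l. R l = Coord k}" by simp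
            also have "\<dots> \<le> 1"
            proof -
              have "l = l'" if "R l = Coord k" "R l' = Coord k" for l l'
                using injD[OF R(1), of l l'] that by simp
              then show ?thesis unfolding One_nat_def by (subst card_le_Suc0_iff_eq) auto
            qed
            finally show ?thesis .
          qed
          moreover have "1 \<le> (\<Sum>l | \<not> (\<exists>c. R l = Div c). ray_vec N (R l) i)"
          proof -
            have "ray_vec N (R l0) i \<le> (\<Sum>l | \<not> (\<exists>c. R l = Div c). ray_vec N (R l) i)"
              by (rule member_le_sum) (use l0 in auto)
            then show ?thesis using l0 by (simp add: unit_exponent_def)
          qed
          ultimately show ?thesis unfolding split[of k] split[of i] by linarith
        qed
        then show False using gt unfolding R(3) by simp
      qed
      \<comment> \<open>The value on the new divisor is the sum of the values along the rays of the
        cone. Along each ray \<open>a\<close> has at least the value of \<open>x_i\<close>, and the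
        sums agree; so all values agree and \<open>a\<close> is the exponent of
        \<open>x_i\<close>.\<close>
      obtain a where a: "g a \<noteq> 0" "dot (N (Suc b)) a = N (Suc b) i" using attained[OF bi] by blast
      have le: "dot (ray_vec N (R l)) (unit_exponent i) \<le> dot (ray_vec N (R l)) a" for l
      proof (cases "R l")
        case (Coord k')
        with noti have "k' \<noteq> i" by (metis rangeI)
        then have "dot (ray_vec N (R l)) (unit_exponent i) = 0"
          unfolding Coord ray_vec.simps dot_unit_exponent by (simp add: unit_exponent_def)
        then show ?thesis by simp
      next
        case (Div c)
        with R(2)[OF Div] Suc have "c \<in> indices C" by auto
        with ge[OF this a(1)] Div show ?thesis by (simp add: dot_unit_exponent)
      qed
      have dsum: "(\<Sum>l\<in>UNIV. dot (ray_vec N (R l)) h) = dot (N (Suc b)) h" for h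
        unfolding R(3) dot_def sum_distrib_right by (rule sum.swap)
      have "dot (ray_vec N (R l)) (unit_exponent i) = dot (ray_vec N (R l)) a" for l
      proof (rule ccontr)
        assume "dot (ray_vec N (R l)) (unit_exponent i) \<noteq> dot (ray_vec N (R l)) a"
        with le[of l] have "dot (ray_vec N (R l)) (unit_exponent i) < dot (ray_vec N (R l)) a" by simp
        then have "(\<Sum>l\<in>UNIV. dot (ray_vec N (R l)) (unit_exponent i)) < (\<Sum>l\<in>UNIV. dot (ray_vec N (R l)) a)"
          using le by (intro sum_strict_mono_ex1) auto
        then have "dot (N (Suc b)) (unit_exponent i) < dot (N (Suc b)) a" by (simp only: dsum)
        then show False using a(2) by (simp add: dot_unit_exponent)
      qed
      then have "unit_exponent i = a" by (rule nondegenerate_dot_inj[OF R(4)])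
      then show ?thesis using a(1) by (intro exI[of _ i]) auto
    qed
  qed
  have "1 \<le> length C" using nonempty by (simp add: Suc_leI)
  from step[OF this] obtain k where "g (unit_exponent k) \<noteq> 0" "\<And>b. b \<in> indices C \<Longrightarrow> N b k = N b i" by auto
  then show ?thesis using same_columnI by blast
qed

section \<open>Admissible sections as those with a linear term\<close>

definition admissible :: "'d \<Rightarrow> (('d \<Rightarrow> nat) \<Rightarrow> complex) \<Rightarrow> bool" where
  "admissible i c \<longleftrightarrow> (\<exists>k\<in>same_column i. c (unit_exponent k) \<noteq> 0)"

lemma chart_without_coordinate:
  assumes K: "(\<psi>, R) \<in> K" and ab: "a \<noteq> b" "Div a \<in> range R" "Div b \<in> range R"
  shows "\<exists>\<psi>' R'. (\<psi>', R') \<in> K \<and> Div a \<in> range R' \<and> Div b \<in> range R' \<and> Coord k \<notin> range R'"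
proof (cases "3 \<le> CARD('d)")
  case True
  then show ?thesis using avoid_coord[OF _ K ab] by blast
next
  case False
  \<comment> \<open>In dimension 2 the two exceptional rays already make up the whole cone.\<close>
  then have "card (range R) = 2" using card_ge_2 card_image[OF inj_rays[OF K]] by simp
  moreover have "card {Div a, Div b :: 'd ray} = 2" using ab(1) by simp
  ultimately have "range R = {Div a, Div b}"
    using ab(2,3) card_subset_eq[of "range R" "{Div a, Div b}"] by simp
  then have "Coord k \<notin> range R" by simp
  with K ab show ?thesis by blast
qed

text \<open>At the centre of a chart a monomial survives only if all its reduced exponents are 0;
  independence of the rays leaves the k-th coordinate alone.\<close>

lemma section_of_at_centre:
  assumes K: "(\<psi>, R) \<in> K" and k: "k \<in> same_column i" and R: "Coord k \<notin> range R" and e: "\<psi> 0 \<in> exc_locus C"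
  shows "section_of i c (\<psi>, 0) = c (unit_exponent k)"
proof -
  let ?t = "\<lambda>b. c b * (\<Prod>l\<in>UNIV. (0 :: complex^'d) $ l ^ (dot (rows R l) b - weight i R l))"
  have Rk: "R l \<noteq> Coord k" for l using R by (metis rangeI)
  note w = weight_eq_dot_unit_exponent[OF K k Rk]
  have "?t b = 0" if b: "b \<in> exponents i - {unit_exponent k}" for b
  proof -
    have "\<exists>l. dot (rows R l) b \<noteq> dot (rows R l) (unit_exponent k)"
      using nondegenerate_dot_inj[OF nondeg[OF K], of b "unit_exponent k"] b by auto
    then obtain l where "dot (rows R l) b \<noteq> weight i R l" using w by auto
    then have "dot (rows R l) b - weight i R l > 0" using weight_le_dot[OF K, of b i l] b by auto
    then have "(0 :: complex^'d) $ l ^ (dot (rows R l) b - weight i R l) = 0" by simp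
    then have "(\<Prod>l\<in>UNIV. (0 :: complex^'d) $ l ^ (dot (rows R l) b - weight i R l)) = 0"
      by (intro prod_zero) auto
    then show ?thesis by simp
  qed
  then have "section_of i c (\<psi>, 0) = (\<Sum>b\<in>{unit_exponent k}. ?t b)"
    unfolding section_of_chart[OF K e]
    by (intro sum.mono_neutral_right) (auto simp: finite_exponents unit_exponent_in_exponents[OF k])
  then show ?thesis by (simp add: w)
qed

text \<open>A germ with the prescribed valuations has a suitable linear term, and its section is
  determined by its coefficients. Conversely, a polynomial with such a term has the right
  valuations, and its section is nonzero at the centre of a chart that contains both divisors and
  avoids \<open>Coord k\<close>.\<close>

lemma admissible_sections_eq:
  "admissible_sections C (column i) = {section_of i c | c. admissible i c}"
proof (intro equalityI subsetI)
  fix s assume "s \<in> admissible_sections C (column i)"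
  then obtain g U where sG: "s \<in> global_sections C (column i)" and g: "g \<in> local_ring"
    and val: "\<And>j. j \<in> indices C \<Longrightarrow> \<exists>n. valuation C j g = enat n \<and> column i j = int n"
    and U: "exc_locus C \<subseteq> U" "restricts_to C (column i) U (pullback C g) s"
    unfolding admissible_sections_def by blast
  have vj: "valuation C j g = enat (N j i)" if "j \<in> indices C" for j
    using val[OF that] that by (auto simp: column_def)
  have ge: "N b i \<le> dot (N b) a" if "b \<in> indices C" "g a \<noteq> 0" for a b
    using vj[OF that(1)] that unfolding valuation_eq_iff[OF g that(1)] by blast
  have att: "\<exists>a. g a \<noteq> 0 \<and> dot (N b) a = N b i" if "b \<in> indices C" for b
    using vj[OF that] unfolding valuation_eq_iff[OF g that] by blast
  obtain V where V: "exc_locus C \<subseteq> V" "restricts_to C (column i) V (pullback C g) (section_of i g)"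
    using restricts_to_section_of[OF g ge] by blast
  have "s = section_of i g"
  proof
    fix x :: "(complex^'d \<Rightarrow> 'd pt) \<times> (complex^'d)"
    obtain \<psi> y where x: "x = (\<psi>, y)" by (cases x)
    show "s x = section_of i g x"
    proof (cases "\<psi> \<in> atlas (sky C) \<and> \<psi> y \<in> exc_locus C")
      case True
      then show ?thesis unfolding x using restricts_to_unique[OF U(2) V(2) U(1) V(1)] by blast
    next
      case False
      then show ?thesis unfolding x using sG section_of_outside by (auto simp: global_sections_def)
    qed
  qed
  moreover have "admissible i g"
    unfolding admissible_def by (rule linear_term_of_same_column[OF ge att])
  ultimately show "s \<in> {section_of i c | c. admissible i c}" by blast
next
  fix s assume "s \<in> {section_of i c | c. admissible i c}"
  then obtain c k where s: "s = section_of i c" and k: "k \<in> same_column i" "c (unit_exponent k) \<noteq> 0"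
    by (auto simp: admissible_def)
  \<comment> \<open>Cutting \<open>c\<close> off to a finite set of exponents gives a polynomial
    with the required lower bounds on its valuations and leaves the section unchanged.\<close>
  define g where "g b = (if b \<in> exponents i then c b else 0)" for b
  have sg: "s = section_of i g" unfolding s by (rule section_of_cong) (simp add: g_def)
  have "finite {b. g b \<noteq> 0}"
    by (rule finite_subset[OF _ finite_exponents[of i]]) (auto simp: g_def)
  then have g: "g \<in> local_ring" unfolding local_ring_iff using converges_finite_support[of g 1] by auto
  have ge: "N b i \<le> dot (N b) a" if "b \<in> indices C" "g a \<noteq> 0" for a b
    using that by (auto simp: g_def exponents_def split: if_splits)
  have gk: "g (unit_exponent k) \<noteq> 0" using unit_exponent_in_exponents k by (simp add: g_def)
  obtain V where V: "exc_locus C \<subseteq> V" "restricts_to C (column i) V (pullback C g) s"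
    using restricts_to_section_of[OF g ge] unfolding sg by blast
  show "s \<in> admissible_sections C (column i)"
    unfolding admissible_sections_def
  proof (intro CollectI conjI bexI[OF _ g] ballI impI)
    show "s \<in> global_sections C (column i)"
      unfolding global_sections_def using V section_of_outside unfolding sg by blast
    show "\<exists>n. valuation C j g = enat n \<and> column i j = int n" if j: "j \<in> indices C" for j
    proof (intro exI conjI)
      show "valuation C j g = enat (N j i)"
        unfolding valuation_eq_iff[OF g j]
        using ge[OF j] gk same_columnD[OF k(1) j] by (auto simp: dot_unit_exponent)
      show "column i j = int (N j i)" using j by (simp add: column_def)
    qed
    show "\<exists>N. exc_locus C \<subseteq> N \<and> restricts_to C (column i) N (pullback C g) s" using V by blast
    fix a b assume a: "a \<in> indices C" and b: "b \<in> indices C"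
      and ab: "a \<noteq> b \<and> exc_div C a \<inter> exc_div C b \<noteq> {}"
    then obtain p where p: "p \<in> D a" "p \<in> D b" unfolding exc_div_eq by blast
    then obtain \<psi> R y where K: "(\<psi>, R) \<in> K" and y: "p = \<psi> y" using divisor_points points by force
    have "Div a \<in> range R" "Div b \<in> range R" using p divisor[OF K] unfolding y by (metis rangeI)+
    then obtain \<psi>' R' where K': "(\<psi>', R') \<in> K" and ab': "Div a \<in> range R'" "Div b \<in> range R'"
      and nk: "Coord k \<notin> range R'"
      using chart_without_coordinate[OF K] ab by blast
    have in_D: "\<psi>' 0 \<in> D a" "\<psi>' 0 \<in> D b" using ab' divisor[OF K'] by (auto simp: image_iff)
    then have e: "\<psi>' 0 \<in> exc_locus C" unfolding exc_locus_def exc_div_eq using a by blast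
    have "\<psi>' 0 \<notin> zero_locus C s"
    proof
      assume "\<psi>' 0 \<in> zero_locus C s"
      then obtain \<phi> z where \<phi>: "\<psi>' 0 = \<phi> z" "\<phi> \<in> atlas (sky C)" "s (\<phi>, z) = 0"
        unfolding zero_locus_def by blast
      have "\<psi>' = \<phi>" using centre[OF K' chart_of_atlas[OF \<phi>(2)]] \<phi>(1) by auto
      then have "z = 0" using \<phi>(1) inj_chart[OF K'] by (metis injD)
      with \<open>\<psi>' = \<phi>\<close> \<phi>(3) have "s (\<psi>', 0) = 0" by simp
      with section_of_at_centre[OF K' k(1) nk e] k(2) show False unfolding s by simp
    qed
    with in_D show "\<not> exc_div C a \<inter> exc_div C b \<subseteq> zero_locus C s" unfolding exc_div_eq by blast
  qed
qed

end

section \<open>Separating coefficients of sections\<close>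

text \<open>Continuity refers to pointwise convergence, the topology on sections; it makes the later
  retraction continuous.\<close>

definition linear_functional :: "(('a \<Rightarrow> complex) \<Rightarrow> complex) \<Rightarrow> bool" where
  "linear_functional \<phi> \<longleftrightarrow> continuous_on UNIV \<phi> \<and> (\<forall>f g. \<phi> (\<lambda>x. f x + g x) = \<phi> f + \<phi> g) \<and>
     (\<forall>c f. \<phi> (\<lambda>x. c * f x) = c * \<phi> f)"

lemma linear_functional_eval: "linear_functional (\<lambda>f. f x)"
  by (simp add: linear_functional_def)

lemma linear_functional_combination:
  "linear_functional \<phi> \<Longrightarrow> linear_functional \<mu> \<Longrightarrow> linear_functional (\<lambda>f. \<alpha> * \<phi> f + \<beta> * \<mu> f)"
  unfolding linear_functional_def by (auto intro!: continuous_intros simp: algebra_simps)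

lemma linear_functional_sum:
  "finite P \<Longrightarrow> (\<And>b. b \<in> P \<Longrightarrow> linear_functional (\<phi> b)) \<Longrightarrow> linear_functional (\<lambda>f. \<Sum>b\<in>P. c b * \<phi> b f)"
proof (induction P rule: finite_induct)
  case empty
  show ?case by (simp add: linear_functional_def)
next
  case (insert b P)
  then have "linear_functional (\<lambda>f. c b * \<phi> b f + 1 * (\<Sum>b\<in>P. c b * \<phi> b f))"
    by (intro linear_functional_combination) auto
  with insert.hyps show ?case by simp
qed

lemma linear_functional_apply_sum:
  assumes "linear_functional \<phi>"
  shows "\<phi> (\<lambda>x. \<Sum>b\<in>P. c b * f b x) = (\<Sum>b\<in>P. c b * \<phi> (f b))"
proof (induction P rule: infinite_finite_induct)
  case (insert b P)
  then show ?case using assms unfolding linear_functional_def by simp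
next
  case empty
  have "\<phi> (\<lambda>x. 0 * undefined x) = 0 * \<phi> undefined" using assms unfolding linear_functional_def by blast
  then show ?case by simp
next
  case (infinite P)
  have "\<phi> (\<lambda>x. 0 * undefined x) = 0 * \<phi> undefined" using assms unfolding linear_functional_def by blast
  with infinite show ?case by simp
qed

text \<open>The new function minus its projection to the earlier ones is nonzero at some point.
  Evaluating there after this projection, with a normalization, gives the new functional; the
  earlier ones are corrected by multiples of it.\<close>

lemma dual_functionals:
  assumes "finite P" and "\<And>c. (\<And>x. (\<Sum>b\<in>P. c b * f b x) = 0) \<Longrightarrow> \<forall>b\<in>P. c b = (0::complex)"
  shows "\<exists>\<phi>. \<forall>b\<in>P. linear_functional (\<phi> b) \<and> (\<forall>b'\<in>P. \<phi> b (f b') = (if b' = b then 1 else 0))"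
  using assms
proof (induction P rule: finite_induct)
  case empty
  show ?case by simp
next
  case (insert p P)
  have "\<forall>b\<in>P. c b = 0" if c: "\<And>x. (\<Sum>b\<in>P. c b * f b x) = 0" for c
  proof -
    let ?c = "c(p := 0)"
    have "(\<Sum>b\<in>insert p P. ?c b * f b x) = 0" for x
    proof -
      have "(\<Sum>b\<in>P. ?c b * f b x) = (\<Sum>b\<in>P. c b * f b x)"
        by (rule sum.cong) (use insert.hyps in auto)
      then show ?thesis using insert.hyps c by simp
    qed
    from insert.prems[OF this] have "\<forall>b\<in>P. ?c b = 0" by blast
    moreover have "?c b = c b" if "b \<in> P" for b using that insert.hyps by auto
    ultimately show ?thesis by metis
  qed
  from insert.IH[OF this] obtain \<phi> where \<phi>: "\<And>b. b \<in> P \<Longrightarrow> linear_functional (\<phi> b)"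
    "\<And>b b'. b \<in> P \<Longrightarrow> b' \<in> P \<Longrightarrow> \<phi> b (f b') = (if b' = b then 1 else 0)" by blast
  define d where "d b = (if b = p then 1 else - \<phi> b (f p))" for b
  have "\<not> (\<forall>b\<in>insert p P. d b = 0)" by (simp add: d_def)
  then obtain x where x: "(\<Sum>b\<in>insert p P. d b * f b x) \<noteq> 0" using insert.prems by blast
  define w where "w = (\<Sum>b\<in>insert p P. d b * f b x)"
  have dP: "(\<Sum>b\<in>P. d b * f b x) = - (\<Sum>b\<in>P. f b x * \<phi> b (f p))"
    unfolding sum_negf[symmetric] by (rule sum.cong) (use insert.hyps in \<open>auto simp: d_def\<close>)
  have w: "w = f p x - (\<Sum>b\<in>P. f b x * \<phi> b (f p))"
    unfolding w_def using insert.hyps dP by (simp add: d_def)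
  define \<mu> where "\<mu> h = (1 / w) * h x + (- 1 / w) * (\<Sum>b\<in>P. f b x * \<phi> b h)" for h
  have lin: "linear_functional \<mu>"
    unfolding \<mu>_def
    by (intro linear_functional_combination linear_functional_eval linear_functional_sum insert.hyps \<phi>)
  have w0: "w \<noteq> 0" using x by (simp add: w_def)
  have "\<mu> (f p) = (1 / w) * (f p x - (\<Sum>b\<in>P. f b x * \<phi> b (f p)))"
    by (simp add: \<mu>_def algebra_simps)
  then have \<mu>p: "\<mu> (f p) = 1" using w w0 by simp
  have \<mu>P: "\<mu> (f b) = 0" if b: "b \<in> P" for b
  proof -
    have "(\<Sum>a\<in>P. f a x * \<phi> a (f b)) = (\<Sum>a\<in>P. if a = b then f b x else 0)"
      by (rule sum.cong) (use \<phi>(2) b in auto)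
    then show ?thesis using b insert.hyps by (simp add: \<mu>_def)
  qed
  let ?\<phi> = "\<lambda>b. if b = p then \<mu> else (\<lambda>h. 1 * \<phi> b h + (- \<phi> b (f p)) * \<mu> h)"
  show ?case
  proof (intro exI[of _ ?\<phi>] ballI conjI)
    fix b assume b: "b \<in> insert p P"
    show "linear_functional (?\<phi> b)"
      using b lin \<phi>(1) linear_functional_combination[of "\<phi> b" \<mu> 1 "- \<phi> b (f p)"] by auto
    fix b' assume "b' \<in> insert p P"
    then show "?\<phi> b (f b') = (if b' = b then 1 else 0)"
      using b \<mu>p \<mu>P \<phi>(2) insert.hyps by auto
  qed
qed

text \<open>A zero of \<open>P\<close> is one of \<open>Q\<close>; it is divided out of both, and at
  the zero itself the relation is restored by continuity. Once \<open>P\<close> has no zero, neither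
  has \<open>Q\<close>, and both are constant by the fundamental theorem of algebra.\<close>

lemma unit_quotient_constant:
  fixes P Q :: "complex poly" and u :: "complex \<Rightarrow> complex"
  assumes "P \<noteq> 0" "continuous_on UNIV u" "\<And>t. u t \<noteq> 0" "\<And>t. poly Q t = u t * poly P t"
  shows "u s = u t"
  using assms
proof (induction "degree P" arbitrary: P Q rule: less_induct)
  case less
  show ?case
  proof (cases "\<exists>z. poly P z = 0")
    case True
    then obtain z where z: "poly P z = 0" by blast
    with less.prems(4)[of z] have "poly Q z = 0" by simp
    with z obtain P' Q' where P': "P = [:- z, 1:] * P'" and Q': "Q = [:- z, 1:] * Q'"
      by (meson poly_eq_0_iff_dvd dvdE)
    have P'0: "P' \<noteq> 0" using less.prems(1) P' by auto
    have off: "poly Q' t = u t * poly P' t" if "t \<noteq> z" for t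
    proof -
      have "(t - z) * poly Q' t = (t - z) * (u t * poly P' t)"
        using less.prems(4)[of t] by (simp add: P' Q' algebra_simps)
      then show ?thesis using that by simp
    qed
    show ?thesis
    proof (rule less.hyps[of P' Q'])
      show "degree P' < degree P" unfolding P' using P'0 by (subst degree_mult_eq) auto
      show "poly Q' t = u t * poly P' t" for t
      proof (cases "t = z")
        case True
        have c: "continuous (at z) (\<lambda>t. poly Q' t)" "continuous (at z) (\<lambda>t. u t * poly P' t)"
          using less.prems(2) by (auto intro!: continuous_intros simp: continuous_on_eq_continuous_at)
        have "\<forall>\<^sub>F t in at z. poly Q' t = u t * poly P' t"
          using off by (simp add: eventually_at_filter)
        then have "((\<lambda>t. u t * poly P' t) \<longlongrightarrow> poly Q' z) (at z)"
          using c(1) unfolding continuous_at by (rule tendsto_cong[THEN iffD1])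
        moreover have "((\<lambda>t. u t * poly P' t) \<longlongrightarrow> u z * poly P' z) (at z)"
          using c(2) unfolding continuous_at .
        ultimately show ?thesis using True tendsto_unique[OF at_neq_bot] by metis
      qed (use off in auto)
    qed (use less.prems P'0 in auto)
  next
    case False
    then have "constant (poly P)" using fundamental_theorem_of_algebra by blast
    moreover have "constant (poly Q)"
      using False less.prems(3,4) fundamental_theorem_of_algebra[of Q] by (metis mult_eq_0_iff)
    ultimately have "u s * poly P t = u t * poly P t"
      using less.prems(4)[of s] less.prems(4)[of t] unfolding constant_def by metis
    then show ?thesis using False by auto
  qed
qed

section \<open>Recovering sections from single components\<close>

context constellation
begin

text \<open>The exponents whose monomials do not vanish identically on the b-th divisor: their
  reduced exponent at its hyperplane is 0.\<close>

definition visible :: "'d \<Rightarrow> nat \<Rightarrow> ('d \<Rightarrow> nat) set" where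
  "visible i b = {a \<in> exponents i. dot (N b) a = N b i}"

lemma section_of_on_divisor:
  assumes K: "(\<psi>, R) \<in> K" and l: "R l0 = Div b" and y: "y $ l0 = 0"
  shows "section_of i c (\<psi>, y) =
    (\<Sum>a\<in>visible i b. c a * (\<Prod>l\<in>UNIV. y $ l ^ (dot (rows R l) a - weight i R l)))"
proof -
  have e: "\<psi> y \<in> exc_locus C" using exc_locus_iff[OF K] l y by blast
  show ?thesis
    unfolding section_of_chart[OF K e]
  proof (rule sum.mono_neutral_right[OF finite_exponents])
    show "\<forall>a\<in>exponents i - visible i b. c a * (\<Prod>l\<in>UNIV. y $ l ^ (dot (rows R l) a - weight i R l)) = 0"
    proof
      fix a assume a: "a \<in> exponents i - visible i b"
      then have "dot (rows R l0) a - weight i R l0 > 0"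
        using weight_le_dot[OF K, of a i l0] l by (auto simp: visible_def)
      then have "y $ l0 ^ (dot (rows R l0) a - weight i R l0) = 0" using y by simp
      then have "(\<Prod>l\<in>UNIV. y $ l ^ (dot (rows R l) a - weight i R l)) = 0" by (intro prod_zero) auto
      then show "c a * (\<Prod>l\<in>UNIV. y $ l ^ (dot (rows R l) a - weight i R l)) = 0" by simp
    qed
  qed (auto simp: visible_def)
qed

text \<open>The visible monomials have distinct reduced exponents and do not involve the coordinate
  \<open>y $ l0\<close>, so a combination vanishing on the hyperplane vanishes everywhere.\<close>

lemma section_of_independent:
  assumes K: "(\<psi>, R) \<in> K" and l: "R l0 = Div b"
    and z: "\<And>y. y $ l0 = 0 \<Longrightarrow> section_of i c (\<psi>, y) = 0" and a: "a \<in> visible i b"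
  shows "c a = 0"
proof (rule monomials_independent[where E = "\<lambda>a l. dot (rows R l) a - weight i R l" and P = "visible i b"])
  show "finite (visible i b)" using finite_exponents by (simp add: visible_def)
  show "inj_on (\<lambda>a l. dot (rows R l) a - weight i R l) (visible i b)"
  proof (rule inj_onI)
    fix a a' assume h: "a \<in> visible i b" "a' \<in> visible i b"
      "(\<lambda>l. dot (rows R l) a - weight i R l) = (\<lambda>l. dot (rows R l) a' - weight i R l)"
    have "dot (rows R l) a = dot (rows R l) a'" for l
      using fun_cong[OF h(3), of l] weight_le_dot[OF K, of a i l] weight_le_dot[OF K, of a' i l] h(1,2)
      by (simp add: visible_def)
    then show "a = a'" by (rule nondegenerate_dot_inj[OF nondeg[OF K]])
  qed
  fix y :: "complex^'d"
  let ?y = "\<chi> l. if l = l0 then 0 else y $ l"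
  have "(\<Prod>l\<in>UNIV. y $ l ^ (dot (rows R l) a - weight i R l)) =
      (\<Prod>l\<in>UNIV. ?y $ l ^ (dot (rows R l) a - weight i R l))" if "a \<in> visible i b" for a
    by (rule prod.cong) (use that l in \<open>auto simp: visible_def\<close>)
  then show "(\<Sum>a\<in>visible i b. c a * (\<Prod>l\<in>UNIV. y $ l ^ (dot (rows R l) a - weight i R l))) = 0"
    using z[of ?y] section_of_on_divisor[OF K l, of ?y i c] by simp
qed fact

text \<open>The relevant linear terms are seen on every component, which ties the components
  together.\<close>

lemma unit_exponent_visible: "k \<in> same_column i \<Longrightarrow> b \<in> indices C \<Longrightarrow> unit_exponent k \<in> visible i b"
  using unit_exponent_in_exponents same_columnD by (simp add: visible_def dot_unit_exponent)

text \<open>The first divisor in a single chart suffices to read off these coefficients: the visible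
  monomials are independent functions there, and their dual functionals are composed with the
  restriction \<open>?r\<close>.\<close>

lemma coefficient_functionals:
  "\<exists>\<phi>. \<forall>k\<in>same_column i. linear_functional (\<phi> k) \<and> (\<forall>c. \<phi> k (section_of i c) = c (unit_exponent k))"
proof -
  have one: "1 \<in> indices C" using nonempty by (simp add: Suc_leI)
  obtain \<psi> R l0 where K: "(\<psi>, R) \<in> K" and l: "R l0 = Div 1" using label_exists[of 1] one by force
  let ?r = "\<lambda>s y. if y $ l0 = 0 then s (\<psi>, y) else 0 :: complex"
  let ?f = "\<lambda>a. ?r (basic_section i a)"
  have sec': "section_of i c (\<psi>, y) = (\<Sum>a\<in>visible i 1. c a * ?f a y)" if y: "y $ l0 = 0" for c y
  proof -
    have "section_of i c (\<psi>, y) = section_of i (\<lambda>a. if a \<in> visible i 1 then c a else 0) (\<psi>, y)"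
      unfolding section_of_on_divisor[OF K l y] by (rule sum.cong) auto
    also have "\<dots> = (\<Sum>a\<in>exponents i. if a \<in> visible i 1 then c a * ?f a y else 0)"
      unfolding section_of_def using y by (intro sum.cong) auto
    also have "\<dots> = (\<Sum>a\<in>visible i 1. c a * ?f a y)"
      by (subst sum.inter_filter[symmetric]) (auto simp: finite_exponents visible_def intro: sum.cong)
    finally show ?thesis .
  qed
  have "\<exists>\<phi>. \<forall>a\<in>visible i 1. linear_functional (\<phi> a) \<and>
      (\<forall>a'\<in>visible i 1. \<phi> a (?f a') = (if a' = a then 1 else 0))"
  proof (rule dual_functionals)
    show "finite (visible i 1)" using finite_exponents by (simp add: visible_def)
    fix c assume c: "\<And>y. (\<Sum>a\<in>visible i 1. c a * ?f a y) = 0"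
    have "section_of i c (\<psi>, y) = 0" if "y $ l0 = 0" for y using sec'[OF that] c by simp
    then show "\<forall>a\<in>visible i 1. c a = 0" using section_of_independent[OF K l] by blast
  qed
  then obtain \<phi> where \<phi>: "\<And>a. a \<in> visible i 1 \<Longrightarrow> linear_functional (\<phi> a)"
    "\<And>a a'. a \<in> visible i 1 \<Longrightarrow> a' \<in> visible i 1 \<Longrightarrow> \<phi> a (?f a') = (if a' = a then 1 else 0)" by blast
  have cont_r: "continuous_on UNIV ?r"
  proof (rule continuous_on_coordinatewise_then_product)
    fix y show "continuous_on UNIV (\<lambda>s. ?r s y)" by (cases "y $ l0 = 0") simp_all
  qed
  show ?thesis
  proof (intro exI[of _ "\<lambda>k s. \<phi> (unit_exponent k) (?r s)"] ballI conjI allI)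
    fix k assume k: "k \<in> same_column i"
    note v = unit_exponent_visible[OF k one]
    note lin = \<phi>(1)[OF v]
    have lin_add: "\<phi> (unit_exponent k) (\<lambda>x. f x + g x) = \<phi> (unit_exponent k) f + \<phi> (unit_exponent k) g"
      and lin_scale: "\<phi> (unit_exponent k) (\<lambda>x. \<alpha> * f x) = \<alpha> * \<phi> (unit_exponent k) f" for f g \<alpha>
      using lin unfolding linear_functional_def by blast+
    have add: "?r (\<lambda>x. f x + g x) = (\<lambda>y. ?r f y + ?r g y)" for f g
      by (simp add: fun_eq_iff)
    have scale: "?r (\<lambda>x. \<alpha> * f x) = (\<lambda>y. \<alpha> * ?r f y)" for f \<alpha>
      by (simp add: fun_eq_iff)
    show "linear_functional (\<lambda>s. \<phi> (unit_exponent k) (?r s))"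
      unfolding linear_functional_def
    proof (intro conjI allI)
      show "continuous_on UNIV (\<lambda>s. \<phi> (unit_exponent k) (?r s))"
        using lin by (intro continuous_on_compose2[OF _ cont_r]) (auto simp: linear_functional_def)
      fix f g and \<alpha> :: complex
      show "\<phi> (unit_exponent k) (?r (\<lambda>x. f x + g x)) = \<phi> (unit_exponent k) (?r f) + \<phi> (unit_exponent k) (?r g)"
        unfolding add[of f g] by (rule lin_add)
      show "\<phi> (unit_exponent k) (?r (\<lambda>x. \<alpha> * f x)) = \<alpha> * \<phi> (unit_exponent k) (?r f)"
        unfolding scale[of \<alpha> f] by (rule lin_scale)
    qed
    fix c
    have "?r (section_of i c) = (\<lambda>y. \<Sum>a\<in>visible i 1. c a * ?f a y)"
      using sec' by (auto simp: fun_eq_iff)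
    then have "\<phi> (unit_exponent k) (?r (section_of i c)) = (\<Sum>a\<in>visible i 1. c a * \<phi> (unit_exponent k) (?f a))"
      using linear_functional_apply_sum[OF lin, of c ?f "visible i 1"] by simp
    also have "\<dots> = (\<Sum>a\<in>visible i 1. if a = unit_exponent k then c a else 0)"
      by (rule sum.cong) (use \<phi>(2)[OF v] in auto)
    also have "\<dots> = c (unit_exponent k)"
      using v finite_exponents by (simp add: visible_def)
    finally show "\<phi> (unit_exponent k) (?r (section_of i c)) = c (unit_exponent k)" .
  qed
qed

text \<open>On a line through a point where \<open>s'\<close> does not vanish, a local equation \<open>s = u s'\<close> with a unit
  \<open>u\<close> is one between polynomials in one variable, hence \<open>u\<close> is constant on the line.\<close>

lemma zero_divisor_chart_constant:
  assumes K: "(\<psi>, R) \<in> K" and l: "R l0 = Div b" and c': "admissible i c'"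
    and z: "zero_divisor C (section_of i c) = zero_divisor C (section_of i c')"
  obtains \<kappa> where "\<kappa> \<noteq> 0" "\<And>y. y $ l0 = 0 \<Longrightarrow> section_of i c (\<psi>, y) = \<kappa> * section_of i c' (\<psi>, y)"
proof -
  have b: "b \<in> indices C" using labels[OF K l] by auto
  have \<psi>: "\<psi> \<in> atlas (sky C)" using K atlas by force
  have on: "\<psi> y \<in> exc_div C b \<longleftrightarrow> y $ l0 = 0" for y
    unfolding exc_div_eq divisor[OF K] using label_unique[OF K l] l by auto
  define h where "h y = (if \<psi> y \<in> exc_div C b then section_of i c (\<psi>, y) else 0)" for y
  \<comment> \<open>The section itself is a local equation, with the unit 1; as the two sets agree,
    it is a unit multiple of the other section.\<close>
  have "h \<in> zero_divisor C (section_of i c) b \<psi>"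
    unfolding zero_divisor_def using b \<psi> holomorphic_sev_const[OF open_UNIV, of 1]
    by (auto simp: h_def intro!: exI[of _ "\<lambda>_. 1"])
  then have "h \<in> zero_divisor C (section_of i c') b \<psi>" unfolding z .
  then obtain u where u: "holomorphic_sev u UNIV" "\<And>y. u y \<noteq> 0"
    "\<And>y. \<psi> y \<in> exc_div C b \<Longrightarrow> h y = u y * section_of i c' (\<psi>, y)"
    unfolding zero_divisor_def using b \<psi> by auto
  have eq: "section_of i c (\<psi>, y) = u y * section_of i c' (\<psi>, y)" if "y $ l0 = 0" for y
    using u(3)[of y] that on[of y] by (simp add: h_def)
  obtain k where k: "k \<in> same_column i" "c' (unit_exponent k) \<noteq> 0" using c' by (auto simp: admissible_def)
  obtain y0 where y0: "y0 $ l0 = 0" "section_of i c' (\<psi>, y0) \<noteq> 0"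
    using section_of_independent[OF K l, of i c'] unit_exponent_visible[OF k(1) b] k(2) by metis
  have "u y = u y0" if y: "y $ l0 = 0" for y
  proof -
    let ?p = "\<lambda>t. y0 + t *s (y - y0)"
    define pol where "pol c = (\<Sum>a\<in>visible i b. [:c a:] *
      (\<Prod>l\<in>UNIV. [:y0 $ l, y $ l - y0 $ l:] ^ (dot (rows R l) a - weight i R l)))" for c
    have p0: "?p t $ l0 = 0" for t using y y0 by simp
    have pol: "poly (pol c) t = section_of i c (\<psi>, ?p t)" for c t
      unfolding section_of_on_divisor[OF K l p0] pol_def
      by (simp add: poly_sum poly_prod algebra_simps)
    have "u (?p 1) = u (?p 0)"
    proof (rule unit_quotient_constant[of "pol c'" "\<lambda>t. u (?p t)" "pol c"])
      show "pol c' \<noteq> 0"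
      proof
        assume "pol c' = 0"
        then have "poly (pol c') 0 = 0" by simp
        then show False using y0(2) by (simp add: pol)
      qed
      show "continuous_on UNIV (\<lambda>t. u (?p t))"
      proof (rule continuous_on_compose2[OF holomorphic_sev_imp_continuous_on[OF u(1)]])
        have "continuous_on UNIV (\<lambda>t. \<chi> l. y0 $ l + t * (y - y0) $ l)"
          by (intro continuous_intros)
        moreover have "(\<lambda>t. \<chi> l. y0 $ l + t * (y - y0) $ l) = ?p"
          by (simp add: fun_eq_iff vec_eq_iff algebra_simps)
        ultimately show "continuous_on UNIV ?p" by (rule back_subst[of "continuous_on UNIV"])
      qed auto
      show "poly (pol c) t = u (?p t) * poly (pol c') t" for t
        unfolding pol by (rule eq[OF p0])
    qed (rule u(2))
    then show ?thesis by simp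
  qed
  with eq u(2)[of y0] show thesis by (intro that[of "u y0"]) auto
qed

text \<open>On each divisor in each chart the sections are proportional. The coefficient of one
  fixed coordinate, visible on all divisors, shows that the factor is always \<kappa>.\<close>

lemma zero_divisor_eq_imp_proportional:
  assumes c: "admissible i c" and c': "admissible i c'"
    and z: "zero_divisor C (section_of i c) = zero_divisor C (section_of i c')"
  shows "line (section_of i c) = line (section_of i c')"
proof -
  obtain k where k: "k \<in> same_column i" "c' (unit_exponent k) \<noteq> 0" using c' by (auto simp: admissible_def)
  define \<kappa> where "\<kappa> = c (unit_exponent k) / c' (unit_exponent k)"
  have main: "\<kappa> \<noteq> 0 \<and> (\<forall>y. y $ l0 = 0 \<longrightarrow> section_of i c (\<psi>, y) = \<kappa> * section_of i c' (\<psi>, y))"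
    if K: "(\<psi>, R) \<in> K" and l: "R l0 = Div b" for \<psi> R l0 b
  proof -
    have b: "b \<in> indices C" using labels[OF K l] by auto
    obtain \<kappa>' where \<kappa>': "\<kappa>' \<noteq> 0" "\<And>y. y $ l0 = 0 \<Longrightarrow> section_of i c (\<psi>, y) = \<kappa>' * section_of i c' (\<psi>, y)"
      using zero_divisor_chart_constant[OF K l c' z] by blast
    \<comment> \<open>The section with these combined coefficients vanishes on the hyperplane, hence
      so does its coefficient at the k-th coordinate.\<close>
    have "1 * c (unit_exponent k) + (- \<kappa>') * c' (unit_exponent k) = 0"
    proof (rule section_of_independent[OF K l _ unit_exponent_visible[OF k(1) b],
          where c = "\<lambda>b. 1 * c b + (- \<kappa>') * c' b"])
      show "section_of i (\<lambda>b. 1 * c b + (- \<kappa>') * c' b) (\<psi>, y) = 0" if "y $ l0 = 0" for y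
        unfolding section_of_linear using \<kappa>'(2)[OF that] by simp
    qed
    then have "\<kappa>' = \<kappa>" using k(2) by (simp add: \<kappa>_def field_simps)
    with \<kappa>' show ?thesis by blast
  qed
  have one: "1 \<in> indices C" using nonempty by (simp add: Suc_leI)
  obtain \<psi>1 R1 l1 where "(\<psi>1, R1) \<in> K" "R1 l1 = Div 1" using label_exists[of 1] one by force
  then have \<kappa>0: "\<kappa> \<noteq> 0" using main by blast
  have "section_of i c x = \<kappa> * section_of i c' x" for x
  proof -
    obtain \<psi> y where x: "x = (\<psi>, y)" by (cases x)
    show ?thesis
    proof (cases "\<psi> \<in> atlas (sky C) \<and> \<psi> y \<in> exc_locus C")
      case True
      then obtain R where K: "(\<psi>, R) \<in> K" using chart_of_atlas by blast
      with True obtain l b where "R l = Div b" "y $ l = 0" using exc_locus_iff by blast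
      with main[OF K] show ?thesis unfolding x by blast
    next
      case False
      then show ?thesis unfolding x by (simp add: section_of_outside)
    qed
  qed
  then have "section_of i c = (\<lambda>x. \<kappa> * section_of i c' x)" by blast
  then show ?thesis using line_scale[OF \<kappa>0] by metis
qed

lemma zero_divisor_scale:
  assumes "\<alpha> \<noteq> 0"
  shows "zero_divisor C (\<lambda>x. \<alpha> * s x) = zero_divisor C s"
proof -
  have sub: "zero_divisor C (\<lambda>x. \<alpha> * s x) j \<psi> \<subseteq> zero_divisor C s j \<psi>" if "\<alpha> \<noteq> 0" for \<alpha> s j \<psi>
  proof
    fix h assume h: "h \<in> zero_divisor C (\<lambda>x. \<alpha> * s x) j \<psi>"
    then have j: "j \<in> indices C \<and> \<psi> \<in> atlas (sky C)" by (auto simp: zero_divisor_def split: if_splits)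
    with h obtain u where u: "\<forall>y. \<psi> y \<notin> exc_div C j \<longrightarrow> h y = 0" "holomorphic_sev u UNIV" "\<forall>y. u y \<noteq> 0"
      "\<forall>y. \<psi> y \<in> exc_div C j \<longrightarrow> h y = u y * (\<alpha> * s (\<psi>, y))"
      unfolding zero_divisor_def by auto
    have "holomorphic_sev (\<lambda>y. u y * \<alpha>) UNIV"
      by (intro holomorphic_sev_mult u(2) holomorphic_sev_const open_UNIV)
    then have "\<exists>u. holomorphic_sev u UNIV \<and> (\<forall>y. u y \<noteq> 0) \<and> (\<forall>y. \<psi> y \<in> exc_div C j \<longrightarrow> h y = u y * s (\<psi>, y))"
      using u(3,4) that by (intro exI[of _ "\<lambda>y. u y * \<alpha>"]) (simp add: mult.assoc)
    then show "h \<in> zero_divisor C s j \<psi>" unfolding zero_divisor_def using j u(1) by simp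
  qed
  show ?thesis
  proof (intro ext equalityI)
    fix j \<psi>
    show "zero_divisor C (\<lambda>x. \<alpha> * s x) j \<psi> \<subseteq> zero_divisor C s j \<psi>" by (rule sub[OF assms])
    have "zero_divisor C (\<lambda>x. (1 / \<alpha>) * (\<alpha> * s x)) j \<psi> \<subseteq> zero_divisor C (\<lambda>x. \<alpha> * s x) j \<psi>"
      by (rule sub) (use assms in simp)
    then show "zero_divisor C s j \<psi> \<subseteq> zero_divisor C (\<lambda>x. \<alpha> * s x) j \<psi>" using assms by simp
  qed
qed

end

section \<open>The topology of the space of traces\<close>

lemma homeomorphic_pullback_topology:
  assumes inj: "inj_on f A" and im: "f ` A \<subseteq> topspace T"
  shows "pullback_topology A f T homeomorphic_space subtopology T (f ` A)"
proof -
  have top: "topspace (pullback_topology A f T) = A"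
    using im by (auto simp: topspace_pullback_topology)
  have top': "topspace (subtopology T (f ` A)) = f ` A" using im by auto
  have "homeomorphic_map (pullback_topology A f T) (subtopology T (f ` A)) f"
  proof (rule bijective_open_imp_homeomorphic_map)
    show "continuous_map (pullback_topology A f T) (subtopology T (f ` A)) f"
      unfolding continuous_map_in_subtopology
    proof
      show "continuous_map (pullback_topology A f T) T f"
        unfolding continuous_map_alt
      proof (intro conjI allI impI)
        fix U assume "openin T U"
        then show "openin (pullback_topology A f T) (f -` U \<inter> topspace (pullback_topology A f T))"
          unfolding top openin_pullback_topology by blast
      qed (use im top in auto)
    qed (simp add: top)
    show "open_map (pullback_topology A f T) (subtopology T (f ` A)) f"
      unfolding open_map_def
    proof (intro allI impI)
      fix U assume "openin (pullback_topology A f T) U"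
      then obtain W where W: "openin T W" "U = f -` W \<inter> A" unfolding openin_pullback_topology by blast
      have "f ` U = W \<inter> f ` A" unfolding W(2) by auto
      then show "openin (subtopology T (f ` A)) (f ` U)" using W(1) by (auto simp: openin_subtopology)
    qed
  qed (use top top' inj in auto)
  then show ?thesis unfolding homeomorphic_space using homeomorphic_map_imp_homeomorphic_space homeomorphic_space by blast
qed

context constellation
begin

lemma global_sections_scale:
  assumes "s \<in> global_sections C v"
  shows "(\<lambda>x. c * s x) \<in> global_sections C v"
proof -
  have "restricts_to C v U (\<lambda>p. c * f p) (\<lambda>x. c * s x)" if r: "restricts_to C v U f s" for U f
    unfolding restricts_to_def
  proof (intro conjI ballI)
    show opn: "openin (manifold_topology (sky C)) U" using r by (simp add: restricts_to_def)
    fix \<psi> assume \<psi>: "\<psi> \<in> atlas (sky C)"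
    then obtain F where F: "local_trivialization C v U f \<psi> F" "\<And>y. y \<in> \<psi> -` (U \<inter> exc_locus C) \<Longrightarrow> s (\<psi>, y) = F y"
      using r unfolding restricts_to_def by metis
    have o: "open (\<psi> -` U)" using opn \<psi> by (simp add: openin_manifold_topology)
    show "\<exists>F. local_trivialization C v U (\<lambda>p. c * f p) \<psi> F \<and> (\<forall>y\<in>\<psi> -` (U \<inter> exc_locus C). c * s (\<psi>, y) = F y)"
    proof (intro exI[of _ "\<lambda>y. c * F y"] conjI ballI)
      show "local_trivialization C v U (\<lambda>p. c * f p) \<psi> (\<lambda>y. c * F y)"
        using F(1) holomorphic_sev_mult[OF holomorphic_sev_const[OF o, of c], of F]
        unfolding local_trivialization_def by (auto simp: mult.left_commute)
    qed (use F(2) in auto)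
  qed
  then show ?thesis using assms unfolding global_sections_def by (simp, blast)
qed

lemma punctured_cone_global_sections: "punctured_cone (global_sections C v - {\<lambda>_. 0})"
  unfolding punctured_cone_def using global_sections_scale by (auto simp: fun_eq_iff)

lemma section_of_nonzero: "admissible i c \<Longrightarrow> section_of i c \<noteq> (\<lambda>_. 0)"
proof
  assume "admissible i c" and z: "section_of i c = (\<lambda>_. 0)"
  then obtain k where k: "k \<in> same_column i" "c (unit_exponent k) \<noteq> 0" by (auto simp: admissible_def)
  obtain \<phi> where \<phi>: "linear_functional \<phi>" "\<And>c. \<phi> (section_of i c) = c (unit_exponent k)"
    using coefficient_functionals[of i] k(1) by blast
  have "\<phi> (\<lambda>x. 0 * section_of i c x) = 0 * \<phi> (section_of i c)"
    using \<phi>(1) unfolding linear_functional_def by blast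
  then have "\<phi> (section_of i c) = 0" unfolding z by simp
  with \<phi>(2) k(2) show False by simp
qed

lemma punctured_cone_admissible_sections: "punctured_cone (admissible_sections C (column i))"
  unfolding punctured_cone_def
proof (intro conjI allI impI)
  show "(\<lambda>_. 0) \<notin> admissible_sections C (column i)"
    unfolding admissible_sections_eq using section_of_nonzero by fastforce
  fix \<alpha> :: complex and s assume \<alpha>: "\<alpha> \<noteq> 0" and "s \<in> admissible_sections C (column i)"
  then obtain c where s: "s = section_of i c" "admissible i c" unfolding admissible_sections_eq by blast
  have "(\<lambda>x. \<alpha> * s x) = section_of i (\<lambda>b. \<alpha> * c b + 0 * c b)" unfolding section_of_linear s by simp
  moreover have "admissible i (\<lambda>b. \<alpha> * c b + 0 * c b)" using s(2) \<alpha> by (auto simp: admissible_def)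
  ultimately show "(\<lambda>x. \<alpha> * s x) \<in> admissible_sections C (column i)" unfolding admissible_sections_eq by blast
qed

lemma admissible_line_eq:
  assumes s: "s \<in> admissible_sections C (column i)" and t: "t \<in> admissible_sections C (column i)"
  shows "zero_divisor C s = zero_divisor C t \<longleftrightarrow> line s = line t"
proof
  assume z: "zero_divisor C s = zero_divisor C t"
  obtain c c' where "s = section_of i c" "admissible i c" "t = section_of i c'" "admissible i c'"
    using s t unfolding admissible_sections_eq by blast
  with zero_divisor_eq_imp_proportional[of i c c'] z show "line s = line t" by simp
next
  assume l: "line s = line t"
  have "s \<noteq> (\<lambda>_. 0)" using s punctured_coneD(1)[OF punctured_cone_admissible_sections] by blast
  from line_eqD[OF l this] obtain \<alpha> where "\<alpha> \<noteq> 0" "t = (\<lambda>x. \<alpha> * s x)" by blast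
  then show "zero_divisor C s = zero_divisor C t" using zero_divisor_scale[of \<alpha> s] by simp
qed

lemma section_class_zero_divisor:
  assumes s: "s \<in> admissible_sections C (column i)"
  shows "section_class C (column i) (zero_divisor C s) = line s"
  unfolding section_class_def
proof (rule the_equality)
  show "\<exists>t\<in>admissible_sections C (column i). zero_divisor C t = zero_divisor C s \<and> line t = line s"
    using s by blast
qed (use admissible_line_eq[OF _ s] in blast)

text \<open>\<open>section_class\<close> identifies the divisors with the lines of admissible
  sections; these sections form a punctured cone, so the topology induced from the projective space
  is the quotient topology.\<close>

lemma D_space_homeomorphic:
  "D_space C (column i) homeomorphic_space line_space (admissible_sections C (column i))"
proof -
  let ?A = "admissible_sections C (column i)" and ?G = "global_sections C (column i)"
  let ?Z = "zero_divisor C ` ?A" and ?f = "section_class C (column i)"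
  have im: "?f ` ?Z = line ` ?A"
    unfolding image_image by (rule image_cong) (simp_all add: section_class_zero_divisor)
  have inj: "inj_on ?f ?Z"
  proof (rule inj_onI)
    fix \<delta> \<delta>' assume "\<delta> \<in> ?Z" "\<delta>' \<in> ?Z" and eq: "?f \<delta> = ?f \<delta>'"
    then obtain s t where st: "s \<in> ?A" "t \<in> ?A" "\<delta> = zero_divisor C s" "\<delta>' = zero_divisor C t" by blast
    with eq have "line s = line t" by (simp add: section_class_zero_divisor)
    with st show "\<delta> = \<delta>'" using admissible_line_eq by blast
  qed
  have AG: "?A \<subseteq> ?G - {\<lambda>_. 0}"
  proof -
    have "?A \<subseteq> ?G" unfolding admissible_sections_def by blast
    then show ?thesis using punctured_coneD(1)[OF punctured_cone_admissible_sections] by blast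
  qed
  have proj: "projectivization ?G = line_space (?G - {\<lambda>_. 0})"
    by (simp add: projectivization_def line_space_def)
  have "D_space C (column i) homeomorphic_space subtopology (projectivization ?G) (?f ` ?Z)"
    unfolding D_space_def
    by (rule homeomorphic_pullback_topology[OF inj]) (use AG in \<open>auto simp: im proj\<close>)
  also have "subtopology (projectivization ?G) (?f ` ?Z) = line_space ?A"
    unfolding im proj
    by (rule subtopology_line_space[OF punctured_cone_global_sections punctured_cone_admissible_sections AG])
  finally show ?thesis .
qed

text \<open>\<open>?f\<close> reads off the coefficients of the linear terms in
  \<open>same_column i\<close>, and \<open>?g\<close> builds the section with these terms alone. On
  the segment from \<open>?g (?f s)\<close> to \<open>s\<close> these coefficients are constant, so
  admissibility persists.\<close>

lemma admissible_sections_homotopy_equivalent: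
  "line_space (admissible_sections C (column i)) homotopy_equivalent_space
     line_space (punctured_coord_space (same_column i))"
proof -
  let ?M = "same_column i" and ?A = "admissible_sections C (column i)"
  obtain \<phi> where \<phi>: "\<And>k. k \<in> ?M \<Longrightarrow> linear_functional (\<phi> k)"
    "\<And>k c. k \<in> ?M \<Longrightarrow> \<phi> k (section_of i c) = c (unit_exponent k)"
    using coefficient_functionals[of i] by blast
  \<comment> \<open>The vector \<open>z\<close> is placed at the unit exponents of
    \<open>?M\<close>; all other exponents get the coefficient 0.\<close>
  define coef where "coef z b = (\<Sum>k\<in>?M. if b = unit_exponent k then z k else 0 :: complex)" for z b
  have inj_unit: "unit_exponent k = unit_exponent k' \<longleftrightarrow> k = k'" for k k' :: 'd
    by (auto simp: unit_exponent_def fun_eq_iff split: if_splits)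
  have coef_unit: "coef z (unit_exponent k) = z k" if "k \<in> ?M" for z k
    using that by (simp add: coef_def inj_unit)
  let ?f = "\<lambda>s k. if k \<in> ?M then \<phi> k s else 0"
  let ?g = "\<lambda>z x. \<Sum>k\<in>?M. z k * basic_section i (unit_exponent k) x"
  have g: "?g z = section_of i (coef z)" for z
  proof
    fix x
    have "section_of i (coef z) x = (\<Sum>b\<in>exponents i. \<Sum>k\<in>?M. if b = unit_exponent k then z k * basic_section i b x else 0)"
      unfolding section_of_def coef_def sum_distrib_right by (intro sum.cong) auto
    also have "\<dots> = (\<Sum>k\<in>?M. \<Sum>b\<in>exponents i. if b = unit_exponent k then z k * basic_section i b x else 0)"
      by (rule sum.swap)
    also have "\<dots> = ?g z x"
      by (rule sum.cong) (simp_all add: finite_exponents unit_exponent_in_exponents)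
    finally show "?g z x = section_of i (coef z) x" by simp
  qed
  show ?thesis
  proof (rule line_space_homotopy_equivalent[of ?f _ _ ?g])
    show "homogeneous ?f" using \<phi>(1) by (auto simp: homogeneous_def linear_functional_def fun_eq_iff)
    show "continuous_on UNIV ?f"
    proof (rule continuous_on_coordinatewise_then_product)
      fix k show "continuous_on UNIV (\<lambda>s. ?f s k)"
        using \<phi>(1) by (cases "k \<in> ?M") (auto simp: linear_functional_def)
    qed
    show "homogeneous ?g" by (auto simp: homogeneous_def sum_distrib_left mult.assoc)
    show "continuous_on UNIV ?g" by (intro continuous_intros) auto
    show "?f ` ?A \<subseteq> punctured_coord_space ?M"
    proof
      fix z assume "z \<in> ?f ` ?A"
      then obtain c where c: "admissible i c" "z = ?f (section_of i c)" unfolding admissible_sections_eq by blast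
      then obtain k where k: "k \<in> ?M" "c (unit_exponent k) \<noteq> 0" by (auto simp: admissible_def)
      then have "z k \<noteq> 0" using c(2) \<phi>(2) by simp
      moreover have "z \<in> coord_space ?M" using c(2) by (simp add: coord_space_def)
      ultimately show "z \<in> punctured_coord_space ?M" by auto
    qed
    show "?g ` punctured_coord_space ?M \<subseteq> ?A"
    proof
      fix s assume "s \<in> ?g ` punctured_coord_space ?M"
      then obtain z where z: "z \<in> coord_space ?M" "z \<noteq> (\<lambda>_. 0)" "s = section_of i (coef z)" using g by auto
      then obtain k where "z k \<noteq> 0" by auto
      moreover from this have k: "k \<in> ?M" using z(1) by (auto simp: coord_space_def)
      ultimately have "coef z (unit_exponent k) \<noteq> 0" by (simp add: coef_unit)
      with k have "admissible i (coef z)" by (auto simp: admissible_def)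
      with z(3) show "s \<in> ?A" unfolding admissible_sections_eq by blast
    qed
    show "?f (?g z) = z" if "z \<in> punctured_coord_space ?M" for z
      using that unfolding g by (auto simp: fun_eq_iff \<phi>(2) coef_unit coord_space_def)
    fix t :: real and s assume "s \<in> ?A"
    then obtain c where c: "admissible i c" "s = section_of i c" unfolding admissible_sections_eq by blast
    have gx: "?g z x = section_of i (coef z) x" for z x using fun_cong[OF g] .
    let ?c = "\<lambda>b. of_real t * c b + (1 - of_real t) * coef (?f s) b"
    have "(\<lambda>x. of_real t * s x + (1 - of_real t) * ?g (?f s) x) = section_of i ?c"
      by (simp only: section_of_linear gx c(2))
    moreover have "?c (unit_exponent k) = c (unit_exponent k)" if "k \<in> ?M" for k
      using that \<phi>(2)[OF that] by (simp add: coef_unit c(2) algebra_simps)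
    then have "admissible i ?c" using c(1) by (auto simp: admissible_def)
    ultimately show "(\<lambda>x. of_real t * s x + (1 - of_real t) * ?g (?f s) x) \<in> ?A"
      unfolding admissible_sections_eq by blast
  qed
qed

lemma D_space_euler_characteristic:
  "finite_betti (D_space C (column i))" "euler_characteristic (D_space C (column i)) = int (card (same_column i))"
proof -
  have "D_space C (column i) homotopy_equivalent_space line_space (punctured_coord_space (same_column i))"
    using homeomorphic_imp_homotopy_equivalent_space[OF D_space_homeomorphic]
      admissible_sections_homotopy_equivalent homotopy_eqv_trans by blast
  moreover have "same_column i \<noteq> {}" using same_column_self by blast
  ultimately show "finite_betti (D_space C (column i))"
    "euler_characteristic (D_space C (column i)) = int (card (same_column i))"
    using euler_characteristic_projective_space[of "same_column i"] by simp_all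
qed

end

theorem mainTheorem5:
  fixes C :: "('d::finite) pt list"
  assumes "2 \<le> CARD('d)" and "toric_constellation C"
  shows "(\<forall>v\<in>matrix_columns C. finite_betti (D_space C v)) \<and>
    poincare_series C =
      1 / (\<Prod>v\<in>matrix_columns C. (1 - t_pow (length C) v) powi euler_characteristic (D_space C v))"
proof -
  obtain K N D where "toric_atlas (length C) (sky C) K N D"
    using toric_atlas_level[OF assms order_refl] by blast
  then interpret constellation C K N D
    using assms by (simp add: constellation_def constellation_axioms_def toric_constellation_def)
  let ?t = "\<lambda>v. 1 - t_pow (length C) v"
  \<comment> \<open>Each Euler characteristic counts the coordinates with a given column, so the
    factors regroup to one for each coordinate.\<close>
  have "(\<Prod>v\<in>matrix_columns C. ?t v powi euler_characteristic (D_space C v))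
      = (\<Prod>v\<in>range column. \<Prod>k | k \<in> UNIV \<and> column k = v. ?t (column k))"
    unfolding matrix_columns_eq
  proof (rule prod.cong[OF refl])
    fix v assume "v \<in> range column"
    then obtain i where v: "v = column i" by blast
    have "?t v powi euler_characteristic (D_space C v) = ?t v ^ card (same_column i)"
      unfolding v D_space_euler_characteristic(2) by simp
    also have "\<dots> = (\<Prod>k | k \<in> UNIV \<and> column k = v. ?t (column k))"
      by (simp add: same_column_def v)
    finally show "?t v powi euler_characteristic (D_space C v)
        = (\<Prod>k | k \<in> UNIV \<and> column k = v. ?t (column k))" .
  qed
  also have "\<dots> = (\<Prod>k\<in>UNIV. ?t (column k))"
    by (rule prod.group) auto
  finally have P: "(\<Prod>v\<in>matrix_columns C. ?t v powi euler_characteristic (D_space C v))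
      = (\<Prod>k\<in>UNIV. ?t (column k))" .
  let ?P = "\<Prod>k\<in>UNIV. ?t (column k)"
  \<comment> \<open>The Poincare series itself shows that the product is a unit, so that
    \<open>inverse\<close> does not take its default value 0.\<close>
  have inv: "?P * inverse ?P = 1"
    by (rule mps_inverse) (metis poincare_series_times_prod dvd_triv_right)
  have "poincare_series C = poincare_series C * (?P * inverse ?P)" unfolding inv by simp
  also have "\<dots> = 1 / ?P"
    unfolding mult.assoc[symmetric] poincare_series_times_prod divide_mps_def ..
  finally show ?thesis
    unfolding P using D_space_euler_characteristic(1) by (auto simp: matrix_columns_eq)
qed

end
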